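(* Let $d\ge 1$ be an integer and let $C\subset \mathbb{R}^3$ be a planar tropical curve of degree $d$ having exactly $4d$ unbounded edges. Then the genus of $C$ is at most $(d-1)\cdot(d-2)$.
   Context: A tropical curve $C$ in $\mathbb{R}^n$ is a piecewise linear graph with finitely many vertices, each edge $e$ carrying a positive integer weight $w_e$ and having a direction in $\mathbb{Z}^n$, such that at each vertex $v$ with adjacent edges $e_1,\dots,e_l$ the balancing condition $\sum_i w_{e_i}u_{e_i}=0$ holds, where $u_{e_i}$ is the primitive integer direction of $e_i$ pointing away from $v$. The degree of $C$ is $\sum_e w_e\max_{j}\{0,u_{e,j}\}$, the sum being over unbounded edges $e$, with $u_e$ the primitive integer direction of $e$ pointing to infinity. The genus of a tropical curve is its first Betti number. A tropical plane in $\mathbb{R}^3$ is a tropical linear space of dimension $2$ in $\mathbb{R}^3$ (e.g. a translate of the tropical surface defined by a tropical linear polynomial); $C$ is planar if it is contained in some tropical plane. *)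

theory Defs
  imports "HOL-Analysis.Analysis"
begin

text \<open>Embedded tropical curves in R^3, represented combinatorially:
  V = finite set of vertices (points of R^3),
  E = finite set of bounded edges, each a two-element set {p,q} of vertices (the segment [p,q]),
  R = finite set of unbounded edges, each a pair (p,u): the ray p + t u, t \<ge> 0, u a primitive
      integer vector,
  w, wr = positive integer weights of bounded / unbounded edges.\<close>

definition int_vec :: "int^3 \<Rightarrow> real^3" where
  "int_vec u = (\<chi> i. real_of_int (u $ i))"

definition primitive :: "int^3 \<Rightarrow> bool" where
  "primitive u \<longleftrightarrow> u \<noteq> 0 \<and> (\<forall>k::int. k > 1 \<longrightarrow> \<not> (\<forall>i. k dvd u $ i))"

text \<open>u is the primitive integer direction of the segment from p to q, pointing away from p.\<close>
definition prim_dir :: "real^3 \<Rightarrow> real^3 \<Rightarrow> int^3 \<Rightarrow> bool" where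
  "prim_dir p q u \<longleftrightarrow> primitive u \<and> (\<exists>c>0. q - p = c *\<^sub>R int_vec u)"

definition ray :: "real^3 \<Rightarrow> int^3 \<Rightarrow> (real^3) set" where
  "ray p u = {p + t *\<^sub>R int_vec u | t. t \<ge> 0}"

definition cells ::
  "(real^3) set set \<Rightarrow> ((real^3) \<times> (int^3)) set \<Rightarrow> (real^3) set set" where
  "cells E R = {closed_segment p q | p q. {p, q} \<in> E} \<union> {ray p u | p u. (p, u) \<in> R}"

definition tropical_curve ::
  "(real^3) set \<Rightarrow> (real^3) set set \<Rightarrow> ((real^3) \<times> (int^3)) set
     \<Rightarrow> ((real^3) set \<Rightarrow> nat) \<Rightarrow> ((real^3) \<times> (int^3) \<Rightarrow> nat) \<Rightarrow> bool" where
  "tropical_curve V E R w wr \<longleftrightarrow>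
     finite V \<and> finite E \<and> finite R \<and>
     E \<subseteq> {{p, q} | p q. p \<in> V \<and> q \<in> V \<and> p \<noteq> q} \<and>
     R \<subseteq> {(p, u). p \<in> V \<and> primitive u} \<and>
     (\<forall>e\<in>E. w e > 0) \<and> (\<forall>r\<in>R. wr r > 0) \<and>
     \<comment> \<open>rational slopes\<close>
     (\<forall>p q. {p, q} \<in> E \<longrightarrow> (\<exists>u. prim_dir p q u)) \<and>
     \<comment> \<open>balancing condition at every vertex\<close>
     (\<forall>v\<in>V.
        (\<Sum>q\<in>{q. {v, q} \<in> E}. int (w {v, q}) *s (THE u. prim_dir v q u))
      + (\<Sum>r\<in>{r\<in>R. fst r = v}. int (wr r) *s snd r) = 0) \<and>
     \<comment> \<open>it is an embedded graph: edges meet vertices only at their endpoints,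
         and distinct edges meet only in vertices\<close>
     (\<forall>p q. {p, q} \<in> E \<longrightarrow> closed_segment p q \<inter> V = {p, q}) \<and>
     (\<forall>p u. (p, u) \<in> R \<longrightarrow> ray p u \<inter> V = {p}) \<and>
     (\<forall>c1\<in>cells E R. \<forall>c2\<in>cells E R. c1 \<noteq> c2 \<longrightarrow> c1 \<inter> c2 \<subseteq> V)"

definition support ::
  "(real^3) set \<Rightarrow> (real^3) set set \<Rightarrow> ((real^3) \<times> (int^3)) set \<Rightarrow> (real^3) set" where
  "support V E R = V \<union> \<Union> (cells E R)"

text \<open>Degree: sum over unbounded edges of w_e * max_j {0, u_{e,j}}.\<close>
definition degree ::
  "((real^3) \<times> (int^3)) set \<Rightarrow> ((real^3) \<times> (int^3) \<Rightarrow> nat) \<Rightarrow> nat" where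
  "degree R wr = (\<Sum>r\<in>R. wr r * nat (Max (insert 0 (range (\<lambda>j. snd r $ j)))))"

text \<open>First Betti number of the graph: #edges - #vertices + #connected components
  (unbounded edges are contractible and do not contribute).\<close>
definition adj :: "(real^3) set set \<Rightarrow> ((real^3) \<times> (real^3)) set" where
  "adj E = {(p, q). {p, q} \<in> E}"

definition genus :: "(real^3) set \<Rightarrow> (real^3) set set \<Rightarrow> int" where
  "genus V E = int (card E) - int (card V) + int (card (V // ((adj E)\<^sup>*)))"

text \<open>Tropical planes in R^3: tropical hyperplanes V(max_{i\<in>S} (a_i + x_i)) with x_0 = 0
  and S \<subseteq> {0,1,2,3}, card S \<ge> 2 (the max is attained at least twice).\<close>
definition coord :: "real^3 \<Rightarrow> nat \<Rightarrow> real" where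
  "coord x i = (if i = 0 then 0 else if i = 1 then x $ 1 else if i = 2 then x $ 2 else x $ 3)"

definition tropical_plane :: "(real^3) set \<Rightarrow> bool" where
  "tropical_plane P \<longleftrightarrow> (\<exists>S (a :: nat \<Rightarrow> real). S \<subseteq> {0..3} \<and> card S \<ge> 2 \<and>
     P = {x. \<exists>i\<in>S. \<exists>j\<in>S. i \<noteq> j \<and> a j + coord x j = a i + coord x i \<and>
                 (\<forall>k\<in>S. a k + coord x k \<le> a i + coord x i)})"

definition planar ::
  "(real^3) set \<Rightarrow> (real^3) set set \<Rightarrow> ((real^3) \<times> (int^3)) set \<Rightarrow> bool" where
  "planar V E R \<longleftrightarrow> (\<exists>P. tropical_plane P \<and> support V E R \<subseteq> P)"

end

theory Submission
  imports Defs
begin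

text \<open>
  Balancing forces the \<open>4 d\<close> unbounded edges to be rays of weight 1, \<open>d\<close> in each of the four
  directions of a generic tropical plane, and any tropical plane containing the curve may be replaced
  by a generic one. On a generic plane take the coordinates \<open>y_i \<ge> 0\<close> (at most two of them
  nonzero), sweep by the levels of a generic positive combination of the \<open>y_i\<close>, and orient all
  edges upwards. To the edges crossing a level attach the number \<open>D\<^sup>2 - \<Sum> p_ij p_ji\<close>, where
  \<open>p_ij\<close> is the \<open>i\<close>-component of the total weighted direction in the face \<open>(i, j)\<close> and \<open>D\<close> the
  degree so far, plus the signed determinants of all pairs of edges in a common face. It starts at
  0, ends at \<open>d\<^sup>2\<close>, and its jump at a vertex is at least the local self-intersection number, which in
  turn is compared with the valency by Pick-type inequalities. Only at the apex of the plane can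
  this number be negative, and there it costs at most \<open>(d - 1) (d - 2)\<close>.
  This yields \<open>\<Sum> (val v - 2) \<le> 2 d\<^sup>2 - 2 d + 2\<close>, which is the genus bound for a connected
  curve; the bound is superadditive in the degree, so it passes to disjoint unions.
\<close>

section \<open>Lattice inequalities\<close>

text \<open>The bookkeeping imitates logarithmic adjunction. A smooth curve of degree
  \<open>d\<close> in the projective plane that meets four lines transversally in
  \<open>n = 4 d\<close> points satisfies \<open>2 g - 2 + n = d^2 + d\<close>: the
  self-intersection gives \<open>d^2\<close>, the canonical class \<open>- 3 d\<close>, the four
  lines \<open>4 d\<close>. Hence \<open>potential\<close> is the self-intersection plus the degree;
  the added excess of the weights over 1 vanishes once only rays of weight 1 cross. Everything is
  scaled by 4, since faces and pairs of edges are summed in both orders. Adjunction alone would give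
  the genus bound \<open>(d - 1) (d - 2) / 2\<close>, and the correction at the apex doubles it. The
  obstacle is that a curve cannot in general be moved off itself inside a tropical plane. The sweep
  needs no displacement: determinants are taken only within one face, and each vertex is compared
  only with the other edges at its level.\<close>

lemma gcd_mult_dvd_det:
  fixes a b c d :: int
  shows "gcd a b * gcd c d dvd a * d - b * c"
  by (intro dvd_diff mult_dvd_mono) (auto simp: mult.commute intro: mult_dvd_mono)

lemma gcd_mult_le_det:
  fixes a b c d :: int
  assumes "a * d - b * c \<noteq> 0"
  shows "gcd a b * gcd c d \<le> \<bar>a * d - b * c\<bar>"
  using zdvd_imp_le[of "gcd a b * gcd c d" "\<bar>a * d - b * c\<bar>"] gcd_mult_dvd_det[of a b c d] assms by simp

text \<open>Parallel vectors are multiples of one primitive vector, so lattice length is subadditive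
  on them. Independent vectors can violate this: \<open>(1, 0)\<close> and \<open>(2, 3)\<close>
  have length 1, their sum has length 3.\<close>

lemma gcd_add_le_of_det_eq_0:
  fixes a b c d :: int
  assumes det: "a * d = b * c"
  shows "gcd (a + c) (b + d) \<le> gcd a b + gcd c d"
proof (cases "gcd a b = 0 \<or> gcd c d = 0")
  case True
  thus ?thesis by auto
next
  case False
  define g h where "g = gcd a b" and "h = gcd c d"
  have gh: "g > 0" "h > 0"
    using False unfolding g_def h_def by (metis gcd_ge_0_int order_le_less)+
  obtain a0 b0 where ab: "a = a0 * g" "b = b0 * g" and co: "coprime a0 b0"
    using gcd_coprime_exists[of a b] False unfolding g_def by auto
  obtain c0 d0 where cd: "c = c0 * h" "d = d0 * h" and co': "coprime c0 d0"
    using gcd_coprime_exists[of c d] False unfolding h_def by auto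
  have e: "a0 * d0 = b0 * c0"
    using det gh unfolding ab cd by auto
  hence "\<bar>a0\<bar> * \<bar>d0\<bar> = \<bar>c0\<bar> * \<bar>b0\<bar>"
    by (metis abs_mult mult.commute)
  hence abs: "\<bar>a0\<bar> = \<bar>c0\<bar>" "\<bar>d0\<bar> = \<bar>b0\<bar>"
    using coprime_crossproduct_int[OF co co'] by (auto simp: mult.commute)
  have "(c0 = a0 \<and> d0 = b0) \<or> (c0 = - a0 \<and> d0 = - b0)"
    using abs e by (auto simp: abs_if split: if_splits)
  hence "(a + c = a0 * (g + h) \<and> b + d = b0 * (g + h)) \<or> (a + c = a0 * (g - h) \<and> b + d = b0 * (g - h))"
    unfolding ab cd by (auto simp: algebra_simps)
  hence "gcd (a + c) (b + d) = \<bar>g + h\<bar> \<or> gcd (a + c) (b + d) = \<bar>g - h\<bar>"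
    using co by (auto simp: gcd_mult_distrib_int[symmetric] mult.commute[of a0] mult.commute[of b0])
  thus ?thesis
    using gh by (auto simp: g_def[symmetric] h_def[symmetric])
qed

lemma add_le_mult_of_pos:
  fixes a b :: int
  assumes "a > 0" "b > 0"
  shows "a + b \<le> a * b + 1"
proof -
  have "0 \<le> (a - 1) * (b - 1)" using assms by simp
  thus ?thesis by (simp add: algebra_simps)
qed

text \<open>Pick's inequality for a triangle: any two sides have the same determinant up to sign, so
  it dominates all three products of side lengths. The product of the two longest is already large
  enough.\<close>

lemma three_gcd_le_det:
  fixes a b c d :: int
  assumes det: "a * d - b * c \<noteq> 0"
  shows "gcd (a + c) (b + d) + gcd a b + gcd c d - 2 \<le> \<bar>a * d - b * c\<bar>"
proof -
  define x y z D where "x = gcd a b" and "y = gcd c d" and "z = gcd (a + c) (b + d)"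
    and "D = \<bar>a * d - b * c\<bar>"
  have xy: "x * y \<le> D" using gcd_mult_le_det[OF det] by (simp add: x_def y_def D_def)
  have xz: "x * z \<le> D" using gcd_mult_le_det[of a "b + d" b "a + c"] det
    by (simp add: x_def z_def D_def algebra_simps)
  have yz: "y * z \<le> D" using gcd_mult_le_det[of c "b + d" d "a + c"] det
    by (simp add: y_def z_def D_def algebra_simps)
  have pos: "x > 0" "y > 0" "z > 0"
    using det unfolding x_def y_def z_def
    by (auto simp: algebra_simps) (metis add.commute add_eq_0_iff det diff_self mult_minus_left mult_minus_right mult.commute)
  have key: "p + q + r - 2 \<le> p * q" if "p \<ge> q" "q \<ge> r" "r > 0" for p q r :: int
  proof -
    have pq: "p + q \<le> p * q + 1" using that by (intro add_le_mult_of_pos) auto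
    have "p * 3 \<le> p * q" if "q \<ge> 3" using that \<open>p \<ge> q\<close> by (intro mult_left_mono) auto
    moreover have "q = 1 \<or> q = 2 \<or> q \<ge> 3" using that by linarith
    moreover have "p * q = p * 2" if "q = 2" using that by simp
    ultimately show ?thesis using that pq by (smt (verit))
  qed
  have "z + x + y - 2 \<le> D"
    using key[of x y z] key[of x z y] key[of y x z] key[of y z x] key[of z x y] key[of z y x] xy xz yz pos
    by (smt (verit) mult.commute)
  thus ?thesis by (simp add: x_def y_def z_def D_def)
qed

text \<open>Twice the area of a lattice polygon is at least its number of boundary lattice points minus 2;
  the polygon here has the vectors \<open>(a e, b e)\<close> and minus their sum as edges.\<close>

lemma half_plane_det_bound:
  fixes a b :: "'e \<Rightarrow> int" and \<alpha> \<beta> :: real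
  assumes "finite U" "card U \<ge> 2"
    and "\<And>e. e \<in> U \<Longrightarrow> \<alpha> * of_int (a e) + \<beta> * of_int (b e) > 0"
    and "\<And>e f. e \<in> U \<Longrightarrow> f \<in> U \<Longrightarrow> e \<noteq> f \<Longrightarrow> a e * b f - b e * a f \<noteq> 0"
  shows "2 * (gcd (\<Sum>e\<in>U. a e) (\<Sum>e\<in>U. b e) + (\<Sum>e\<in>U. gcd (a e) (b e)) - 2)
    \<le> (\<Sum>e\<in>U. \<Sum>f\<in>U. \<bar>a e * b f - b e * a f\<bar>)"
  using assms
proof (induction U rule: finite_induct)
  case empty
  thus ?case by simp
next
  case (insert u U)
  define A B where "A = (\<Sum>e\<in>U. a e)" and "B = (\<Sum>e\<in>U. b e)"
  define P where "P = (\<Sum>e\<in>U. \<Sum>f\<in>U. \<bar>a e * b f - b e * a f\<bar>)"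
  define Q where "Q = (\<Sum>f\<in>U. \<bar>a u * b f - b u * a f\<bar>)"
  define w g g' where "w = gcd (a u) (b u)" and "g = gcd (a u + A) (b u + B)" and "g' = gcd A B"
  define W where "W = (\<Sum>e\<in>U. gcd (a e) (b e))"
  have ne: "U \<noteq> {}" using insert.prems(1) insert.hyps by auto
  have Q': "(\<Sum>e\<in>U. \<bar>a e * b u - b e * a u\<bar>) = Q"
    unfolding Q_def by (intro sum.cong refl) (metis abs_minus_commute mult.commute)
  have total: "(\<Sum>e\<in>insert u U. \<Sum>f\<in>insert u U. \<bar>a e * b f - b e * a f\<bar>) = P + 2 * Q"
    using insert.hyps by (simp add: P_def Q_def[symmetric] sum.distrib Q')
  have det_sum: "a u * B - b u * A = (\<Sum>f\<in>U. a u * b f - b u * a f)"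
    by (simp add: A_def B_def sum_subtractf sum_distrib_left)
  have Q_ge: "\<bar>a u * B - b u * A\<bar> \<le> Q"
    unfolding det_sum Q_def by (rule sum_abs)
  have w_pos: "w > 0"
    using insert.prems(2)[of u] unfolding w_def by (cases "a u = 0 \<and> b u = 0") (auto intro: gcd_pos_int[THEN iffD2])
  have sum_pos: "0 < (\<Sum>e\<in>U. \<alpha> * of_int (a e) + \<beta> * of_int (b e))"
    using insert.prems(2) insert.hyps ne by (intro sum_pos) auto
  hence AB: "\<alpha> * of_int A + \<beta> * of_int B > 0"
    by (simp add: A_def B_def sum.distrib sum_distrib_left)
  hence g'_pos: "g' > 0" unfolding g'_def by (auto simp: gcd_pos_int)
  have "\<alpha> * of_int (a u + A) + \<beta> * of_int (b u + B) > 0"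
    using AB insert.prems(2)[of u] by (simp add: algebra_simps)
  hence g_pos: "g > 0" unfolding g_def by (auto simp: gcd_pos_int simp del: of_int_add)
  have "2 * (g + (w + W) - 2) \<le> P + 2 * Q"
  proof (cases "card U \<ge> 2")
    case False
    hence "card U = 1" using ne insert.hyps by (metis One_nat_def card_0_eq le_antisym not_less_eq_eq numeral_2_eq_2 le0 Suc_leI bot_nat_0.not_eq_extremum)
    then obtain f where f: "U = {f}" by (auto simp: card_1_singleton_iff)
    have "a u * b f - b u * a f \<noteq> 0" using insert.prems(3)[of u f] insert.hyps f by auto
    from three_gcd_le_det[OF this] show ?thesis
      by (simp add: f P_def Q_def g_def w_def W_def A_def B_def)
  next
    case True
    have IH: "2 * (g' + W - 2) \<le> P"
      unfolding g'_def A_def B_def W_def P_def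
      by (rule insert.IH) (use insert.prems True in auto)
    \<comment> \<open>Adding the side \<open>u\<close> replaces the closing side of length
      \<open>g'\<close> by one of length \<open>g\<close>, and the new determinants have to pay for
      the change. If \<open>u\<close> is parallel to the closing side, the determinant with the sum
      is worthless; then at least two sides of \<open>U\<close> contribute at least \<open>w\<close>
      each.\<close>
    have "w + g - g' \<le> Q"
    proof (cases "a u * B - b u * A = 0")
      case False
      hence "w * g \<le> Q"
        using gcd_mult_le_det[of "a u" "b u + B" "b u" "a u + A"] Q_ge
        by (simp add: w_def g_def algebra_simps)
      thus ?thesis using add_le_mult_of_pos[OF w_pos g_pos] g'_pos by simp
    next
      case eq: True
      have g_le: "g \<le> w + g'" unfolding g_def w_def g'_def
        by (rule gcd_add_le_of_det_eq_0) (use eq in simp)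
      have each: "w \<le> \<bar>a u * b f - b u * a f\<bar>" if "f \<in> U" for f
      proof -
        have ne0: "a u * b f - b u * a f \<noteq> 0" using insert.prems(3)[of u f] insert.hyps that by auto
        hence "gcd (a f) (b f) \<ge> 1" by (auto simp: int_one_le_iff_zero_less gcd_pos_int)
        hence "w * 1 \<le> w * gcd (a f) (b f)" using w_pos by (intro mult_left_mono) auto
        thus ?thesis using gcd_mult_le_det[OF ne0] by (simp add: w_def)
      qed
      have "int (card U) * w \<le> Q"
        unfolding Q_def using sum_mono[of U "\<lambda>_. w", OF each] by simp
      moreover have "2 * w \<le> int (card U) * w" using True w_pos by (intro mult_right_mono) auto
      ultimately show ?thesis using g_le by simp
    qed
    thus ?thesis using IH by simp
  qed
  thus ?case
    unfolding total using insert.hyps by (simp add: g_def w_def W_def A_def B_def)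
qed

text \<open>The bound at the apex is split over the entries \<open>x\<close> of the matrix of fluxes into the faces, whose
  rows sum to \<open>D\<close>; \<open>cap D x\<close> is the share of an entry.\<close>

definition cap :: "int \<Rightarrow> int \<Rightarrow> int" where
  "cap D x = (if x = 0 then 0 else if x < D then x^2 + x else D^2 - D + 2)"

text \<open>With all entries below \<open>D\<close>, convexity makes the split into
  \<open>D - 1\<close> and \<open>1\<close> extremal, and it gives exactly
  \<open>D^2 - D + 2\<close>. This is the origin of the exceptional value of \<open>cap\<close> at
  \<open>D\<close>, which replaces \<open>D^2 + D\<close>.\<close>

lemma sum_cap_le:
  fixes x :: "'a \<Rightarrow> int"
  assumes fin: "finite I" and nonneg: "\<And>i. i \<in> I \<Longrightarrow> x i \<ge> 0" and D: "(\<Sum>i\<in>I. x i) = D" "D \<ge> 1"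
  shows "(\<Sum>i\<in>I. cap D (x i)) \<le> D^2 - D + 2"
proof (cases "\<exists>k\<in>I. x k \<ge> D")
  case True
  then obtain k where k: "k \<in> I" "x k \<ge> D" by auto
  have rem: "(\<Sum>i\<in>I. x i) = x k + (\<Sum>i\<in>I - {k}. x i)" using fin k by (simp add: sum.remove)
  have ge0: "(\<Sum>i\<in>I - {k}. x i) \<ge> 0" using nonneg by (intro sum_nonneg) auto
  have "(\<Sum>i\<in>I - {k}. x i) = 0" using rem ge0 D k by linarith
  hence z: "\<forall>i\<in>I - {k}. x i = 0" using fin nonneg by (subst (asm) sum_nonneg_eq_0_iff) auto
  have "(\<Sum>i\<in>I. cap D (x i)) = cap D (x k) + (\<Sum>i\<in>I - {k}. cap D (x i))"
    using fin k by (simp add: sum.remove)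
  also have "(\<Sum>i\<in>I - {k}. cap D (x i)) = 0" using z by (intro sum.neutral) (auto simp: cap_def)
  finally show ?thesis using k D by (auto simp: cap_def)
next
  case False
  hence lt: "x i < D" if "i \<in> I" for i using that by force
  have "cap D (x i) = (x i)^2 + x i" if "i \<in> I" for i using lt[OF that] by (simp add: cap_def)
  hence eq: "(\<Sum>i\<in>I. cap D (x i)) = (\<Sum>i\<in>I. (x i)^2) + D" using D by (simp add: sum.distrib)
  have "\<exists>k\<in>I. x k > 0"
  proof (rule ccontr)
    assume "\<not> ?thesis"
    hence "(\<Sum>i\<in>I. x i) \<le> 0" by (intro sum_nonpos) force
    thus False using D by simp
  qed
  then obtain k where k: "k \<in> I" "x k > 0" by auto
  define r where "r = (\<Sum>i\<in>I - {k}. x i)"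
  have r: "x k + r = D" using fin k D by (simp add: sum.remove r_def)
  have "(\<Sum>i\<in>I - {k}. (x i)^2) \<le> (\<Sum>i\<in>I - {k}. x i * r)"
  proof (rule sum_mono)
    fix i assume i: "i \<in> I - {k}"
    have "x i \<le> r" unfolding r_def using i fin nonneg by (intro member_le_sum) auto
    thus "(x i)^2 \<le> x i * r" using nonneg i by (simp add: power2_eq_square mult_left_mono)
  qed
  also have "\<dots> = r^2" by (simp add: r_def sum_distrib_right power2_eq_square)
  finally have "(\<Sum>i\<in>I. (x i)^2) \<le> (x k)^2 + r^2" using fin k by (simp add: sum.remove)
  moreover have "x k + r \<le> x k * r + 1" using add_le_mult_of_pos[of "x k" r] k lt[of k] r by simp
  moreover have "D^2 = (x k)^2 + r^2 + 2 * (x k * r)" unfolding r[symmetric] by (simp add: power2_sum)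
  ultimately show ?thesis using eq r by simp
qed

text \<open>The double product is a sum of squares minus \<open>(a - b)^2\<close>. For distinct
  entries this square is at least \<open>\<bar>a - b\<bar>\<close>, which compensates for the
  smaller value of \<open>cap\<close> at \<open>D\<close>. For equal entries the gcd is the entry
  itself, and \<open>a = b = D\<close> gives equality.\<close>

lemma mult_gcd_le_cap:
  fixes a b D :: int
  assumes "1 \<le> a" "a \<le> D" "1 \<le> b" "b \<le> D"
  shows "2 * (a * b + 2 - gcd a b) \<le> cap D a + cap D b"
proof -
  have g: "gcd a b \<ge> 1" using assms by (simp add: int_one_le_iff_zero_less gcd_pos_int)
  have sq: "2 * (a * b) = a^2 + b^2 - (a - b)^2" by (simp add: power2_eq_square algebra_simps)
  show ?thesis
  proof (cases "a = b")
    case True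
    thus ?thesis using assms by (auto simp: cap_def power2_eq_square)
  next
    case False
    have "0 \<le> (k - 1) * k" if "k \<noteq> (0::int)" for k :: int using that by (cases "k > 0") (auto simp: zero_le_mult_iff)
    from this[of "a - b"] this[of "b - a"] False have k: "(a-b)^2 \<ge> a - b" "(a-b)^2 \<ge> b - a"
      by (auto simp: power2_eq_square algebra_simps)
    have "(a - b)^2 \<ge> 1" using False by (metis diff_eq_eq int_one_le_iff_zero_less zero_less_power2 add_0)
    thus ?thesis using assms False g k sq by (auto simp: cap_def)
  qed
qed

text \<open>The arithmetic of a vertex on an edge of the plane: \<open>A1\<close>,
  \<open>A2\<close>, \<open>A3\<close> are the components along that edge of the net flow into the
  three adjacent faces, \<open>\<delta>\<close> is the transversal component common to them, and
  \<open>mp\<close>, \<open>mm\<close> are the flows leaving and arriving along the edge itself. A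
  face is expensive, costing up to \<open>gcd A \<delta>\<close>, only if its \<open>A\<close> is
  negative, and the balance limits how often this can happen.\<close>

lemma edge_vertex_bound:
  fixes A1 A2 A3 \<delta> mp mm X1 X2 X3 :: int
  assumes \<delta>: "\<delta> \<ge> 1" and mp: "mp \<ge> 0" and mm: "mm \<ge> 0"
    and bal: "A1 + A2 + A3 + mp - mm = \<delta>"
    and X1: "X1 \<le> 2 - gcd A1 \<delta> \<or> X1 \<le> gcd A1 \<delta> \<and> A1 < 0"
    and X2: "X2 \<le> 2 - gcd A2 \<delta> \<or> X2 \<le> gcd A2 \<delta> \<and> A2 < 0"
    and X3: "X3 \<le> 2 - gcd A3 \<delta> \<or> X3 \<le> gcd A3 \<delta> \<and> A3 < 0"
  shows "X1 + X2 + X3 + mm + (if mp > 0 then 2 - mp else 0) \<le> \<delta> + 2 + \<delta> * (mp + mm)"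
proof -
  have g1: "1 \<le> gcd A \<delta>" "gcd A \<delta> \<le> \<delta>" for A
    using \<delta> by (auto simp: int_one_le_iff_zero_less gcd_pos_int zdvd_imp_le)
  have half: "2 * gcd A \<delta> \<le> \<delta>" if "gcd A \<delta> \<noteq> \<delta>" for A
  proof -
    obtain k where k: "\<delta> = gcd A \<delta> * k" by (meson dvdE gcd_dvd2)
    hence "k \<noteq> 1" using that by auto
    moreover have "k > 0" using k g1(1)[of A] \<delta> by (metis zero_less_mult_pos less_le_trans zero_less_one)
    ultimately have "gcd A \<delta> * 2 \<le> gcd A \<delta> * k" using g1(1)[of A] by (intro mult_left_mono) auto
    thus ?thesis using k by simp
  qed
  \<comment> \<open>Any flow along the edge leaves a surplus of \<open>\<delta> - 1\<close>, enough
    to pay for a second expensive face.\<close>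
  have stuff: "mm + (if mp > 0 then 2 - mp else 0) + (if mp + mm > 0 then \<delta> - 1 else 0) \<le> \<delta> * (mp + mm)"
  proof -
    have "mp > 0 \<Longrightarrow> \<delta> + mp \<le> \<delta> * mp + 1" "mm > 0 \<Longrightarrow> \<delta> + mm \<le> \<delta> * mm + 1"
      using \<delta> add_le_mult_of_pos[of \<delta>] by auto
    moreover have "\<delta> * (mp + mm) = \<delta> * mp + \<delta> * mm" by (simp add: algebra_simps)
    moreover have "\<delta> * mp = 0" if "mp = 0" using that by simp
    moreover have "\<delta> * mm = 0" if "mm = 0" using that by simp
    ultimately show ?thesis using mp mm \<delta> by (smt (verit))
  qed
  have two: "Y1 + Y2 + Y3 + mm + (if mp > 0 then 2 - mp else 0) \<le> \<delta> + 2 + \<delta> * (mp + mm)"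
    if "Y1 \<le> gcd B1 \<delta>" "Y2 \<le> gcd B2 \<delta>" "Y3 \<le> 2 - gcd B3 \<delta>" "B1 + B2 + B3 + mp - mm = \<delta>"
    for Y1 Y2 Y3 B1 B2 B3
  proof (cases "mp + mm > 0")
    case True
    thus ?thesis using stuff that g1[of B1] g1[of B2] g1[of B3] by (smt (verit))
  next
    case False
    hence z: "mp = 0" "mm = 0" using mp mm by auto
    \<comment> \<open>Either both gcds are at most half of \<open>\<delta>\<close>, or one equals
      \<open>\<delta>\<close> and the balance makes the other divide \<open>B3\<close>.\<close>
    have "gcd B1 \<delta> + gcd B2 \<delta> \<le> \<delta> + gcd B3 \<delta>"
    proof -
      have *: "gcd B2' \<delta> \<le> gcd B3 \<delta>" if "gcd B1' \<delta> = \<delta>" "B1' + B2' + B3 = \<delta>" for B1' B2'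
      proof -
        have "\<delta> dvd B1'" using that by (metis gcd_dvd1)
        hence "gcd B2' \<delta> dvd B1'" by (metis dvd_trans gcd_dvd2)
        moreover have "B3 = \<delta> - B1' - B2'" using that by simp
        ultimately have "gcd B2' \<delta> dvd B3" by auto
        thus ?thesis using g1[of B3] by (intro zdvd_imp_le) auto
      qed
      consider "gcd B1 \<delta> = \<delta>" | "gcd B2 \<delta> = \<delta>" | "gcd B1 \<delta> \<noteq> \<delta>" "gcd B2 \<delta> \<noteq> \<delta>" by blast
      thus ?thesis
      proof cases
        case 1 thus ?thesis using *[of B1 B2] that z by auto
      next
        case 2 thus ?thesis using *[of B2 B1] that z by auto
      next
        case 3 thus ?thesis using half[of B1] half[of B2] g1[of B3] by auto
      qed
    qed
    thus ?thesis using z that by simp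
  qed
  \<comment> \<open>Three negative components force \<open>mp\<close> to be at least 4, which pays
    for all three faces.\<close>
  have three: ?thesis if "A1 < 0" "A2 < 0" "A3 < 0"
    "X1 \<le> gcd A1 \<delta>" "X2 \<le> gcd A2 \<delta>" "X3 \<le> gcd A3 \<delta>"
  proof -
    have mp4: "mp \<ge> 4" using that bal \<delta> mm by linarith
    have "\<delta> * 4 \<le> \<delta> * mp" "1 * mm \<le> \<delta> * mm"
      by (rule mult_left_mono mult_right_mono; use mp4 \<delta> mm in simp)+
    moreover have "\<delta> * (mp + mm) = \<delta> * mp + \<delta> * mm" by (simp add: algebra_simps)
    ultimately show ?thesis using that mp4 g1[of A1] g1[of A2] g1[of A3] \<delta> mm by (smt (verit))
  qed
  have stuff0: "mm + (if mp > 0 then 2 - mp else 0) \<le> \<delta> * (mp + mm)"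
    using stuff \<delta> by (auto split: if_splits)
  show ?thesis
    using X1 X2 X3 stuff0 g1[of A1] g1[of A2] g1[of A3] \<delta> three bal
      two[of X1 A1 X2 A2 X3 A3] two[of X1 A1 X3 A3 X2 A2] two[of X2 A2 X3 A3 X1 A1]
    by (smt (verit))
qed

section \<open>Sweeping a curve by levels\<close>

text \<open>The topmost vertex below \<open>t\<close> is removed, and \<open>s\<close> is placed
  just below it. Consecutive intervals share such an endpoint, so they tile the range below
  \<open>t\<close>; what \<open>g\<close> does between vertices is already part of the
  steps.\<close>

lemma telescope_le:
  fixes g :: "real \<Rightarrow> real" and lev :: "'v \<Rightarrow> real"
  assumes "finite V" and inj: "inj_on lev V"
    and base: "\<And>t. \<forall>v\<in>V. t < lev v \<Longrightarrow> g t = 0"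
    and step: "\<And>v s t. v \<in> V \<Longrightarrow> s < lev v \<Longrightarrow> lev v < t \<Longrightarrow>
      (\<And>u. u \<in> V \<Longrightarrow> u \<noteq> v \<Longrightarrow> lev u < s \<or> t < lev u) \<Longrightarrow> J v \<le> g t - g s"
    and "t \<notin> lev ` V"
  shows "(\<Sum>v\<in>{v\<in>V. lev v < t}. J v) \<le> g t"
  using \<open>t \<notin> lev ` V\<close>
proof (induction "card {v\<in>V. lev v < t}" arbitrary: t)
  case 0
  hence e: "{v\<in>V. lev v < t} = {}" using \<open>finite V\<close> by simp
  hence "\<forall>v\<in>V. t < lev v" using 0 by force
  hence "g t = 0" by (rule base)
  thus ?case unfolding e by simp
next
  case (Suc n)
  define W where "W = {v\<in>V. lev v < t}"
  have W: "finite W" "W \<noteq> {}" using Suc.hyps(2) \<open>finite V\<close> unfolding W_def by (auto simp del: Collect_empty_eq)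
  then obtain v where v: "v \<in> W" "\<And>u. u \<in> W \<Longrightarrow> lev u \<le> lev v"
    using finite_imageI[OF W(1), of lev] Max_in[of "lev ` W"] Max_ge[of "lev ` W"]
    by (metis (no_types, lifting) imageE imageI image_is_empty)
  have vV: "v \<in> V" "lev v < t" using v by (auto simp: W_def)
  have below: "lev u < lev v" if "u \<in> W" "u \<noteq> v" for u
    using v(2)[OF that(1)] inj that vV by (auto simp: W_def inj_on_def order_less_le)
  \<comment> \<open>The entry \<open>lev v - 1\<close> serves the case that no other vertex lies
    below \<open>t\<close>.\<close>
  define s0 where "s0 = Max (insert (lev v - 1) (lev ` (W - {v})))"
  have s0: "s0 < lev v" unfolding s0_def using W below by (subst Max_less_iff) auto
  have s0': "lev u \<le> s0" if "u \<in> W" "u \<noteq> v" for u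
    unfolding s0_def using W that by (intro Max_ge) auto
  define s where "s = (s0 + lev v) / 2"
  have s: "s0 < s" "s < lev v" using s0 by (auto simp: s_def)
  have lows: "{u\<in>V. lev u < s} = W - {v}"
    using s s0' vV by (force simp: W_def)
  have sV: "s \<notin> lev ` V"
  proof
    assume "s \<in> lev ` V"
    then obtain u where u: "u \<in> V" "lev u = s" by auto
    hence "u \<in> W" "u \<noteq> v" using s vV by (auto simp: W_def)
    thus False using s0' u s by force
  qed
  have "n = card {u\<in>V. lev u < s}"
    using Suc.hyps(2) v(1) W unfolding lows W_def[symmetric] by simp
  from Suc.hyps(1)[OF this sV] have IH: "(\<Sum>v\<in>W - {v}. J v) \<le> g s" unfolding lows .
  have "J v \<le> g t - g s"
  proof (rule step)
    fix u assume u: "u \<in> V" "u \<noteq> v"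
    thus "lev u < s \<or> t < lev u"
      using s0'[of u] s Suc.prems by (cases "lev u < t") (force simp: W_def)+
  qed (use vV s in auto)
  thus ?case using IH v(1) W by (simp add: W_def[symmetric] sum.remove)
qed

text \<open>\<open>Y v\<close> are the plane coordinates of \<open>v\<close>, zero on the largest linear forms; \<open>m e\<close> is the direction of \<open>e\<close>
  from \<open>lo e\<close> to \<open>hi e\<close> (\<open>None\<close> for a ray) in these coordinates, multiplied by the weight; \<open>F e\<close> is the
  face containing the relative interior of \<open>e\<close>. Edges are allowed to cross.\<close>

locale leveled_curve =
  fixes V :: "'v set" and L :: "'e set" and lo :: "'e \<Rightarrow> 'v" and hi :: "'e \<Rightarrow> 'v option"
    and Y :: "'v \<Rightarrow> 4 \<Rightarrow> real" and m :: "'e \<Rightarrow> 4 \<Rightarrow> int" and w :: "'e \<Rightarrow> int" and lam :: "4 \<Rightarrow> real"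
  fixes lev :: "'v \<Rightarrow> real" and sl :: "'e \<Rightarrow> real" and F :: "'e \<Rightarrow> 4 set"
  defines "lev v \<equiv> \<Sum>i\<in>UNIV. lam i * Y v i"
    and "sl e \<equiv> \<Sum>i\<in>UNIV. lam i * of_int (m e i)"
    and "F e \<equiv> {i. Y (lo e) i \<noteq> 0 \<or> m e i \<noteq> 0}"
  assumes finV: "finite V" and finL: "finite L" and lam_pos: "\<And>i. lam i > 0"
    and Y_nonneg: "\<And>v i. v \<in> V \<Longrightarrow> Y v i \<ge> 0"
    and lo_V: "\<And>e. e \<in> L \<Longrightarrow> lo e \<in> V"
    and hi_V: "\<And>e q. e \<in> L \<Longrightarrow> hi e = Some q \<Longrightarrow> q \<in> V"
    and hi_eq: "\<And>e q. e \<in> L \<Longrightarrow> hi e = Some q \<Longrightarrow> \<exists>c>0. \<forall>i. Y q i = Y (lo e) i + c * of_int (m e i)"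
    and sl_pos: "\<And>e. e \<in> L \<Longrightarrow> sl e > 0"
    and face: "\<And>e. e \<in> L \<Longrightarrow> \<exists>i j. i \<noteq> j \<and> F e \<subseteq> {i, j}"
    and ray: "\<And>e. e \<in> L \<Longrightarrow> hi e = None \<Longrightarrow> \<exists>k. \<forall>i. m e i = (if i = k then 1 else 0)"
    and weight: "\<And>e i j. e \<in> L \<Longrightarrow> F e \<subseteq> {i, j} \<Longrightarrow> w e = gcd (m e i) (m e j)"
    and balance: "\<And>v i j. v \<in> V \<Longrightarrow>
        (\<Sum>e\<in>{e\<in>L. lo e = v}. m e i) - (\<Sum>e\<in>{e\<in>L. hi e = Some v}. m e i) =
        (\<Sum>e\<in>{e\<in>L. lo e = v}. m e j) - (\<Sum>e\<in>{e\<in>L. hi e = Some v}. m e j)"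
    and distinct: "\<And>e f c. e \<in> L \<Longrightarrow> f \<in> L \<Longrightarrow> e \<noteq> f \<Longrightarrow> lo e = lo f \<or> (hi e = hi f \<and> hi e \<noteq> None) \<Longrightarrow>
        c > 0 \<Longrightarrow> \<exists>i. of_int (m e i) \<noteq> c * (of_int (m f i) :: real)"
    and lev_inj: "inj_on lev V"
begin

section \<open>Edges through a level, their order and their determinants\<close>

definition out :: "'v \<Rightarrow> 'e set" where "out v = {e\<in>L. lo e = v}"
definition inn :: "'v \<Rightarrow> 'e set" where "inn v = {e\<in>L. hi e = Some v}"
text \<open>Strictness at both ends matters at the level of a vertex \<open>v\<close>: there the
  edges at \<open>v\<close> are left out, and \<open>cross (lev v)\<close> consists of the
  bystanders, which pass the level of \<open>v\<close> without meeting it as an endpoint.\<close>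

definition cross :: "real \<Rightarrow> 'e set" where
  "cross t = {e\<in>L. lev (lo e) < t \<and> (\<forall>q. hi e = Some q \<longrightarrow> t < lev q)}"
definition pos :: "'e \<Rightarrow> real \<Rightarrow> 4 \<Rightarrow> real" where
  "pos e t k = Y (lo e) k + (t - lev (lo e)) / sl e * of_int (m e k)"
definition det2 :: "4 \<Rightarrow> 4 \<Rightarrow> 'e \<Rightarrow> 'e \<Rightarrow> int" where
  "det2 i j e f = m e i * m f j - m e j * m f i"
text \<open>The sign orders the edges by their position on the level line of the face. Diverging
  edges count positively and converging ones negatively; exchanging the edges, or the two indices,
  changes both factors.\<close>

definition sdet :: "4 \<Rightarrow> 4 \<Rightarrow> real \<Rightarrow> 'e \<Rightarrow> 'e \<Rightarrow> real" where
  "sdet i j t e f = sgn (pos f t j - pos e t j) * of_int (det2 i j e f)"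
definition on :: "4 \<Rightarrow> 4 \<Rightarrow> 'e set \<Rightarrow> 'e set" where
  "on i j S = {e\<in>S. F e = {i, j}}"
definition area :: "4 \<Rightarrow> 4 \<Rightarrow> real \<Rightarrow> real" where
  "area i j t = (\<Sum>e\<in>on i j (cross t). \<Sum>f\<in>on i j (cross t). sdet i j t e f)"
definition flux :: "4 \<Rightarrow> 4 \<Rightarrow> real \<Rightarrow> int" where
  "flux i j t = (\<Sum>e\<in>on i j (cross t). m e i)"
text \<open>Any other coordinate would do, by \<open>deg_eq\<close>: the balancing condition makes
  all four sums agree away from the levels of vertices.\<close>

definition deg :: "real \<Rightarrow> int" where "deg t = (\<Sum>e\<in>cross t. m e 1)"
definition mom :: "'v \<Rightarrow> int" where "mom v = (\<Sum>e\<in>out v. m e 1) - (\<Sum>e\<in>inn v. m e 1)"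

lemma fin [simp, intro]: "finite (out v)" "finite (inn v)" "finite (cross t)" "finite S \<Longrightarrow> finite (on i j S)"
  using finL by (auto simp: out_def inn_def cross_def on_def)

lemma mom_eq: "v \<in> V \<Longrightarrow> (\<Sum>e\<in>out v. m e i) - (\<Sum>e\<in>inn v. m e i) = mom v"
  unfolding mom_def out_def inn_def by (rule balance)

lemma m_eq_0: "F e \<subseteq> A \<Longrightarrow> i \<notin> A \<Longrightarrow> m e i = 0"
  by (auto simp: F_def)

lemma lev_lo_hi:
  assumes "e \<in> L" "hi e = Some q"
  shows "\<exists>c>0. (\<forall>i. Y q i = Y (lo e) i + c * of_int (m e i)) \<and> lev q = lev (lo e) + c * sl e"
proof -
  obtain c where c: "c > 0" "\<forall>i. Y q i = Y (lo e) i + c * of_int (m e i)" using hi_eq[OF assms] by blast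
  have "lev q = lev (lo e) + c * sl e"
    unfolding lev_def sl_def using c(2) by (simp add: sum.distrib sum_distrib_left algebra_simps)
  thus ?thesis using c by blast
qed

lemma lev_less: "e \<in> L \<Longrightarrow> hi e = Some q \<Longrightarrow> lev (lo e) < lev q"
  using lev_lo_hi[of e q] sl_pos[of e] by (auto simp: mult_pos_pos)

lemma out_inn_disjoint: "out v \<inter> inn v = {}"
  using lev_less by (fastforce simp: out_def inn_def)

lemma pos_out: "e \<in> out v \<Longrightarrow> pos e (lev v) k = Y v k"
  by (auto simp: pos_def out_def)

lemma pos_inn:
  assumes "e \<in> inn v" shows "pos e (lev v) k = Y v k"
proof -
  have e: "e \<in> L" "hi e = Some v" using assms by (auto simp: inn_def)
  from lev_lo_hi[OF e] sl_pos[OF e(1)] show ?thesis by (auto simp: pos_def)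
qed

lemma Y_lo_eq_0_imp: "e \<in> L \<Longrightarrow> Y (lo e) i = 0 \<Longrightarrow> m e i \<ge> 0"
proof (cases "hi e")
  case None
  assume "e \<in> L"
  then obtain k where "\<forall>i. m e i = (if i = k then 1 else 0)" using ray None by blast
  thus ?thesis by simp
next
  case (Some q)
  assume e: "e \<in> L" "Y (lo e) i = 0"
  obtain c where c: "c > 0" "\<forall>i. Y q i = Y (lo e) i + c * of_int (m e i)" using hi_eq[OF e(1) Some] by blast
  have "0 \<le> c * of_int (m e i)" using c e Y_nonneg[OF hi_V[OF e(1) Some]] by (metis add_0)
  thus ?thesis using c by (simp add: zero_le_mult_iff)
qed

text \<open>A coordinate that is nonnegative at both ends of an edge and not identically zero is
  positive strictly between them. This fixes the signs in \<open>sdet\<close> against a vertex on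
  the boundary of the face.\<close>

lemma pos_pos:
  assumes "e \<in> cross t" "k \<in> F e" shows "pos e t k > 0"
proof -
  have e: "e \<in> L" "lev (lo e) < t" using assms by (auto simp: cross_def)
  define x where "x = (t - lev (lo e)) / sl e"
  have x: "x > 0" using e sl_pos[of e] by (simp add: x_def)
  have y0: "Y (lo e) k \<ge> 0" using Y_nonneg lo_V e by blast
  show ?thesis
  proof (cases "m e k \<ge> 0")
    case True
    hence "Y (lo e) k > 0 \<or> m e k > 0" using assms(2) y0 by (auto simp: F_def)
    thus ?thesis using x y0 True unfolding pos_def x_def[symmetric]
      by (auto intro: add_pos_nonneg add_nonneg_pos)
  next
    case False
    hence "hi e \<noteq> None" using ray[OF e(1)] by (metis zero_le_one order_refl)
    then obtain q where q: "hi e = Some q" by auto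
    obtain c where c: "c > 0" "Y q k = Y (lo e) k + c * of_int (m e k)" "lev q = lev (lo e) + c * sl e"
      using lev_lo_hi[OF e(1) q] by blast
    have "t < lev q" using assms(1) q by (auto simp: cross_def)
    hence "x < c" using c(3) sl_pos[OF e(1)] by (simp add: x_def divide_less_eq)
    hence "x * of_int (m e k) > c * of_int (m e k)" using False by (intro mult_strict_right_mono_neg) auto
    thus ?thesis using c(2) Y_nonneg[OF hi_V[OF e(1) q], of k] unfolding pos_def x_def[symmetric] by linarith
  qed
qed

lemma sl_on: "i \<noteq> j \<Longrightarrow> F e = {i, j} \<Longrightarrow> sl e = lam i * of_int (m e i) + lam j * of_int (m e j)"
proof -
  assume a: "i \<noteq> j" "F e = {i, j}"
  have "sl e = (\<Sum>k\<in>{i, j}. lam k * of_int (m e k))"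
    unfolding sl_def using a by (intro sum.mono_neutral_right) (auto simp: F_def)
  thus ?thesis using a by simp
qed

text \<open>Both edges are parametrized by the level, so coordinate \<open>j\<close> has slope
  \<open>m e j / sl e\<close>. In a face \<open>sl\<close> involves only the indices
  \<open>i\<close> and \<open>j\<close>, and the difference of two slopes is a positive multiple of
  the determinant.\<close>

lemma pos_diff:
  assumes "e \<in> L" "f \<in> L" "F e = {i, j}" "F f = {i, j}" "i \<noteq> j"
  shows "(pos f t j - pos e t j) - (pos f s j - pos e s j) =
    (t - s) * (lam i * of_int (det2 i j e f) / (sl e * sl f))"
proof -
  have "sl e > 0" "sl f > 0" using sl_pos assms by auto
  hence "(pos f t j - pos e t j) - (pos f s j - pos e s j)
     = (t - s) * ((of_int (m f j) * sl e - of_int (m e j) * sl f) / (sl e * sl f))"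
    by (simp add: pos_def field_simps)
  also have "of_int (m f j) * sl e - of_int (m e j) * sl f = lam i * of_int (det2 i j e f)"
    unfolding sl_on[OF assms(5,3)] sl_on[OF assms(5,4)] by (simp add: det2_def algebra_simps)
  finally show ?thesis .
qed

text \<open>Two edges in a face diverge exactly as their determinant tells, so each term of the
  pair sum only increases with the level, even where edges cross.\<close>

lemma sdet_mono:
  assumes "e \<in> L" "f \<in> L" "F e = {i, j}" "F f = {i, j}" "i \<noteq> j" "s \<le> t"
  shows "sdet i j s e f \<le> sdet i j t e f"
proof -
  define b where "b = (t - s) * (lam i / (sl e * sl f))"
  have b: "b \<ge> 0" using sl_pos[of e] sl_pos[of f] lam_pos[of i] assms by (simp add: b_def)
  define x y D where "x = pos f s j - pos e s j" and "y = pos f t j - pos e t j"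
    and "D = (of_int (det2 i j e f) :: real)"
  have y: "y = x + b * D" using pos_diff[OF assms(1-5), of t s] by (simp add: x_def y_def b_def D_def)
  have sgn_mono: "sgn p \<le> sgn q" if "p \<le> q" for p q :: real using that by (auto simp: sgn_if)
  have "sgn x * D \<le> sgn y * D"
  proof (cases "D \<ge> 0")
    case True
    hence "x \<le> y" using y b by simp
    thus ?thesis using True by (intro mult_right_mono sgn_mono)
  next
    case False
    hence "y \<le> x" using y b by (simp add: mult_nonneg_nonpos)
    thus ?thesis using False by (intro mult_right_mono_neg sgn_mono) auto
  qed
  thus ?thesis by (simp add: sdet_def x_def y_def D_def)
qed

lemma sdet_after:
  assumes "e \<in> L" "f \<in> L" "F e = {i, j}" "F f = {i, j}" "i \<noteq> j" "pos e l j = pos f l j" 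
  shows "l < t \<Longrightarrow> sdet i j t e f = \<bar>of_int (det2 i j e f)\<bar>" "t < l \<Longrightarrow> sdet i j t e f = - \<bar>of_int (det2 i j e f)\<bar>"
proof -
  define p where "p = lam i / (sl e * sl f)"
  have p: "p > 0" using sl_pos[of e] sl_pos[of f] lam_pos[of i] assms by (simp add: p_def)
  have eq: "pos f t j - pos e t j = (t - l) * p * of_int (det2 i j e f)"
    using pos_diff[OF assms(1-5), of t l] assms(6) by (simp add: p_def)
  have sg: "sgn (pos f t j - pos e t j) = sgn (t - l) * sgn (of_int (det2 i j e f) :: real)"
    unfolding eq using p by (simp add: sgn_mult)
  show "l < t \<Longrightarrow> sdet i j t e f = \<bar>of_int (det2 i j e f)\<bar>" "t < l \<Longrightarrow> sdet i j t e f = - \<bar>of_int (det2 i j e f)\<bar>"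
    by (simp_all add: sdet_def sg abs_sgn mult.commute)
qed

lemma sdet_commute: "sdet i j t e f = sdet i j t f e"
  by (simp add: sdet_def det2_def sgn_if algebra_simps)

text \<open>Along a level line of the face the coordinates \<open>i\<close> and \<open>j\<close>
  vary in opposite directions, so the order of the edges and the determinant both change
  sign.\<close>

lemma sdet_swap:
  assumes "e \<in> L" "f \<in> L" "F e = {i, j}" "F f = {i, j}" "i \<noteq> j"
  shows "sdet i j t e f = sdet j i t e f"
proof -
  have lv: "lam i * pos e t i + lam j * pos e t j = t" if "e \<in> L" "F e = {i, j}" for e
  proof -
    have "lev (lo e) = (\<Sum>k\<in>{i, j}. lam k * Y (lo e) k)"
      unfolding lev_def using that by (intro sum.mono_neutral_right) (auto simp: F_def)
    hence l: "lev (lo e) = lam i * Y (lo e) i + lam j * Y (lo e) j" using assms by simp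
    have "lam i * pos e t i + lam j * pos e t j = lev (lo e) + (t - lev (lo e)) / sl e * sl e"
      unfolding pos_def l sl_on[OF assms(5) that(2)] by (simp only: distrib_left distrib_right) (simp add: algebra_simps)
    thus ?thesis using sl_pos[OF that(1)] by simp
  qed
  define x y where "x = pos f t i - pos e t i" and "y = pos f t j - pos e t j"
  have "lam i * x + lam j * y = 0" using lv[of e] lv[of f] assms unfolding x_def y_def by (simp add: algebra_simps)
  hence "x = - (lam j / lam i * y)" using lam_pos[of i] by (simp add: field_simps)
  hence "sgn x = - sgn y" using lam_pos[of i] lam_pos[of j] by (simp add: sgn_mult)
  thus ?thesis by (simp add: sdet_def x_def y_def det2_def algebra_simps)
qed

lemma on_commute: "on i j S = on j i S" by (auto simp: on_def insert_commute)

lemma area_commute: "i \<noteq> j \<Longrightarrow> area i j t = area j i t"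
  unfolding area_def on_commute[of j i]
  by (intro sum.cong refl sdet_swap) (auto simp: on_def cross_def)

lemma cross_jump:
  assumes "v \<in> V" "s < lev v" "lev v < t"
    and "\<And>u. u \<in> V \<Longrightarrow> u \<noteq> v \<Longrightarrow> lev u < s \<or> t < lev u"
  shows "cross s = cross (lev v) \<union> inn v" "cross t = cross (lev v) \<union> out v"
    "cross (lev v) \<inter> inn v = {}" "cross (lev v) \<inter> out v = {}"
proof -
  have u: "lev u < s \<longleftrightarrow> lev u < lev v" "t < lev u \<longleftrightarrow> lev v < lev u"
    "lev u < t \<longleftrightarrow> lev u < lev v \<or> u = v" "s < lev u \<longleftrightarrow> lev v < lev u \<or> u = v" if "u \<in> V" for u
    using assms(4)[OF that] assms(2,3) by (cases "u = v"; force)+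
  show "cross s = cross (lev v) \<union> inn v"
    using u lo_V hi_V lev_less by (fastforce simp: cross_def inn_def)
  show "cross t = cross (lev v) \<union> out v"
    using u lo_V hi_V lev_less by (fastforce simp: cross_def out_def)
  show "cross (lev v) \<inter> inn v = {}" "cross (lev v) \<inter> out v = {}" by (auto simp: cross_def inn_def out_def)
qed

lemma on_Un: "on i j (A \<union> B) = on i j A \<union> on i j B" by (auto simp: on_def)

lemma on_Int_empty: "A \<inter> B = {} \<Longrightarrow> on i j A \<inter> on i j B = {}" by (auto simp: on_def)

text \<open>Pairs of bystanders can only gain. For a bystander and an edge at \<open>v\<close>,
  monotonicity allows evaluation at the level of \<open>v\<close>, where the latter edge sits at
  \<open>v\<close> itself, so that only the net vector through \<open>v\<close> enters. Pairs at
  \<open>v\<close> are known exactly: outgoing ones have just diverged, incoming ones were about to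
  meet.\<close>

lemma area_jump:
  assumes jump: "v \<in> V" "s < lev v" "lev v < t"
    "\<And>u. u \<in> V \<Longrightarrow> u \<noteq> v \<Longrightarrow> lev u < s \<or> t < lev u" and ij: "i \<noteq> j"
  shows "2 * (\<Sum>f\<in>on i j (cross (lev v)). sgn (pos f (lev v) j - Y v j) *
           of_int ((\<Sum>e\<in>on i j (out v). det2 i j e f) - (\<Sum>e\<in>on i j (inn v). det2 i j e f)))
      + of_int (\<Sum>e\<in>on i j (out v). \<Sum>f\<in>on i j (out v). \<bar>det2 i j e f\<bar>)
      + of_int (\<Sum>e\<in>on i j (inn v). \<Sum>f\<in>on i j (inn v). \<bar>det2 i j e f\<bar>)
    \<le> area i j t - area i j s"
proof -
  define C A B where "C = on i j (cross (lev v))" and "A = on i j (out v)" and "B = on i j (inn v)"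
  note cj = cross_jump[OF jump]
  have t: "on i j (cross t) = C \<union> A" "C \<inter> A = {}" and s: "on i j (cross s) = C \<union> B" "C \<inter> B = {}"
    using cj by (auto simp: C_def A_def B_def on_Un on_Int_empty)
  have finABC: "finite A" "finite B" "finite C" by (auto simp: A_def B_def C_def)
  have split: "(\<Sum>e\<in>C \<union> D. \<Sum>f\<in>C \<union> D. sdet i j r e f) = (\<Sum>e\<in>C. \<Sum>f\<in>C. sdet i j r e f)
      + 2 * (\<Sum>f\<in>C. \<Sum>e\<in>D. sdet i j r e f) + (\<Sum>e\<in>D. \<Sum>f\<in>D. sdet i j r e f)"
    if "finite D" "C \<inter> D = {}" for D r
  proof -
    have "(\<Sum>e\<in>D. \<Sum>f\<in>C. sdet i j r e f) = (\<Sum>f\<in>C. \<Sum>e\<in>D. sdet i j r e f)" by (rule sum.swap)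
    moreover have "(\<Sum>e\<in>C. \<Sum>f\<in>D. sdet i j r e f) = (\<Sum>f\<in>C. \<Sum>e\<in>D. sdet i j r e f)"
      by (intro sum.cong refl sdet_commute)
    ultimately show ?thesis using that finABC by (simp add: sum.union_disjoint sum.distrib)
  qed
  have mem: "e \<in> L \<and> F e = {i, j}" if "e \<in> A \<union> B \<union> C" for e
    using that by (auto simp: A_def B_def C_def on_def out_def inn_def cross_def)
  have CC: "(\<Sum>e\<in>C. \<Sum>f\<in>C. sdet i j s e f) \<le> (\<Sum>e\<in>C. \<Sum>f\<in>C. sdet i j t e f)"
    using mem ij jump by (intro sum_mono sdet_mono) auto
  have pA: "pos e (lev v) k = Y v k" if "e \<in> A" for e k using that pos_out by (auto simp: A_def on_def)
  have pB: "pos e (lev v) k = Y v k" if "e \<in> B" for e k using that pos_inn by (auto simp: B_def on_def)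
  have CA: "(\<Sum>f\<in>C. \<Sum>e\<in>A. sgn (pos f (lev v) j - Y v j) * of_int (det2 i j e f)) \<le> (\<Sum>f\<in>C. \<Sum>e\<in>A. sdet i j t e f)"
  proof (intro sum_mono)
    fix f e assume "f \<in> C" "e \<in> A"
    hence "sdet i j (lev v) e f \<le> sdet i j t e f" using mem ij jump by (intro sdet_mono) auto
    thus "sgn (pos f (lev v) j - Y v j) * of_int (det2 i j e f) \<le> sdet i j t e f"
      using pA[OF \<open>e \<in> A\<close>] by (simp add: sdet_def)
  qed
  have CB: "(\<Sum>f\<in>C. \<Sum>e\<in>B. sdet i j s e f) \<le> (\<Sum>f\<in>C. \<Sum>e\<in>B. sgn (pos f (lev v) j - Y v j) * of_int (det2 i j e f))"
  proof (intro sum_mono)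
    fix f e assume "f \<in> C" "e \<in> B"
    hence "sdet i j s e f \<le> sdet i j (lev v) e f" using mem ij jump by (intro sdet_mono) auto
    thus "sdet i j s e f \<le> sgn (pos f (lev v) j - Y v j) * of_int (det2 i j e f)"
      using pB[OF \<open>e \<in> B\<close>] by (simp add: sdet_def)
  qed
  have AA: "(\<Sum>e\<in>A. \<Sum>f\<in>A. sdet i j t e f) = of_int (\<Sum>e\<in>A. \<Sum>f\<in>A. \<bar>det2 i j e f\<bar>)"
    unfolding of_int_sum of_int_abs
    using mem ij jump pA by (intro sum.cong refl sdet_after(1)[where l = "lev v"]) auto
  have BB: "(\<Sum>e\<in>B. \<Sum>f\<in>B. sdet i j s e f) = - of_int (\<Sum>e\<in>B. \<Sum>f\<in>B. \<bar>det2 i j e f\<bar>)"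
    unfolding of_int_sum of_int_abs sum_negf[symmetric]
    using mem ij jump pB by (intro sum.cong refl sdet_after(2)[where l = "lev v"]) auto
  have mid: "(\<Sum>f\<in>C. sgn (pos f (lev v) j - Y v j) * of_int ((\<Sum>e\<in>A. det2 i j e f) - (\<Sum>e\<in>B. det2 i j e f)))
     = (\<Sum>f\<in>C. \<Sum>e\<in>A. sgn (pos f (lev v) j - Y v j) * of_int (det2 i j e f))
     - (\<Sum>f\<in>C. \<Sum>e\<in>B. sgn (pos f (lev v) j - Y v j) * of_int (det2 i j e f))"
    by (simp add: sum_subtractf[symmetric] sum_distrib_left[symmetric] right_diff_distrib)
  have "area i j t = (\<Sum>e\<in>C. \<Sum>f\<in>C. sdet i j t e f)
      + 2 * (\<Sum>f\<in>C. \<Sum>e\<in>A. sdet i j t e f) + of_int (\<Sum>e\<in>A. \<Sum>f\<in>A. \<bar>det2 i j e f\<bar>)"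
    unfolding area_def t(1) split[OF finABC(1) t(2)] AA ..
  moreover have "area i j s = (\<Sum>e\<in>C. \<Sum>f\<in>C. sdet i j s e f)
      + 2 * (\<Sum>f\<in>C. \<Sum>e\<in>B. sdet i j s e f) - of_int (\<Sum>e\<in>B. \<Sum>f\<in>B. \<bar>det2 i j e f\<bar>)"
    unfolding area_def s(1) split[OF finABC(2) s(2)] BB by simp
  ultimately show ?thesis
    unfolding C_def[symmetric] A_def[symmetric] B_def[symmetric] mid
    using CC CA CB by argo
qed

lemma flux_jump:
  assumes "v \<in> V" "s < lev v" "lev v < t"
    and "\<And>u. u \<in> V \<Longrightarrow> u \<noteq> v \<Longrightarrow> lev u < s \<or> t < lev u"
  shows "flux i j s = (\<Sum>e\<in>on i j (cross (lev v)). m e i) + (\<Sum>e\<in>on i j (inn v). m e i)"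
    "flux i j t = (\<Sum>e\<in>on i j (cross (lev v)). m e i) + (\<Sum>e\<in>on i j (out v). m e i)"
proof -
  note cj = cross_jump[OF assms]
  have "on i j (cross s) = on i j (cross (lev v)) \<union> on i j (inn v)" using cj(1) by (simp add: on_Un)
  thus "flux i j s = (\<Sum>e\<in>on i j (cross (lev v)). m e i) + (\<Sum>e\<in>on i j (inn v). m e i)"
    unfolding flux_def using on_Int_empty[OF cj(3)] by (simp add: sum.union_disjoint)
  have "on i j (cross t) = on i j (cross (lev v)) \<union> on i j (out v)" using cj(2) by (simp add: on_Un)
  thus "flux i j t = (\<Sum>e\<in>on i j (cross (lev v)). m e i) + (\<Sum>e\<in>on i j (out v). m e i)"
    unfolding flux_def using on_Int_empty[OF cj(4)] by (simp add: sum.union_disjoint)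
qed

text \<open>An edge with both ends below \<open>t\<close> cancels; one with only its lower end below
  \<open>t\<close> survives.\<close>

lemma sum_cross:
  fixes g :: "'e \<Rightarrow> 'a :: ab_group_add"
  assumes t: "t \<notin> lev ` V"
  shows "(\<Sum>e\<in>cross t. g e) = (\<Sum>v\<in>{v\<in>V. lev v < t}. (\<Sum>e\<in>out v. g e) - (\<Sum>e\<in>inn v. g e))"
proof -
  define U where "U = {v\<in>V. lev v < t}"
  have finU: "finite U" using finV by (simp add: U_def)
  have o: "(\<Sum>v\<in>U. \<Sum>e\<in>out v. g e) = (\<Sum>e\<in>(\<Union>v\<in>U. out v). g e)"
    using finU by (intro sum.UNION_disjoint[symmetric]) (auto simp: out_def finL)
  have i: "(\<Sum>v\<in>U. \<Sum>e\<in>inn v. g e) = (\<Sum>e\<in>(\<Union>v\<in>U. inn v). g e)"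
    using finU by (intro sum.UNION_disjoint[symmetric]) (auto simp: inn_def finL)
  have sub: "(\<Union>v\<in>U. inn v) \<subseteq> (\<Union>v\<in>U. out v)"
    using lev_less lo_V by (fastforce simp: U_def inn_def out_def)
  have "cross t = (\<Union>v\<in>U. out v) - (\<Union>v\<in>U. inn v)"
    using t lo_V hi_V by (force simp: U_def inn_def out_def cross_def not_less order_le_less)
  thus ?thesis
    using sum_diff[OF _ sub, of g] finU by (simp add: U_def[symmetric] sum_subtractf o i)
qed

lemma deg_eq: "t \<notin> lev ` V \<Longrightarrow> (\<Sum>e\<in>cross t. m e i) = deg t"
  unfolding deg_def sum_cross by (intro sum.cong refl) (simp add: mom_eq)

lemma deg_eq_sum: "t \<notin> lev ` V \<Longrightarrow> deg t = (\<Sum>v\<in>{v\<in>V. lev v < t}. mom v)"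
  unfolding deg_def sum_cross by (intro sum.cong refl) (simp add: mom_eq)

text \<open>A face has at most two indices, so edges whose face contains \<open>i\<close> are sorted
  by the other one; \<open>j = i\<close> collects those running along the \<open>i\<close>-th edge
  of the plane.\<close>

lemma sum_on:
  fixes g :: "'e \<Rightarrow> 'a :: comm_monoid_add"
  assumes "S \<subseteq> L" "\<And>e. e \<in> S \<Longrightarrow> i \<notin> F e \<Longrightarrow> g e = 0"
  shows "(\<Sum>e\<in>S. g e) = (\<Sum>j\<in>UNIV. \<Sum>e\<in>on i j S. g e)"
proof -
  have finS: "finite S" using assms finL finite_subset by blast
  have "(\<Sum>e\<in>S. g e) = (\<Sum>e\<in>{e\<in>S. i \<in> F e}. g e)"
    using finS assms by (intro sum.mono_neutral_right) auto
  also have "{e\<in>S. i \<in> F e} = (\<Union>j\<in>UNIV. on i j S)"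
  proof
    show "{e\<in>S. i \<in> F e} \<subseteq> (\<Union>j\<in>UNIV. on i j S)"
    proof
      fix e assume e: "e \<in> {e\<in>S. i \<in> F e}"
      then obtain a b where "F e \<subseteq> {a, b}" using face assms(1) by blast
      hence "\<exists>j. F e = {i, j}" using e by (auto; blast)
      thus "e \<in> (\<Union>j\<in>UNIV. on i j S)" using e by (auto simp: on_def)
    qed
  qed (auto simp: on_def)
  also have "(\<Sum>e\<in>(\<Union>j\<in>UNIV. on i j S). g e) = (\<Sum>j\<in>UNIV. \<Sum>e\<in>on i j S. g e)"
    using finS by (intro sum.UNION_disjoint) (auto simp: on_def doubleton_eq_iff)
  finally show ?thesis .
qed

section \<open>The potential and the lattice estimates for the edges at a vertex\<close>

definition face_term :: "4 \<Rightarrow> 4 \<Rightarrow> real \<Rightarrow> real" where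
  "face_term i j t = area i j t - 2 * of_int (flux i j t * flux j i t)"
definition pairing :: "real \<Rightarrow> real" where
  "pairing t = (\<Sum>i\<in>UNIV. \<Sum>j\<in>-{i}. face_term i j t) + 4 * (of_int (deg t))^2"
text \<open>The excess \<open>w e - 1\<close> is added at the lower end of an edge and removed at
  the upper one. It turns the lattice lengths of the Pick-type bounds into numbers of edges, with
  outgoing edges estimated by \<open>2 - w\<close> and incoming ones by \<open>w\<close>.\<close>

definition potential :: "real \<Rightarrow> real" where
  "potential t = pairing t + 4 * of_int (deg t) + 4 * of_int (\<Sum>e\<in>cross t. w e - 1)"
definition dets :: "4 \<Rightarrow> 4 \<Rightarrow> 'e set \<Rightarrow> int" where
  "dets i j S = (\<Sum>e\<in>on i j S. \<Sum>f\<in>on i j S. \<bar>det2 i j e f\<bar>)"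

lemma dets_nonneg: "dets i j S \<ge> 0"
  unfolding dets_def by (intro sum_nonneg) auto

lemma on_sub: "e \<in> on i j S \<Longrightarrow> e \<in> S \<and> F e = {i, j}" by (auto simp: on_def)

lemma weight_on: "e \<in> L \<Longrightarrow> F e = {i, j} \<Longrightarrow> w e = gcd (m e i) (m e j)"
  by (rule weight) auto

lemma weight_pos: assumes "e \<in> L" shows "w e \<ge> 1"
proof -
  obtain i j where ij: "i \<noteq> j" "F e \<subseteq> {i, j}" using face assms by blast
  have "m e i \<noteq> 0 \<or> m e j \<noteq> 0"
  proof (rule ccontr)
    assume "\<not> ?thesis"
    hence "m e k = 0" for k using ij m_eq_0[OF ij(2), of k] by (cases "k \<in> {i, j}") auto
    thus False using sl_pos[OF assms] by (simp add: sl_def)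
  qed
  thus ?thesis using weight[OF assms ij(2)] by (simp add: int_one_le_iff_zero_less gcd_pos_int)
qed

text \<open>Both edges climb, so a vanishing determinant would make one direction a positive
  multiple of the other.\<close>

lemma det2_neq_0:
  assumes "e \<in> L" "f \<in> L" "F e = {i, j}" "F f = {i, j}" "i \<noteq> j" "e \<noteq> f"
    "lo e = lo f \<or> hi e = hi f \<and> hi e \<noteq> None"
  shows "det2 i j e f \<noteq> 0"
proof
  assume "det2 i j e f = 0"
  hence "m e i * m f j = m e j * m f i" by (simp add: det2_def)
  hence d: "real_of_int (m e i) * of_int (m f j) = of_int (m e j) * of_int (m f i)"
    by (metis of_int_mult)
  have s: "sl e > 0" "sl f > 0" using sl_pos assms by auto
  have "real_of_int (m e k) * sl f = sl e * of_int (m f k)" for k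
  proof (cases "k \<in> {i, j}")
    case True
    thus ?thesis unfolding sl_on[OF assms(5,3)] sl_on[OF assms(5,4)] using d
      by (auto simp: algebra_simps)
  next
    case False
    thus ?thesis using m_eq_0[of e "{i,j}" k] m_eq_0[of f "{i,j}" k] assms by simp
  qed
  hence "\<forall>k. real_of_int (m e k) = (sl e / sl f) * of_int (m f k)" using s by (simp add: field_simps)
  moreover have "sl e / sl f > 0" using s by simp
  ultimately show False using distinct[OF assms(1,2,6,7)] by blast
qed

text \<open>The first bound suits incoming edges, the second outgoing ones: added up at a vertex
  inside a face, their gcd terms cancel. From two edges on both follow from
  \<open>half_plane_det_bound\<close>; for a single edge the determinants vanish and both are
  equalities.\<close>

lemma dets_bounds:
  assumes "i \<noteq> j" "S \<subseteq> L" "on i j S \<noteq> {}"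
    "\<And>e f. e \<in> S \<Longrightarrow> f \<in> S \<Longrightarrow> lo e = lo f \<or> hi e = hi f \<and> hi e \<noteq> None"
  defines "g \<equiv> gcd (\<Sum>e\<in>on i j S. m e i) (\<Sum>e\<in>on i j S. m e j)"
  shows "2 * ((\<Sum>e\<in>on i j S. w e) - g) \<le> dets i j S"
    "2 * ((\<Sum>e\<in>on i j S. 2 - w e) - 2 + g) \<le> dets i j S" and "g \<ge> 1"
proof -
  define U where "U = on i j S"
  have finU: "finite U" using assms(2) finL finite_subset by (auto simp: U_def)
  have U: "e \<in> L" "F e = {i, j}" "e \<in> S" if "e \<in> U" for e using that assms(2) by (auto simp: U_def on_def)
  have w1: "w e \<ge> 1" if "e \<in> U" for e using weight_pos U that by blast
  have Wn: "(\<Sum>e\<in>U. w e) \<ge> int (card U)" using sum_mono[of U "\<lambda>_. 1" w] w1 by simp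
  have W2: "(\<Sum>e\<in>U. 2 - w e) = 2 * int (card U) - (\<Sum>e\<in>U. w e)" by (simp add: sum_subtractf)
  have pos: "0 < lam i * of_int (m e i) + lam j * of_int (m e j)" if "e \<in> U" for e
    using sl_on[OF assms(1) U(2)[OF that]] sl_pos[OF U(1)[OF that]] by simp
  have "0 < (\<Sum>e\<in>U. lam i * of_int (m e i) + lam j * of_int (m e j))"
    using pos finU assms(3) by (intro sum_pos) (auto simp: U_def)
  hence "0 < lam i * of_int (\<Sum>e\<in>U. m e i) + lam j * of_int (\<Sum>e\<in>U. m e j)"
    by (simp add: sum.distrib sum_distrib_left)
  hence "(\<Sum>e\<in>U. m e i) \<noteq> 0 \<or> (\<Sum>e\<in>U. m e j) \<noteq> 0" by (metis add.right_neutral less_irrefl mult_zero_right of_int_0)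
  thus g1: "g \<ge> 1" unfolding g_def U_def[symmetric] by (simp add: int_one_le_iff_zero_less gcd_pos_int)
  have ge: "card U \<ge> 1" using assms(3) finU by (simp add: U_def[symmetric] Suc_le_eq card_gt_0_iff)
  have "2 * ((\<Sum>e\<in>U. w e) - g) \<le> dets i j S \<and> 2 * ((\<Sum>e\<in>U. 2 - w e) - 2 + g) \<le> dets i j S"
  proof (cases "card U \<ge> 2")
    case True
    have "2 * (gcd (\<Sum>e\<in>U. m e i) (\<Sum>e\<in>U. m e j) + (\<Sum>e\<in>U. gcd (m e i) (m e j)) - 2)
        \<le> (\<Sum>e\<in>U. \<Sum>f\<in>U. \<bar>m e i * m f j - m e j * m f i\<bar>)"
      using det2_neq_0 assms(1,4) U pos by (intro half_plane_det_bound[OF finU True]) (auto simp: det2_def)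
    moreover have "(\<Sum>e\<in>U. gcd (m e i) (m e j)) = (\<Sum>e\<in>U. w e)"
      using U weight_on by (intro sum.cong refl) simp
    ultimately have "2 * (g + (\<Sum>e\<in>U. w e) - 2) \<le> dets i j S"
      by (simp add: g_def dets_def det2_def U_def)
    thus ?thesis using Wn W2 True g1 by simp
  next
    case False
    hence "card U = 1" using ge by simp
    then obtain e where e: "U = {e}" by (auto simp: card_1_singleton_iff)
    hence "g = w e" using weight_on[OF U(1,2)[of e]] by (simp add: g_def U_def[symmetric])
    thus ?thesis using e dets_nonneg[of i j S] by simp
  qed
  thus "2 * ((\<Sum>e\<in>on i j S. w e) - g) \<le> dets i j S"
    "2 * ((\<Sum>e\<in>on i j S. 2 - w e) - 2 + g) \<le> dets i j S" by (auto simp: U_def)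
qed

lemma flag_L: "e \<in> out v \<union> inn v \<Longrightarrow> e \<in> L" by (auto simp: out_def inn_def)

lemma flag_F:
  assumes "e \<in> out v \<union> inn v" "Y v k \<noteq> 0" shows "k \<in> F e"
proof (cases "e \<in> out v")
  case True
  thus ?thesis using assms by (auto simp: out_def F_def)
next
  case False
  hence e: "e \<in> L" "hi e = Some v" using assms by (auto simp: inn_def)
  thus ?thesis using hi_eq[OF e] assms by (auto simp: F_def)
qed

lemma out_pos:
  assumes "e \<in> out v" "Y v k = 0" shows "m e k \<ge> 0" "k \<in> F e \<Longrightarrow> m e k > 0"
proof -
  have e: "e \<in> L" "lo e = v" using assms by (auto simp: out_def)
  thus "m e k \<ge> 0" using Y_lo_eq_0_imp assms by auto
  thus "k \<in> F e \<Longrightarrow> m e k > 0" using e assms by (auto simp: F_def)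
qed

lemma inn_neg:
  assumes "e \<in> inn v" "Y v k = 0" shows "m e k \<le> 0" "k \<in> F e \<Longrightarrow> m e k < 0"
proof -
  have e: "e \<in> L" "hi e = Some v" using assms by (auto simp: inn_def)
  obtain c where c: "c > 0" "Y v k = Y (lo e) k + c * of_int (m e k)" using hi_eq[OF e] by blast
  have y: "Y (lo e) k \<ge> 0" using Y_nonneg lo_V e by auto
  hence "c * of_int (m e k) \<le> 0" using c assms by linarith
  thus le: "m e k \<le> 0" using c by (simp add: mult_le_0_iff)
  assume "k \<in> F e"
  thus "m e k < 0" using c assms le by (auto simp: F_def order_less_le)
qed

text \<open>Unless \<open>v\<close> is isolated, some coordinate vanishes there, because a face has
  only two indices. That coordinate cannot decrease along outgoing edges nor increase along incoming
  ones.\<close>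

lemma mom_nonneg: assumes "v \<in> V" shows "mom v \<ge> 0"
proof (cases "\<exists>k. Y v k = 0")
  case True
  then obtain k where k: "Y v k = 0" by auto
  show ?thesis unfolding mom_eq[OF assms, of k, symmetric]
    using out_pos(1)[OF _ k] inn_neg(1)[OF _ k]
    by (smt (verit) sum_nonneg sum_nonpos)
next
  case False
  have "out v = {} \<and> inn v = {}"
  proof (rule ccontr)
    assume "\<not> ?thesis"
    then obtain e where e: "e \<in> out v \<union> inn v" by auto
    hence "F e = UNIV" using flag_F[OF e] False by auto
    moreover obtain i j where "F e \<subseteq> {i, j}" using face[OF flag_L[OF e]] by blast
    ultimately have "card (UNIV :: 4 set) \<le> card {i, j}" by (metis card_mono finite.emptyI finite.insertI)
    also have "\<dots> \<le> 2" by (simp add: card_insert_if)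
    finally show False by simp
  qed
  thus ?thesis by (simp add: mom_def)
qed

section \<open>Jumps at a level, and vertices inside a face\<close>

lemma cross_notin:
  assumes "v \<in> V" "s < lev v" "lev v < t"
    "\<And>u. u \<in> V \<Longrightarrow> u \<noteq> v \<Longrightarrow> lev u < s \<or> t < lev u"
  shows "s \<notin> lev ` V" "t \<notin> lev ` V"
proof -
  have "lev u \<noteq> s \<and> lev u \<noteq> t" if "u \<in> V" for u
    using assms(4)[OF that] assms(2,3) by (cases "u = v") auto
  thus "s \<notin> lev ` V" "t \<notin> lev ` V" by auto
qed

lemma sum_cross_jump:
  fixes g :: "'e \<Rightarrow> 'a :: ab_group_add"
  assumes "v \<in> V" "s < lev v" "lev v < t"
    "\<And>u. u \<in> V \<Longrightarrow> u \<noteq> v \<Longrightarrow> lev u < s \<or> t < lev u"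
  shows "(\<Sum>e\<in>cross t. g e) - (\<Sum>e\<in>cross s. g e) = (\<Sum>e\<in>out v. g e) - (\<Sum>e\<in>inn v. g e)"
  using cross_jump[OF assms] by (simp add: sum.union_disjoint)

lemma deg_jump:
  assumes "v \<in> V" "s < lev v" "lev v < t"
    "\<And>u. u \<in> V \<Longrightarrow> u \<noteq> v \<Longrightarrow> lev u < s \<or> t < lev u"
  shows "deg t = deg s + mom v"
  using sum_cross_jump[OF assms, of "\<lambda>e. m e 1"] unfolding deg_def mom_def by linarith

lemma face_term_mono:
  assumes "v \<in> V" "s < lev v" "lev v < t"
    "\<And>u. u \<in> V \<Longrightarrow> u \<noteq> v \<Longrightarrow> lev u < s \<or> t < lev u"
    and "a \<noteq> b" "on a b (out v) = {}" "on a b (inn v) = {}"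
  shows "face_term a b s \<le> face_term a b t"
proof -
  have "area a b s \<le> area a b t" using area_jump[OF assms(1-5)] assms(6,7) by simp
  moreover have "flux a b s = flux a b t" "flux b a s = flux b a t"
    using flux_jump[OF assms(1-4), of a b] flux_jump[OF assms(1-4), of b a] assms(6,7)
    by (simp_all add: on_commute[of b a])
  ultimately show ?thesis by (simp add: face_term_def)
qed

lemma face_term_commute: "a \<noteq> b \<Longrightarrow> face_term a b t = face_term b a t"
  by (simp add: face_term_def area_commute mult.commute)

text \<open>A third coordinate vanishes along every edge at \<open>v\<close>, so balancing becomes
  the classical condition with zero net vector: fluxes do not change, and the interaction with
  bystanders drops out. What remains is Pick's inequality for the incoming and the outgoing edges,
  glued along their equal total vectors.\<close>

lemma potential_jump_face:
  assumes jump: "v \<in> V" "s < lev v" "lev v < t"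
    "\<And>u. u \<in> V \<Longrightarrow> u \<noteq> v \<Longrightarrow> lev u < s \<or> t < lev u"
    and ij: "i \<noteq> j" "Y v i \<noteq> 0" "Y v j \<noteq> 0"
  shows "4 * (real (card (out v)) + real (card (inn v)) - 2) \<le> potential t - potential s"
proof -
  have Fv: "F e = {i, j}" if e: "e \<in> out v \<union> inn v" for e
  proof -
    obtain a b where "F e \<subseteq> {a, b}" using face[OF flag_L[OF e]] by blast
    thus ?thesis using flag_F[OF e] ij by blast
  qed
  have on: "on i j (out v) = out v" "on i j (inn v) = inn v" using Fv by (auto simp: on_def)
  have on': "on a b (out v) = {}" "on a b (inn v) = {}" if "{a, b} \<noteq> {i, j}" for a b
    using Fv that by (auto simp: on_def)
  obtain k where k: "k \<noteq> i" "k \<noteq> j"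
  proof -
    have "\<exists>k. k \<notin> {i, j}"
    proof (rule ccontr)
      assume "\<not> ?thesis"
      hence "UNIV \<subseteq> {i, j}" by auto
      hence "card (UNIV :: 4 set) \<le> card {i, j}" by (intro card_mono) auto
      thus False using ij by simp
    qed
    thus ?thesis using that by blast
  qed
  have "m e k = 0" if "e \<in> out v \<union> inn v" for e using Fv[OF that] k by (intro m_eq_0[of e "{i, j}"]) auto
  hence mom0: "mom v = 0" unfolding mom_eq[OF jump(1), of k, symmetric] by simp
  have bal: "(\<Sum>e\<in>out v. m e a) = (\<Sum>e\<in>inn v. m e a)" for a
    using mom_eq[OF jump(1), of a] mom0 by simp
  have PO: "dets i j (out v) + dets i j (inn v) \<le> face_term a b t - face_term a b s"
    if ab: "{a, b} = {i, j}" for a b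
  proof -
    have S0: "(\<Sum>e\<in>out v. det2 i j e f) - (\<Sum>e\<in>inn v. det2 i j e f) = 0" for f
      by (simp add: det2_def sum_subtractf sum_distrib_right[symmetric] bal)
    have "dets i j (out v) + dets i j (inn v) \<le> area i j t - area i j s"
      using area_jump[OF jump ij(1)] unfolding on S0 by (simp add: dets_def on)
    moreover have "flux i j s = flux i j t" "flux j i s = flux j i t"
      using flux_jump[OF jump, of i j] flux_jump[OF jump, of j i] bal
      by (simp_all add: on_commute[of j i] on)
    ultimately have "dets i j (out v) + dets i j (inn v) \<le> face_term i j t - face_term i j s"
      by (simp add: face_term_def)
    moreover have "(a = i \<and> b = j) \<or> (a = j \<and> b = i)" using ab by (auto simp: doubleton_eq_iff)
    ultimately show ?thesis using face_term_commute ij(1) by metis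
  qed
  \<comment> \<open>The face of \<open>v\<close> occurs as two ordered pairs, so its gain enters
    \<open>pairing\<close> twice.\<close>
  define H where "H a b = (if {a, b} = {i, j} then real_of_int (dets i j (out v) + dets i j (inn v)) else 0)" for a b
  have "(\<Sum>a\<in>UNIV. \<Sum>b\<in>-{a}. H a b) \<le> (\<Sum>a\<in>UNIV. \<Sum>b\<in>-{a}. face_term a b t - face_term a b s)"
    using PO face_term_mono[OF jump _ on'] by (intro sum_mono) (auto simp: H_def)
  also have "\<dots> = pairing t - pairing s"
    unfolding pairing_def using deg_jump[OF jump] mom0 by (simp add: sum_subtractf)
  finally have "(\<Sum>a\<in>UNIV. \<Sum>b\<in>-{a}. H a b) \<le> pairing t - pairing s" .
  moreover have "(\<Sum>a\<in>UNIV. \<Sum>b\<in>-{a}. H a b) = 2 * real_of_int (dets i j (out v) + dets i j (inn v))"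
  proof -
    have row: "(\<Sum>b\<in>-{a}. H a b) = (if a \<in> {i, j} then real_of_int (dets i j (out v) + dets i j (inn v)) else 0)" for a
    proof -
      have "H a b = (if b = (if a = i then j else i) then
         (if a \<in> {i, j} then real_of_int (dets i j (out v) + dets i j (inn v)) else 0) else 0)" if "b \<in> -{a}" for b
        using that ij by (auto simp: H_def doubleton_eq_iff)
      hence "(\<Sum>b\<in>-{a}. H a b) = (\<Sum>b\<in>-{a}. (if b = (if a = i then j else i) then
         (if a \<in> {i, j} then real_of_int (dets i j (out v) + dets i j (inn v)) else 0) else 0))"
        by (intro sum.cong refl)
      also have "\<dots> = (if a \<in> {i, j} then real_of_int (dets i j (out v) + dets i j (inn v)) else 0)"
        using ij by (subst sum.delta) auto
      finally show ?thesis .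
    qed
    have "(\<Sum>a\<in>UNIV. \<Sum>b\<in>-{a}. H a b) = (\<Sum>a\<in>{i, j}. real_of_int (dets i j (out v) + dets i j (inn v)))"
      unfolding row by (subst sum.inter_restrict[symmetric]) auto
    thus ?thesis using ij(1) by simp
  qed
  ultimately have P: "2 * real_of_int (dets i j (out v) + dets i j (inn v)) \<le> pairing t - pairing s" by simp
  have W: "real_of_int (\<Sum>e\<in>cross t. w e - 1) - of_int (\<Sum>e\<in>cross s. w e - 1)
      = of_int ((\<Sum>e\<in>out v. w e - 1) - (\<Sum>e\<in>inn v. w e - 1))"
    using sum_cross_jump[OF jump, of "\<lambda>e. w e - 1"] by (metis of_int_diff)
  have sub: "out v \<subseteq> L" "inn v \<subseteq> L" by (auto simp: out_def inn_def)
  have main: "2 * (int (card (out v)) + int (card (inn v)) - 2)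
      \<le> dets i j (out v) + dets i j (inn v) + 2 * ((\<Sum>e\<in>out v. w e - 1) - (\<Sum>e\<in>inn v. w e - 1))"
  proof (cases "out v = {} \<or> inn v = {}")
    case True
    \<comment> \<open>All edges climb, so vectors with sum zero must be absent. If one side is
      empty, \<open>v\<close> is isolated and the left-hand side of the bound is negative.\<close>
    have z: "S = {}" if "S \<subseteq> L" "\<And>a. (\<Sum>e\<in>S. m e a) = 0" for S
    proof (rule ccontr)
      assume "S \<noteq> {}"
      hence "0 < (\<Sum>e\<in>S. sl e)" using that finL by (intro sum_pos) (auto intro: sl_pos finite_subset)
      also have "(\<Sum>e\<in>S. sl e) = (\<Sum>a\<in>UNIV. lam a * of_int (\<Sum>e\<in>S. m e a))"
        unfolding sl_def of_int_sum sum_distrib_left by (rule sum.swap)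
      finally show False using that by simp
    qed
    have "out v = {} \<and> inn v = {}" using True bal z[OF sub(1)] z[OF sub(2)] by auto
    thus ?thesis using dets_nonneg[of i j "out v"] dets_nonneg[of i j "inn v"] by simp
  next
    case False
    have "2 * ((\<Sum>e\<in>inn v. w e) - gcd (\<Sum>e\<in>inn v. m e i) (\<Sum>e\<in>inn v. m e j)) \<le> dets i j (inn v)"
      using dets_bounds(1)[OF ij(1) sub(2)] False unfolding on by (auto simp: inn_def)
    moreover have "2 * ((\<Sum>e\<in>out v. 2 - w e) - 2 + gcd (\<Sum>e\<in>out v. m e i) (\<Sum>e\<in>out v. m e j)) \<le> dets i j (out v)"
      using dets_bounds(2)[OF ij(1) sub(1)] False unfolding on by (auto simp: out_def)
    ultimately show ?thesis unfolding bal by (simp add: sum_subtractf)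
  qed
  have "real_of_int (2 * (2 * (int (card (out v)) + int (card (inn v)) - 2)))
     \<le> real_of_int (2 * (dets i j (out v) + dets i j (inn v) + 2 * ((\<Sum>e\<in>out v. w e - 1) - (\<Sum>e\<in>inn v. w e - 1))))"
    unfolding of_int_le_iff using main by simp
  thus ?thesis
    unfolding potential_def using P W deg_jump[OF jump] mom0
    by (simp del: of_int_sum add: algebra_simps)
qed

section \<open>Vertices on an edge of the plane\<close>

lemma on_diag:
  assumes e: "e \<in> L" "F e = {i}" shows "m e i \<ge> 1" "w e = m e i" "k \<noteq> i \<Longrightarrow> m e k = 0"
proof -
  have z: "m e k = 0" if "k \<noteq> i" for k using m_eq_0[of e "{i}" k] e that by simp
  have "sl e = (\<Sum>k\<in>{i}. lam k * of_int (m e k))"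
    unfolding sl_def using z by (intro sum.mono_neutral_right) auto
  hence "0 < lam i * of_int (m e i)" using sl_pos[OF e(1)] by simp
  thus "m e i \<ge> 1" using lam_pos[of i] by (simp add: zero_less_mult_iff)
  thus "w e = m e i" using weight[OF e(1), of i i] e(2) by simp
qed (use m_eq_0[of e "{i}" k] e in simp)

text \<open>Edges leaving \<open>v\<close> along the \<open>i\<close>-th edge of the plane are
  parallel, so there is at most one, and its weight is its only nonzero component.\<close>

lemma sum_on_diag_out:
  "(\<Sum>e\<in>on i i (out v). 2 - w e) = (let a = (\<Sum>e\<in>on i i (out v). m e i) in if a > 0 then 2 - a else 0)"
proof -
  have mem: "e \<in> L" "F e = {i}" "lo e = v" if "e \<in> on i i (out v)" for e
    using that by (auto simp: on_def out_def)
  have eq: "e = f" if "e \<in> on i i (out v)" "f \<in> on i i (out v)" for e f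
  proof (rule ccontr)
    assume "e \<noteq> f"
    note e = mem[OF that(1)] and f = mem[OF that(2)]
    have "\<forall>k. real_of_int (m e k) = (of_int (m e i) / of_int (m f i)) * of_int (m f k)"
    proof
      fix k show "real_of_int (m e k) = (of_int (m e i) / of_int (m f i)) * of_int (m f k)"
        using on_diag(1)[OF f(1,2)] on_diag(3)[OF e(1,2), of k] on_diag(3)[OF f(1,2), of k] by (cases "k = i") auto
    qed
    moreover have "real_of_int (m e i) / of_int (m f i) > 0"
      using on_diag(1)[OF e(1,2)] on_diag(1)[OF f(1,2)] by simp
    ultimately obtain c where "c > 0" "\<forall>k. real_of_int (m e k) = c * of_int (m f k)" by blast
    moreover have "lo e = lo f" using e(3) f(3) by simp
    ultimately show False using distinct[OF e(1) f(1) \<open>e \<noteq> f\<close>, of c] by blast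
  qed
  show ?thesis
  proof (cases "on i i (out v) = {}")
    case False
    then obtain e where "on i i (out v) = {e}" using eq by blast
    thus ?thesis using on_diag[OF mem(1,2)[of e]] by (simp add: Let_def)
  qed (simp add: Let_def)
qed

text \<open>With the incoming edges reversed, all edges of this face at \<open>v\<close> have
  positive \<open>j\<close>-component, so the half-plane estimate applies to their sum
  \<open>(A, \<delta>)\<close>. Climbing fixes the sign of every determinant between an outgoing and
  an incoming edge, so these collapse to a product of sums. The second alternative for
  \<open>X\<close> comes from a single incoming edge: it climbs although its
  \<open>j\<close>-component is negative, hence its \<open>i\<close>-component is positive and
  \<open>A\<close> negative.\<close>

lemma dets_flags_bound:
  assumes v: "v \<in> V" "Y v j = 0" and ij: "i \<noteq> j" and ne: "on i j (out v \<union> inn v) \<noteq> {}"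
  defines "A \<equiv> (\<Sum>e\<in>on i j (out v). m e i) - (\<Sum>e\<in>on i j (inn v). m e i)"
    and "\<delta> \<equiv> (\<Sum>e\<in>on i j (out v). m e j) - (\<Sum>e\<in>on i j (inn v). m e j)"
    and "X \<equiv> (\<Sum>e\<in>on i j (inn v). w e) + (\<Sum>e\<in>on i j (out v). 2 - w e) - dets i j (out v \<union> inn v) div 2"
  shows "X \<le> 2 - gcd A \<delta> \<or> X \<le> gcd A \<delta> \<and> A < 0"
    and "dets i j (out v \<union> inn v) = dets i j (out v) + dets i j (inn v)
      - 2 * ((\<Sum>e\<in>on i j (out v). m e i) * (\<Sum>e\<in>on i j (inn v). m e j)
           - (\<Sum>e\<in>on i j (out v). m e j) * (\<Sum>e\<in>on i j (inn v). m e i))"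
proof -
  define U P Q where "U = on i j (out v \<union> inn v)" and "P = on i j (out v)" and "Q = on i j (inn v)"
  have UPQ: "U = P \<union> Q" "P \<inter> Q = {}" using out_inn_disjoint by (auto simp: U_def P_def Q_def on_def)
  have fin': "finite U" "finite P" "finite Q" by (auto simp: U_def P_def Q_def)
  have U: "e \<in> L" "F e = {i, j}" if "e \<in> U" for e using that by (auto simp: U_def on_def out_def inn_def)
  have P: "e \<in> U" "lo e = v" "m e j > 0" if "e \<in> P" for e
    using that out_pos(2)[OF _ v(2)] by (auto simp: P_def U_def on_def out_def)
  have Q: "e \<in> U" "hi e = Some v" "m e j < 0" if "e \<in> Q" for e
    using that inn_neg(2)[OF _ v(2)] by (auto simp: Q_def U_def on_def inn_def)
  define s :: "'e \<Rightarrow> int" where "s e = (if e \<in> P then 1 else - 1)" for e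
  have slp: "lam i * of_int (m e i) + lam j * of_int (m e j) > 0" if "e \<in> U" for e
    using sl_on[OF ij U(2)[OF that]] sl_pos[OF U(1)[OF that]] by simp
  have mixed: "det2 i j e f < 0" if "e \<in> P" "f \<in> Q" for e f
  proof -
    have e: "lam i * of_int (m e i) > - lam j * of_int (m e j)" "m e j > 0"
      and f: "lam i * of_int (m f i) > - lam j * of_int (m f j)" "m f j < 0"
      using slp P[OF that(1)] Q[OF that(2)] by (smt (verit) mult_minus_left)+
    have "lam i * of_int (m e i) * of_int (m f j) < - lam j * of_int (m e j) * of_int (m f j)"
      using e f by (intro mult_strict_right_mono_neg) auto
    moreover have "- lam j * of_int (m f j) * of_int (m e j) < lam i * of_int (m f i) * of_int (m e j)"
      using e f by (intro mult_strict_right_mono) auto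
    ultimately have "lam i * of_int (det2 i j e f) < 0" by (simp add: det2_def algebra_simps)
    thus ?thesis using lam_pos[of i] by (simp add: mult_less_0_iff)
  qed
  have "(\<Sum>e\<in>Q. \<Sum>f\<in>P. \<bar>det2 i j e f\<bar>) = (\<Sum>e\<in>P. \<Sum>f\<in>Q. \<bar>det2 i j e f\<bar>)"
    by (subst sum.swap) (intro sum.cong refl, simp add: det2_def abs_minus_commute mult.commute)
  also have "\<dots> = (\<Sum>e\<in>P. \<Sum>f\<in>Q. - det2 i j e f)"
    using mixed by (intro sum.cong refl) (simp add: less_imp_le)
  also have "\<dots> = - ((\<Sum>e\<in>P. m e i) * (\<Sum>e\<in>Q. m e j) - (\<Sum>e\<in>P. m e j) * (\<Sum>e\<in>Q. m e i))"
    by (simp add: det2_def sum_product sum_subtractf sum_negf[symmetric])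
  finally have QP: "(\<Sum>e\<in>Q. \<Sum>f\<in>P. \<bar>det2 i j e f\<bar>) = \<dots>" .
  have PQ: "(\<Sum>e\<in>P. \<Sum>f\<in>Q. \<bar>det2 i j e f\<bar>) = (\<Sum>e\<in>Q. \<Sum>f\<in>P. \<bar>det2 i j e f\<bar>)"
    by (subst sum.swap) (intro sum.cong refl, simp add: det2_def abs_minus_commute mult.commute)
  show "dets i j (out v \<union> inn v) = dets i j (out v) + dets i j (inn v)
      - 2 * ((\<Sum>e\<in>on i j (out v). m e i) * (\<Sum>e\<in>on i j (inn v). m e j)
           - (\<Sum>e\<in>on i j (out v). m e j) * (\<Sum>e\<in>on i j (inn v). m e i))"
    unfolding dets_def U_def[symmetric] P_def[symmetric] Q_def[symmetric] UPQ(1)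
    using PQ QP fin' UPQ(2) by (simp add: sum.union_disjoint sum.distrib)
  have sumP: "(\<Sum>e\<in>U. s e * h e) = (\<Sum>e\<in>P. h e) - (\<Sum>e\<in>Q. h e)" for h :: "'e \<Rightarrow> int"
  proof -
    have "(\<Sum>e\<in>P. s e * h e) = (\<Sum>e\<in>P. h e)" by (intro sum.cong) (auto simp: s_def)
    moreover have "(\<Sum>e\<in>Q. s e * h e) = (\<Sum>e\<in>Q. - h e)"
      using UPQ(2) by (intro sum.cong) (auto simp: s_def)
    ultimately show ?thesis using fin' UPQ by (simp add: sum.union_disjoint sum_negf)
  qed
  have A\<delta>: "A = (\<Sum>e\<in>U. s e * m e i)" "\<delta> = (\<Sum>e\<in>U. s e * m e j)"
    unfolding sumP by (simp_all add: A_def \<delta>_def P_def Q_def)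
  have w: "gcd (s e * m e i) (s e * m e j) = w e" if "e \<in> U" for e
    using weight_on[OF U[OF that]] by (simp add: s_def)
  have card_ge: "card U \<ge> 1" using ne fin' by (simp add: U_def[symmetric] Suc_le_eq card_gt_0_iff)
  show "X \<le> 2 - gcd A \<delta> \<or> X \<le> gcd A \<delta> \<and> A < 0"
  proof (cases "card U \<ge> 2")
    case True
    have "2 * (gcd A \<delta> + (\<Sum>e\<in>U. gcd (s e * m e i) (s e * m e j)) - 2)
       \<le> (\<Sum>e\<in>U. \<Sum>f\<in>U. \<bar>(s e * m e i) * (s f * m f j) - (s e * m e j) * (s f * m f i)\<bar>)"
      unfolding A\<delta>
    proof (rule half_plane_det_bound[OF fin'(1) True, where \<alpha> = 0 and \<beta> = 1])
      fix e assume "e \<in> U"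
      thus "0 < 0 * real_of_int (s e * m e i) + 1 * real_of_int (s e * m e j)"
        using P(3) Q(3) UPQ by (auto simp: s_def)
    next
      fix e f assume ef: "e \<in> U" "f \<in> U" "e \<noteq> f"
      have "det2 i j e f \<noteq> 0"
      proof (cases "e \<in> P \<longleftrightarrow> f \<in> P")
        case True
        thus ?thesis using det2_neq_0[OF U(1)[OF ef(1)] U(1)[OF ef(2)] U(2)[OF ef(1)] U(2)[OF ef(2)] ij ef(3)]
            P(2) Q(2) ef UPQ by auto
      next
        case False
        thus ?thesis using mixed[of e f] mixed[of f e] ef UPQ by (auto simp: det2_def mult.commute)
      qed
      thus "(s e * m e i) * (s f * m f j) - (s e * m e j) * (s f * m f i) \<noteq> 0"
        by (auto simp: s_def det2_def)
    qed
    also have "\<dots> = dets i j (out v \<union> inn v)"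
      unfolding dets_def U_def[symmetric]
      by (intro sum.cong refl) (auto simp: s_def det2_def abs_minus_commute)
    finally have "2 * (gcd A \<delta> + (\<Sum>e\<in>U. w e) - 2) \<le> dets i j (out v \<union> inn v)"
      using w by simp
    moreover have "(\<Sum>e\<in>P. 2 - w e) \<le> (\<Sum>e\<in>P. w e)"
    proof (rule sum_mono)
      fix e assume "e \<in> P"
      thus "2 - w e \<le> w e" using weight_pos[OF U(1)[OF P(1)]] by fastforce
    qed
    moreover have "(\<Sum>e\<in>U. w e) = (\<Sum>e\<in>P. w e) + (\<Sum>e\<in>Q. w e)"
      using fin' UPQ by (simp add: sum.union_disjoint)
    moreover have "q + s - d div 2 \<le> 2 - g" if "2 * (g + u - 2) \<le> d" "s \<le> p" "u = p + q" for q s d g u p :: int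
      using that by presburger
    ultimately have "X \<le> 2 - gcd A \<delta>" unfolding X_def P_def[symmetric] Q_def[symmetric] by blast
    thus ?thesis ..
  next
    case False
    hence "card U = 1" using card_ge by simp
    then obtain e where e: "U = {e}" by (auto simp: card_1_singleton_iff)
    have g: "gcd A \<delta> = w e" using w[of e] e by (simp add: A\<delta>)
    have d0: "dets i j (out v \<union> inn v) = 0" by (simp add: dets_def U_def[symmetric] e det2_def)
    have PQ1: "P \<union> Q = {e}" "P \<inter> Q = {}" using UPQ e by simp_all
    hence "P = {} \<or> P = {e}" "Q = {} \<or> Q = {e}" by (metis subset_singletonD Un_upper1 Un_upper2)+
    with PQ1 consider "P = {e}" "Q = {}" | "P = {}" "Q = {e}" by auto
    thus ?thesis
    proof cases
      case 1
      thus ?thesis using g d0 by (simp add: X_def P_def Q_def)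
    next
      case 2
      have "lam i * of_int (m e i) > 0"
        using slp[of e] Q(3)[of e] 2 e lam_pos[of j] by (smt (verit) insertI1 mult_pos_neg of_int_less_0_iff)
      hence "m e i > 0" using lam_pos[of i] by (simp add: zero_less_mult_iff)
      hence "A < 0" using 2 by (simp add: A_def P_def Q_def)
      thus ?thesis using g d0 2 by (simp add: X_def P_def Q_def)
    qed
  qed
qed

lemma compl_singleton_4: "\<exists>a b c. - {i :: 4} = {a, b, c} \<and> a \<noteq> b \<and> a \<noteq> c \<and> b \<noteq> c"
proof -
  have "card (- {i}) = 3" by (simp add: Compl_eq_Diff_UNIV card_Diff_singleton)
  thus ?thesis by (auto simp: card_3_iff)
qed

lemma sum_pairs_split:
  fixes G :: "4 \<Rightarrow> 4 \<Rightarrow> real"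
  assumes "\<And>a b. a \<noteq> b \<Longrightarrow> G a b = G b a"
  shows "(\<Sum>a\<in>UNIV. \<Sum>b\<in>-{a}. G a b) = 2 * (\<Sum>j\<in>-{i}. G i j) + (\<Sum>a\<in>-{i}. \<Sum>b\<in>-{a}-{i}. G a b)"
proof -
  have "(\<Sum>a\<in>UNIV. \<Sum>b\<in>-{a}. G a b) = (\<Sum>b\<in>-{i}. G i b) + (\<Sum>a\<in>-{i}. \<Sum>b\<in>-{a}. G a b)"
    by (simp add: sum.remove[of UNIV i] Compl_eq_Diff_UNIV)
  also have "(\<Sum>a\<in>-{i}. \<Sum>b\<in>-{a}. G a b) = (\<Sum>a\<in>-{i}. G i a + (\<Sum>b\<in>-{a}-{i}. G a b))"
    using assms by (intro sum.cong refl) (subst sum.remove[of _ i], auto)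
  finally show ?thesis by (simp add: sum.distrib)
qed

lemma deg_eq_flux: "t \<notin> lev ` V \<Longrightarrow> deg t = flux i i t + (\<Sum>j\<in>-{i}. flux i j t)"
proof -
  assume t: "t \<notin> lev ` V"
  have "deg t = (\<Sum>j\<in>UNIV. flux i j t)"
    unfolding deg_eq[OF t, of i, symmetric] flux_def
    by (rule sum_on) (auto simp: cross_def F_def)
  also have "\<dots> = flux i i t + (\<Sum>j\<in>-{i}. flux i j t)"
    by (simp add: sum.remove[of UNIV i] Compl_eq_Diff_UNIV)
  finally show ?thesis .
qed

text \<open>The net flow \<open>\<delta>\<close> is the same in all three adjacent faces. Its
  products with the fluxes there add up to \<open>\<delta>\<close> times the degree minus the flux
  along the edge itself, so the jump of the squared degree absorbs the bystanders inside the faces.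
  The local determinants \<open>Th\<close> and a term \<open>\<delta> * (mp + mm)\<close> remain,
  which \<open>edge_vertex_bound\<close> compares with the valency.\<close>

lemma potential_jump_edge:
  assumes jump: "v \<in> V" "s < lev v" "lev v < t"
    "\<And>u. u \<in> V \<Longrightarrow> u \<noteq> v \<Longrightarrow> lev u < s \<or> t < lev u"
    and i: "Y v i \<noteq> 0" "\<And>k. k \<noteq> i \<Longrightarrow> Y v k = 0"
  shows "4 * (real (card (out v)) + real (card (inn v)) - 2) \<le> potential t - potential s"
proof -
  define \<delta> where "\<delta> = mom v"
  define Th where "Th j = dets i j (out v \<union> inn v)" for j
  define mp mm where "mp = (\<Sum>e\<in>on i i (out v). m e i)" and "mm = (\<Sum>e\<in>on i i (inn v). m e i)"
  have iF: "i \<in> F e" if "e \<in> out v \<union> inn v" for e using flag_F[OF that i(1)] .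
  have comp: "(\<Sum>e\<in>S. m e j) = (\<Sum>e\<in>on i j S. m e j)" if "S \<subseteq> out v \<union> inn v" "j \<noteq> i" for S j
  proof (rule sum.mono_neutral_right)
    show "finite S" using that(1) by (rule finite_subset) auto
    show "\<forall>e\<in>S - on i j S. m e j = 0"
    proof
      fix e assume e: "e \<in> S - on i j S"
      hence e': "e \<in> out v \<union> inn v" using that by auto
      obtain a b where "F e \<subseteq> {a, b}" using face[OF flag_L[OF e']] by blast
      hence "j \<notin> F e" using iF[OF e'] that(2) e by (auto simp: on_def)
      thus "m e j = 0" by (auto simp: F_def)
    qed
  qed (auto simp: on_def)
  have \<delta>_j: "\<delta> = (\<Sum>e\<in>on i j (out v). m e j) - (\<Sum>e\<in>on i j (inn v). m e j)" if "j \<noteq> i" for j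
    unfolding \<delta>_def mom_eq[OF jump(1), of j, symmetric] using comp[of "out v" j] comp[of "inn v" j] that by simp
  have on_empty: "on a b (out v) = {}" "on a b (inn v) = {}" if "i \<notin> {a, b}" for a b
    using iF that by (auto simp: on_def)
  have Th_eq: "Th j = dets i j (out v) + dets i j (inn v)
      - 2 * ((\<Sum>e\<in>on i j (out v). m e i) * (\<Sum>e\<in>on i j (inn v). m e j)
           - (\<Sum>e\<in>on i j (out v). m e j) * (\<Sum>e\<in>on i j (inn v). m e i))" if "j \<noteq> i" for j
  proof (cases "on i j (out v \<union> inn v) = {}")
    case True
    thus ?thesis by (simp add: Th_def dets_def on_Un)
  next
    case False
    thus ?thesis unfolding Th_def using that by (intro dets_flags_bound(2)[OF jump(1) i(2)]) auto
  qed
  have face_jump: "Th j - 2 * \<delta> * (flux i j s + flux i j t) \<le> face_term i j t - face_term i j s" if j: "j \<noteq> i" for j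
  proof -
    define C Oi Oj Ni Nj Ci Cj where "C = on i j (cross (lev v))"
      and "Oi = (\<Sum>e\<in>on i j (out v). m e i)" and "Oj = (\<Sum>e\<in>on i j (out v). m e j)"
      and "Ni = (\<Sum>e\<in>on i j (inn v). m e i)" and "Nj = (\<Sum>e\<in>on i j (inn v). m e j)"
      and "Ci = (\<Sum>e\<in>C. m e i)" and "Cj = (\<Sum>e\<in>C. m e j)"
    have \<delta>: "\<delta> = Oj - Nj" using \<delta>_j[OF j] by (simp add: Oj_def Nj_def)
    \<comment> \<open>Coordinate \<open>j\<close> is positive on a bystander in this face and zero
      at \<open>v\<close>. All signs being 1, the interaction becomes a product of total
      vectors.\<close>
    have sg: "sgn (pos f (lev v) j - Y v j) = 1" if "f \<in> C" for f
      using pos_pos[of f "lev v" j] that i(2)[OF j] by (auto simp: C_def on_def)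
    have S: "(\<Sum>e\<in>on i j (out v). det2 i j e f) - (\<Sum>e\<in>on i j (inn v). det2 i j e f)
       = (Oi - Ni) * m f j - \<delta> * m f i" for f
      by (simp add: det2_def \<delta> Oi_def Ni_def Oj_def Nj_def sum_subtractf sum_distrib_right[symmetric] algebra_simps)
    have "(\<Sum>f\<in>C. sgn (pos f (lev v) j - Y v j) * of_int ((Oi - Ni) * m f j - \<delta> * m f i))
       = (\<Sum>f\<in>C. real_of_int ((Oi - Ni) * m f j - \<delta> * m f i))"
      using sg by (intro sum.cong) auto
    also have "\<dots> = of_int ((Oi - Ni) * Cj - \<delta> * Ci)"
      by (simp add: Ci_def Cj_def sum_subtractf sum_distrib_left)
    finally have "2 * real_of_int ((Oi - Ni) * Cj - \<delta> * Ci) + of_int (dets i j (out v)) + of_int (dets i j (inn v))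
        \<le> area i j t - area i j s"
      using area_jump[OF jump j[symmetric]] unfolding S C_def[symmetric] dets_def by simp
    hence "real_of_int (2 * ((Oi - Ni) * Cj - \<delta> * Ci) + dets i j (out v) + dets i j (inn v))
        \<le> area i j t - area i j s" by simp
    moreover have fx: "flux i j t = Ci + Oi" "flux i j s = Ci + Ni" "flux j i t = Cj + Oj" "flux j i s = Cj + Nj"
      using flux_jump[OF jump, of i j] flux_jump[OF jump, of j i]
      by (simp_all add: on_commute[of j i] C_def Ci_def Cj_def Oi_def Oj_def Ni_def Nj_def)
    moreover have "2 * ((Oi - Ni) * Cj - \<delta> * Ci) + dets i j (out v) + dets i j (inn v)
       - 2 * (flux i j t * flux j i t) + 2 * (flux i j s * flux j i s) = Th j - 2 * \<delta> * (flux i j s + flux i j t)"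
      unfolding Th_eq[OF j] fx Oi_def[symmetric] Oj_def[symmetric] Ni_def[symmetric] Nj_def[symmetric] \<delta>
      by (simp add: algebra_simps)
    ultimately show ?thesis unfolding face_term_def by linarith
  qed
  have other: "0 \<le> (\<Sum>a\<in>-{i}. \<Sum>b\<in>-{a}-{i}. face_term a b t - face_term a b s)"
    using face_term_mono[OF jump] on_empty by (intro sum_nonneg) auto
  have dg: "deg t = deg s + \<delta>" using deg_jump[OF jump] by (simp add: \<delta>_def)
  \<comment> \<open>Bystanders on the \<open>i\<close>-th edge climb, so they only add to the flow
    of the edges at \<open>v\<close>.\<close>
  have fii: "flux i i s \<ge> mm" "flux i i t \<ge> mp"
  proof -
    have "0 \<le> (\<Sum>e\<in>on i i (cross (lev v)). m e i)"
    proof (rule sum_nonneg)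
      fix e assume "e \<in> on i i (cross (lev v))"
      thus "0 \<le> m e i" using on_diag(1)[of e i] by (auto simp: on_def cross_def)
    qed
    thus "flux i i s \<ge> mm" "flux i i t \<ge> mp"
      using flux_jump[OF jump, of i i] by (auto simp: mp_def mm_def)
  qed
  have \<delta>0: "\<delta> \<ge> 0" using mom_nonneg[OF jump(1)] by (simp add: \<delta>_def)
  have "pairing t - pairing s = (\<Sum>a\<in>UNIV. \<Sum>b\<in>-{a}. face_term a b t - face_term a b s)
      + 4 * ((of_int (deg t))^2 - (of_int (deg s))^2)"
    by (simp add: pairing_def sum_subtractf)
  moreover have "(\<Sum>a\<in>UNIV. \<Sum>b\<in>-{a}. face_term a b t - face_term a b s) \<ge> 2 * (\<Sum>j\<in>-{i}. face_term i j t - face_term i j s)"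
    using other by (subst sum_pairs_split[where i = i]) (auto simp: face_term_commute)
  moreover have "(\<Sum>j\<in>-{i}. face_term i j t - face_term i j s)
      \<ge> (\<Sum>j\<in>-{i}. of_int (Th j - 2 * \<delta> * (flux i j s + flux i j t)))"
    using face_jump by (intro sum_mono) auto
  moreover define N where "N = (\<Sum>j\<in>-{i}. Th j) - 2 * \<delta> * ((deg s - flux i i s) + (deg t - flux i i t))"
  have "(\<Sum>j\<in>-{i}. Th j - 2 * \<delta> * (flux i j s + flux i j t)) = N"
    using deg_eq_flux[OF cross_notin(1)[OF jump], of i] deg_eq_flux[OF cross_notin(2)[OF jump], of i]
    by (simp add: N_def sum_subtractf sum_distrib_left distrib_left sum.distrib)
  hence "(\<Sum>j\<in>-{i}. of_int (Th j - 2 * \<delta> * (flux i j s + flux i j t))) = real_of_int N"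
    unfolding of_int_sum[symmetric] by simp
  ultimately have "2 * real_of_int N + 4 * ((of_int (deg t))^2 - (of_int (deg s))^2) \<le> pairing t - pairing s"
    by argo
  hence bound: "real_of_int (2 * N + 4 * ((deg t)^2 - (deg s)^2)) \<le> pairing t - pairing s" by simp
  have "2 * N + 4 * ((deg t)^2 - (deg s)^2) = 2 * (\<Sum>j\<in>-{i}. Th j) + 4 * \<delta> * (flux i i s + flux i i t)"
    unfolding dg N_def by (simp add: power2_eq_square algebra_simps)
  moreover have "2 * (\<Sum>j\<in>-{i}. Th j) + 4 * (\<delta> * (mp + mm)) \<le> 2 * (\<Sum>j\<in>-{i}. Th j) + 4 * \<delta> * (flux i i s + flux i i t)"
    using mult_left_mono[OF add_mono[OF fii], of "\<delta>"] \<delta>0 by (simp add: add.commute mult.assoc)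
  ultimately have "2 * (\<Sum>j\<in>-{i}. Th j) + 4 * (\<delta> * (mp + mm)) \<le> 2 * N + 4 * ((deg t)^2 - (deg s)^2)" by simp
  hence "real_of_int (2 * (\<Sum>j\<in>-{i}. Th j) + 4 * (\<delta> * (mp + mm))) \<le> of_int (2 * N + 4 * ((deg t)^2 - (deg s)^2))"
    unfolding of_int_le_iff .
  also note bound
  finally have pair: "real_of_int (2 * (\<Sum>j\<in>-{i}. Th j) + 4 * (\<delta> * (mp + mm))) \<le> pairing t - pairing s" .

  \<comment> \<open>Incoming edges count \<open>w\<close>, outgoing ones \<open>2 - w\<close>: in
    total this is the valency minus the jump of the sum of \<open>w e - 1\<close>.\<close>
  define Z where "Z j = (\<Sum>e\<in>on i j (inn v). w e) + (\<Sum>e\<in>on i j (out v). 2 - w e)" for j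
  have subL: "out v \<subseteq> L" "inn v \<subseteq> L" by (auto simp: out_def inn_def)
  have Zsum: "(\<Sum>e\<in>inn v. w e) + (\<Sum>e\<in>out v. 2 - w e) = (\<Sum>j\<in>-{i}. Z j) + mm + (if mp > 0 then 2 - mp else 0)"
  proof -
    have on_mm: "(\<Sum>e\<in>on i i (inn v). w e) = mm" unfolding mm_def
      by (intro sum.cong refl on_diag(2)) (auto simp: on_def inn_def)
    have "(\<Sum>e\<in>inn v. w e) = (\<Sum>j\<in>UNIV. \<Sum>e\<in>on i j (inn v). w e)"
      using iF by (intro sum_on[OF subL(2)]) auto
    moreover have "(\<Sum>e\<in>out v. 2 - w e) = (\<Sum>j\<in>UNIV. \<Sum>e\<in>on i j (out v). 2 - w e)"
      using iF by (intro sum_on[OF subL(1)]) auto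
    ultimately have "(\<Sum>e\<in>inn v. w e) + (\<Sum>e\<in>out v. 2 - w e) = (\<Sum>j\<in>UNIV. Z j)"
      unfolding Z_def by (simp only: sum.distrib)
    also have "\<dots> = Z i + (\<Sum>j\<in>-{i}. Z j)" by (simp add: sum.remove[of UNIV i] Compl_eq_Diff_UNIV)
    also have "Z i = mm + (if mp > 0 then 2 - mp else 0)"
      using on_mm unfolding Z_def sum_on_diag_out by (simp add: mp_def Let_def)
    finally show ?thesis by simp
  qed
  have mpm: "mp \<ge> 0" "mm \<ge> 0" unfolding mp_def mm_def
    by (auto intro!: sum_nonneg simp: on_def out_def inn_def dest!: on_diag(1))
  have bal: "(\<Sum>j\<in>-{i}. (\<Sum>e\<in>on i j (out v). m e i) - (\<Sum>e\<in>on i j (inn v). m e i)) + mp - mm = \<delta>"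
  proof -
    have "(\<Sum>e\<in>S. m e i) = (\<Sum>e\<in>on i i S. m e i) + (\<Sum>j\<in>-{i}. \<Sum>e\<in>on i j S. m e i)" if "S \<subseteq> L" for S
    proof -
      have "(\<Sum>e\<in>S. m e i) = (\<Sum>j\<in>UNIV. \<Sum>e\<in>on i j S. m e i)" using that by (intro sum_on) (auto simp: F_def)
      thus ?thesis by (simp add: sum.remove[of UNIV i] Compl_eq_Diff_UNIV)
    qed
    from this[OF subL(1)] this[OF subL(2)] show ?thesis
      unfolding \<delta>_def mom_eq[OF jump(1), of i, symmetric] mp_def mm_def by (simp add: sum_subtractf)
  qed
  have main: "(\<Sum>j\<in>-{i}. Z j - Th j div 2) + mm + (if mp > 0 then 2 - mp else 0) \<le> \<delta> + 2 + \<delta> * (mp + mm)"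
  proof (cases "\<delta> = 0")
    case True
    \<comment> \<open>Outgoing edges have positive and incoming ones negative
      \<open>j\<close>-component, so zero net flow leaves no edge in any face at \<open>v\<close>.
      Only flow along the \<open>i\<close>-th edge remains, passing straight through.\<close>
    have em: "on i j (out v) = {} \<and> on i j (inn v) = {}" if j: "j \<noteq> i" for j
    proof (rule ccontr)
      assume ne: "\<not> ?thesis"
      have o: "m e j > 0" if "e \<in> on i j (out v)" for e
        using out_pos(2)[of e v j] that i(2)[OF j] by (auto simp: on_def)
      have n: "m e j < 0" if "e \<in> on i j (inn v)" for e
        using inn_neg(2)[of e v j] that i(2)[OF j] by (auto simp: on_def)
      have o0: "(\<Sum>e\<in>on i j (out v). m e j) \<ge> 0" using o by (intro sum_nonneg) (simp add: less_imp_le)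
      have n0: "(\<Sum>e\<in>on i j (inn v). m e j) \<le> 0" using n by (intro sum_nonpos) (simp add: less_imp_le)
      have eq: "(\<Sum>e\<in>on i j (out v). m e j) = (\<Sum>e\<in>on i j (inn v). m e j)" using \<delta>_j[OF j] True by simp
      show False
      proof (cases "on i j (out v) = {}")
        case False
        hence "(\<Sum>e\<in>on i j (out v). m e j) > 0" using o by (intro sum_pos) auto
        thus False using n0 eq by linarith
      next
        case True
        hence "on i j (inn v) \<noteq> {}" using ne by simp
        hence "(\<Sum>e\<in>on i j (inn v). - m e j) > 0" using n by (intro sum_pos) auto
        thus False using o0 eq unfolding sum_negf by linarith
      qed
    qed
    hence "(\<Sum>j\<in>-{i}. Z j - Th j div 2) = 0"
      unfolding Z_def Th_def dets_def on_Un by (intro sum.neutral) auto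
    moreover have "(\<Sum>j\<in>-{i}. (\<Sum>e\<in>on i j (out v). m e i) - (\<Sum>e\<in>on i j (inn v). m e i)) = 0"
      using em by (intro sum.neutral) auto
    hence "mp = mm" using bal True by linarith
    ultimately show ?thesis using True by simp
  next
    case False
    hence \<delta>1: "\<delta> \<ge> 1" using \<delta>0 by simp
    define A where "A j = (\<Sum>e\<in>on i j (out v). m e i) - (\<Sum>e\<in>on i j (inn v). m e i)" for j
    have X: "Z j - Th j div 2 \<le> 2 - gcd (A j) \<delta> \<or> Z j - Th j div 2 \<le> gcd (A j) \<delta> \<and> A j < 0" if j: "j \<noteq> i" for j
    proof -
      have "on i j (out v \<union> inn v) \<noteq> {}"
      proof
        assume "on i j (out v \<union> inn v) = {}"
        thus False using \<delta>_j[OF j] False by (auto simp: on_Un)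
      qed
      from dets_flags_bound(1)[OF jump(1) i(2)[OF j] j[symmetric] this]
      show ?thesis unfolding Z_def Th_def A_def \<delta>_j[OF j] by simp
    qed
    obtain a b c where abc: "-{i} = {a, b, c}" "a \<noteq> b" "a \<noteq> c" "b \<noteq> c" using compl_singleton_4 by blast
    hence ne: "a \<noteq> i" "b \<noteq> i" "c \<noteq> i" by blast+
    have "(\<Sum>j\<in>-{i}. Z j - Th j div 2) = (Z a - Th a div 2) + (Z b - Th b div 2) + (Z c - Th c div 2)"
      unfolding abc(1) using abc by simp
    moreover have "A a + A b + A c + mp - mm = \<delta>"
      using bal abc(2-) unfolding abc(1) A_def[symmetric] by simp
    ultimately show ?thesis
      using edge_vertex_bound[OF \<delta>1 mpm(1) mpm(2) _ X[OF ne(1)] X[OF ne(2)] X[OF ne(3)]] by (simp only:)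
  qed
  have half: "2 * (\<Sum>j\<in>-{i}. Th j div 2) \<le> (\<Sum>j\<in>-{i}. Th j)"
    unfolding sum_distrib_left by (intro sum_mono) simp
  have aux: "4 * (co + ci - 2) \<le> 2 * T + 4 * q + 4 * \<delta> + 4 * ((wo - co) - (wi - ci))"
    if "2 * h \<le> T" "(z - h) + mm + x \<le> \<delta> + 2 + q" "wi + (2 * co - wo) = z + mm + x"
    for h T z x q wi wo co ci :: int
    using that by presburger
  have two_weights: "(\<Sum>e\<in>out v. 2 - w e) = 2 * int (card (out v)) - (\<Sum>e\<in>out v. w e)"
    by (simp add: sum_subtractf)
  have weights: "(\<Sum>e\<in>S. w e - 1) = (\<Sum>e\<in>S. w e) - int (card S)" for S
    by (simp add: sum_subtractf)
  have fin_ineq: "4 * (int (card (out v)) + int (card (inn v)) - 2)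
     \<le> 2 * (\<Sum>j\<in>-{i}. Th j) + 4 * (\<delta> * (mp + mm)) + 4 * \<delta> + 4 * ((\<Sum>e\<in>out v. w e - 1) - (\<Sum>e\<in>inn v. w e - 1))"
    unfolding weights by (rule aux[OF half main[unfolded sum_subtractf] Zsum[unfolded two_weights]])
  have W: "real_of_int (\<Sum>e\<in>cross t. w e - 1) - of_int (\<Sum>e\<in>cross s. w e - 1)
      = of_int ((\<Sum>e\<in>out v. w e - 1) - (\<Sum>e\<in>inn v. w e - 1))"
    using sum_cross_jump[OF jump, of "\<lambda>e. w e - 1"] by (metis of_int_diff)
  define Q1 Q2 where "Q1 = 2 * (\<Sum>j\<in>-{i}. Th j) + 4 * (\<delta> * (mp + mm))"
    and "Q2 = (\<Sum>e\<in>out v. w e - 1) - (\<Sum>e\<in>inn v. w e - 1)"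
  have "real_of_int (4 * (int (card (out v)) + int (card (inn v)) - 2)) \<le> real_of_int (Q1 + 4 * \<delta> + 4 * Q2)"
    using fin_ineq unfolding Q1_def Q2_def of_int_le_iff .
  hence "4 * (real (card (out v)) + real (card (inn v)) - 2) \<le> of_int Q1 + 4 * of_int \<delta> + 4 * of_int Q2"
    by simp
  moreover have "c \<le> (pt + 4 * (ds + x) + 4 * yt) - (ps + 4 * ds + 4 * ys)"
    if "c \<le> q1 + 4 * x + 4 * q2" "q1 \<le> pt - ps" "yt - ys = q2" for c q1 x q2 pt ps ds yt ys :: real
    using that by argo
  ultimately show ?thesis
    unfolding potential_def dg of_int_add
    using pair[folded Q1_def] W[folded Q2_def] by blast
qed

end

lemma sum_UNIV_split:
  fixes h :: "4 \<Rightarrow> 'b :: comm_monoid_add"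
  shows "(\<Sum>b\<in>UNIV. h b) = h a + (\<Sum>b\<in>-{a}. h b)"
  by (simp add: sum.remove[of UNIV a] Compl_eq_Diff_UNIV)

section \<open>The apex of the plane, and summation over all levels\<close>

context leveled_curve
begin

lemma lev_nonneg: "v \<in> V \<Longrightarrow> lev v \<ge> 0"
  unfolding lev_def using Y_nonneg lam_pos by (intro sum_nonneg mult_nonneg_nonneg) (auto simp: less_imp_le)

text \<open>Both sides count each edge twice: a two-element face occurs as two ordered pairs, a
  one-element face once on the doubled diagonal.\<close>

lemma sum_faces:
  fixes g :: "'e \<Rightarrow> int"
  assumes "S \<subseteq> L"
  shows "2 * (\<Sum>e\<in>S. g e) = (\<Sum>a\<in>UNIV. \<Sum>b\<in>-{a}. \<Sum>e\<in>on a b S. g e) + 2 * (\<Sum>a\<in>UNIV. \<Sum>e\<in>on a a S. g e)"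
proof -
  have finS: "finite S" using assms finL finite_subset by blast
  have F: "F e \<noteq> {} \<and> card (F e) \<le> 2" if e: "e \<in> L" for e
  proof -
    have "F e \<noteq> {}"
    proof
      assume "F e = {}"
      hence "sl e = 0" by (auto simp: F_def sl_def)
      thus False using sl_pos[OF e] by simp
    qed
    moreover obtain i j where "F e \<subseteq> {i, j}" using face[OF e] by blast
    hence "card (F e) \<le> card {i, j}" by (intro card_mono) auto
    hence "card (F e) \<le> 2" by (cases "i = j") auto
    ultimately show ?thesis by blast
  qed
  have 1: "(\<Sum>a\<in>UNIV. \<Sum>b\<in>UNIV. \<Sum>e\<in>on a b S. g e) = (\<Sum>e\<in>S. int (card (F e)) * g e)"
  proof -
    have "(\<Sum>b\<in>UNIV. \<Sum>e\<in>on a b S. g e) = (\<Sum>e\<in>S. if a \<in> F e then g e else 0)" for a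
    proof -
      have "(\<Sum>e\<in>S. if a \<in> F e then g e else 0) = (\<Sum>b\<in>UNIV. \<Sum>e\<in>on a b S. if a \<in> F e then g e else 0)"
        by (rule sum_on[OF assms]) simp
      also have "\<dots> = (\<Sum>b\<in>UNIV. \<Sum>e\<in>on a b S. g e)" by (intro sum.cong refl) (auto simp: on_def)
      finally show ?thesis by simp
    qed
    hence "(\<Sum>a\<in>UNIV. \<Sum>b\<in>UNIV. \<Sum>e\<in>on a b S. g e) = (\<Sum>e\<in>S. \<Sum>a\<in>UNIV. if a \<in> F e then g e else 0)"
      by (simp only: sum.swap[of _ S])
    also have "\<dots> = (\<Sum>e\<in>S. int (card (F e)) * g e)"
      by (simp add: sum.inter_restrict[symmetric])
    finally show ?thesis .
  qed
  have 2: "(\<Sum>a\<in>UNIV. \<Sum>e\<in>on a a S. g e) = (\<Sum>e\<in>S. if card (F e) = 1 then g e else 0)"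
  proof -
    have "(\<Sum>a\<in>UNIV. \<Sum>e\<in>on a a S. g e) = (\<Sum>e\<in>(\<Union>a\<in>UNIV. on a a S). g e)"
      using finS by (intro sum.UNION_disjoint[symmetric]) (auto simp: on_def)
    also have "(\<Union>a\<in>UNIV. on a a S) = {e\<in>S. card (F e) = 1}" by (auto simp: on_def card_1_singleton_iff)
    finally show ?thesis using finS by (simp add: sum.inter_filter)
  qed
  have "(\<Sum>a\<in>UNIV. \<Sum>b\<in>UNIV. \<Sum>e\<in>on a b S. g e)
      = (\<Sum>a\<in>UNIV. (\<Sum>b\<in>-{a}. \<Sum>e\<in>on a b S. g e) + (\<Sum>e\<in>on a a S. g e))"
    by (intro sum.cong refl) (metis sum_UNIV_split add.commute)
  hence 3: "(\<Sum>a\<in>UNIV. \<Sum>b\<in>-{a}. \<Sum>e\<in>on a b S. g e)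
      = (\<Sum>e\<in>S. int (card (F e)) * g e) - (\<Sum>e\<in>S. if card (F e) = 1 then g e else 0)"
    unfolding 1 sum.distrib 2 by simp
  have "2 * g e = int (card (F e)) * g e + (if card (F e) = 1 then g e else 0)" if "e \<in> S" for e
  proof -
    have "card (F e) = 1 \<or> card (F e) = 2"
      using F[of e] that assms by (auto simp: le_Suc_eq numeral_2_eq_2)
    thus ?thesis by auto
  qed
  hence "2 * (\<Sum>e\<in>S. g e) = (\<Sum>e\<in>S. int (card (F e)) * g e + (if card (F e) = 1 then g e else 0))"
    unfolding sum_distrib_left by (intro sum.cong refl)
  thus ?thesis unfolding 3 2 by (simp add: sum.distrib)
qed

text \<open>At the vertex of the plane the local self-intersection can be negative; this is where
  the bound exceeds the one for curves in a classical plane.\<close>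

lemma potential_jump_origin:
  assumes jump: "v \<in> V" "s < lev v" "lev v < t"
    "\<And>u. u \<in> V \<Longrightarrow> u \<noteq> v \<Longrightarrow> lev u < s \<or> t < lev u"
    and Y0: "\<And>k. Y v k = 0"
  shows "4 * (real (card (out v)) + real (card (inn v)) - 2)
      - 4 * (if mom v \<ge> 1 then (of_int (mom v) - 1) * (of_int (mom v) - 2) else 0)
    \<le> potential t - potential s"
proof -
  define D where "D = mom v"
  define N where "N a b = (\<Sum>e\<in>on a b (out v). m e a)" for a b
  \<comment> \<open>The apex is the lowest point of the plane. Nothing crosses a level below it, so
    the potential before the jump is 0 and all edges at \<open>v\<close> are outgoing.\<close>
  have lev0: "lev v = 0" using Y0 by (simp add: lev_def)
  have cross0: "cross s = {}" "cross (lev v) = {}"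
    using lev_nonneg lo_V jump lev0 by (force simp: cross_def)+
  have inn0: "inn v = {}"
    using lev_less lev_nonneg lo_V lev0 by (force simp: inn_def)
  have crosst: "cross t = out v" using cross_jump(2)[OF jump] cross0 by simp
  have ps: "potential s = 0"
    by (simp add: potential_def pairing_def face_term_def area_def flux_def deg_def cross0 on_def)
  have mge: "m e k \<ge> 0" if "e \<in> out v" for e k using out_pos(1)[OF that Y0] .
  have subL: "out v \<subseteq> L" by (auto simp: out_def)
  have Nnn: "N a b \<ge> 0" for a b unfolding N_def by (intro sum_nonneg mge) (auto simp: on_def)
  have row: "(\<Sum>b\<in>UNIV. N a b) = D" for a
  proof -
    have "(\<Sum>e\<in>out v. m e a) = (\<Sum>b\<in>UNIV. N a b)" unfolding N_def
      by (intro sum_on[OF subL]) (auto simp: F_def)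
    thus ?thesis using mom_eq[OF jump(1), of a] inn0 by (simp add: D_def)
  qed
  have degt: "deg t = D" unfolding deg_def crosst D_def mom_def inn0 by simp
  have D0: "D \<ge> 0" using row[of 1] Nnn by (metis sum_nonneg)
  show ?thesis
  proof (cases "D = 0")
    case True
    have "out v = {}"
    proof (rule ccontr)
      assume ne: "out v \<noteq> {}"
      then obtain e where e: "e \<in> out v" by blast
      have "m e a = 0" for a
      proof -
        have "(\<Sum>e\<in>out v. m e a) = 0" using mom_eq[OF jump(1), of a] inn0 True by (simp add: D_def)
        thus ?thesis using mge e by (subst (asm) sum_nonneg_eq_0_iff) auto
      qed
      thus False using sl_pos[of e] e by (auto simp: sl_def out_def)
    qed
    hence "potential t = 0"
      by (simp add: potential_def pairing_def face_term_def area_def flux_def deg_def crosst on_def)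
    thus ?thesis using \<open>out v = {}\<close> inn0 ps True by (simp add: D_def)
  next
    case False
    hence D1: "D \<ge> 1" using D0 by simp
    define K where "K a b = (\<Sum>e\<in>on a b (out v). 2 - w e)" for a b
    have face: "2 * N a b * N b a - dets a b (out v) + 2 * K a b \<le> cap D (N a b) + cap D (N b a)"
      if ab: "a \<noteq> b" for a b
    proof (cases "on a b (out v) = {}")
      case True
      thus ?thesis by (simp add: N_def K_def dets_def cap_def on_commute[of b a])
    next
      case False
      have "2 * (K a b - 2 + gcd (N a b) (\<Sum>e\<in>on a b (out v). m e b)) \<le> dets a b (out v)"
        unfolding K_def N_def by (rule dets_bounds(2)[OF ab subL False]) (auto simp: out_def)
      moreover have "(\<Sum>e\<in>on a b (out v). m e b) = N b a" by (simp add: N_def on_commute[of b a])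
      moreover have "2 * (N a b * N b a + 2 - gcd (N a b) (N b a)) \<le> cap D (N a b) + cap D (N b a)"
      proof (rule mult_gcd_le_cap)
        have p: "1 \<le> N c d" if "{c, d} = {a, b}" for c d
        proof -
          have "on c d (out v) = on a b (out v)" using that by (auto simp: on_def)
          hence "0 < N c d" unfolding N_def using False that
            by (intro sum_pos) (auto simp: on_def intro!: out_pos(2)[OF _ Y0])
          thus ?thesis by simp
        qed
        show "1 \<le> N a b" "1 \<le> N b a" by (intro p; auto)+
        have "N c d \<le> D" for c d unfolding row[of c, symmetric] by (rule member_le_sum) (auto simp: Nnn)
        thus "N a b \<le> D" "N b a \<le> D" by auto
      qed
      ultimately show ?thesis by (simp add: algebra_simps)
    qed
    have diag: "2 * K a a \<le> cap D (N a a)" for a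
    proof -
      have NaD: "N a a \<le> D" unfolding row[of a, symmetric] by (rule member_le_sum) (auto simp: Nnn)
      have "K a a = (if N a a > 0 then 2 - N a a else 0)"
        unfolding K_def N_def sum_on_diag_out by (simp add: Let_def)
      moreover have "2 * (2 - x) \<le> cap D x" if "1 \<le> x" "x \<le> D" for x
      proof -
        have "x + x \<le> x * x + 1" using that by (intro add_le_mult_of_pos) auto
        thus ?thesis using that by (cases "x < D") (auto simp: cap_def power2_eq_square)
      qed
      moreover have "cap D 0 = 0" by (simp add: cap_def)
      ultimately show ?thesis using NaD Nnn[of a a] by (cases "N a a = 0") auto
    qed
    have "2 * (\<Sum>e\<in>out v. 2 - w e) = (\<Sum>a\<in>UNIV. \<Sum>b\<in>-{a}. K a b) + 2 * (\<Sum>a\<in>UNIV. K a a)"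
      unfolding K_def by (rule sum_faces[OF subL])
    moreover have "(\<Sum>a\<in>UNIV. \<Sum>b\<in>-{a}. 2 * N a b * N b a - dets a b (out v) + 2 * K a b)
        \<le> (\<Sum>a\<in>UNIV. \<Sum>b\<in>-{a}. cap D (N a b) + cap D (N b a))"
      using face by (intro sum_mono) auto
    moreover have "(\<Sum>a\<in>UNIV. 2 * K a a) \<le> (\<Sum>a\<in>UNIV. cap D (N a a))" using diag by (intro sum_mono) auto
    \<comment> \<open>Each of the sixteen fluxes is counted twice, and each of the four rows has sum
      \<open>D\<close>.\<close>
    moreover have "(\<Sum>a\<in>UNIV. \<Sum>b\<in>-{a}. cap D (N a b) + cap D (N b a)) + 2 * (\<Sum>a\<in>UNIV. cap D (N a a))
        \<le> 8 * (D^2 - D + 2)"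
    proof -
      have split: "(\<Sum>a\<in>UNIV. \<Sum>b\<in>-{a}. g a b) = (\<Sum>a\<in>UNIV. \<Sum>b\<in>UNIV. g a b) - (\<Sum>a\<in>UNIV. g a a)"
        for g :: "4 \<Rightarrow> 4 \<Rightarrow> int"
        using sum_UNIV_split[of "g a" a for a] by (simp add: sum_subtractf[symmetric])
      have "(\<Sum>a\<in>UNIV. \<Sum>b\<in>UNIV. cap D (N b a)) = (\<Sum>a\<in>UNIV. \<Sum>b\<in>UNIV. cap D (N a b))" by (rule sum.swap)
      moreover have "(\<Sum>a\<in>UNIV. \<Sum>b\<in>UNIV. cap D (N a b)) \<le> (\<Sum>a\<in>(UNIV :: 4 set). D^2 - D + 2)"
        using Nnn row D1 by (intro sum_mono sum_cap_le) auto
      ultimately show ?thesis unfolding split sum.distrib by simp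
    qed
    ultimately have key: "(\<Sum>a\<in>UNIV. \<Sum>b\<in>-{a}. 2 * (N a b * N b a) - dets a b (out v)) + 4 * (\<Sum>e\<in>out v. 2 - w e)
        \<le> 8 * (D^2 - D + 2)"
      by (simp add: sum.distrib sum_distrib_left[symmetric] mult.assoc)
    have ft: "of_int (dets a b (out v) - 2 * (N a b * N b a)) \<le> face_term a b t" if "a \<noteq> b" for a b
    proof -
      have "real_of_int (dets a b (out v)) \<le> area a b t"
        using area_jump[OF jump that] by (simp add: cross0 inn0 on_def dets_def area_def)
      thus ?thesis
        using flux_jump(2)[OF jump, of a b] flux_jump(2)[OF jump, of b a]
        by (simp add: face_term_def N_def cross0 on_def)
    qed
    define M W c where "M = (\<Sum>a\<in>UNIV. \<Sum>b\<in>-{a}. 2 * (N a b * N b a) - dets a b (out v))"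
      and "W = (\<Sum>e\<in>out v. w e)" and "c = int (card (out v))"
    have "(\<Sum>a\<in>UNIV. \<Sum>b\<in>-{a}. of_int (dets a b (out v) - 2 * (N a b * N b a))) \<le> (\<Sum>a\<in>UNIV. \<Sum>b\<in>-{a}. face_term a b t)"
      using ft by (intro sum_mono) auto
    moreover have "(\<Sum>a\<in>UNIV. \<Sum>b\<in>-{a}. real_of_int (dets a b (out v) - 2 * (N a b * N b a))) = of_int (- M)"
      unfolding of_int_sum[symmetric] M_def by (simp add: sum_negf[symmetric] del: of_int_sum)
    ultimately have "of_int (- M) \<le> (\<Sum>a\<in>UNIV. \<Sum>b\<in>-{a}. face_term a b t)" by argo
    hence pair: "of_int (- M + 4 * D^2) \<le> pairing t" by (simp add: pairing_def degt)
    have "(\<Sum>e\<in>out v. 2 - w e) = 2 * c - W" by (simp add: sum_subtractf c_def W_def)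
    hence "M + 4 * (2 * c - W) \<le> 8 * (D^2 - D + 2)" using key unfolding M_def by simp
    \<comment> \<open>The constant of \<open>cap\<close> becomes the apex correction:
      \<open>4 D^2 + 4 D - 8 (D^2 - D + 2)\<close> equals
      \<open>- 4 (D - 1) (D - 2) - 8\<close>.\<close>
    hence "4 * (c - 2) - 4 * ((D - 1) * (D - 2)) \<le> (- M + 4 * D^2) + 4 * D + 4 * (W - c)"
      by (simp add: power2_eq_square algebra_simps)
    hence "real_of_int (4 * (c - 2) - 4 * ((D - 1) * (D - 2))) \<le> of_int ((- M + 4 * D^2) + 4 * D + 4 * (W - c))"
      unfolding of_int_le_iff .
    also have "\<dots> = of_int (- M + 4 * D^2) + 4 * of_int D + 4 * of_int (W - c)" by simp
    also have "\<dots> \<le> potential t"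
    proof -
      have "(\<Sum>e\<in>out v. w e - 1) = W - c" by (simp add: sum_subtractf W_def c_def)
      thus ?thesis using pair by (simp add: potential_def degt crosst del: of_int_sum)
    qed
    finally show ?thesis unfolding ps inn0 D_def[symmetric] c_def using D1 by simp
  qed
qed

text \<open>Above all vertices only the rays cross, and no face term is positive there, so the
  potential is at most \<open>4 d^2 + 4 d\<close>. Levels are injective, so at most one vertex is
  the apex, and its momentum is at most \<open>d\<close> because all momenta are nonnegative and sum
  to \<open>d\<close>. Adding \<open>(d - 1) (d - 2)\<close> to \<open>d^2 + d\<close> gives the
  bound on the sum of \<open>val v - 2\<close>.\<close>

lemma edge_count_bound:
  fixes d :: int
  assumes rays: "int (card {e\<in>L. hi e = None}) = 4 * d" and d: "d \<ge> 1"
  shows "2 * int (card {e\<in>L. hi e \<noteq> None}) + 4 * d - 2 * int (card V) \<le> 2 * d^2 - 2 * d + 2"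
proof -
  define R where "R = {e\<in>L. hi e = None}"
  define T where "T = Max (insert 0 (lev ` V)) + 1"
  have below: "lev v < T" if "v \<in> V" for v
  proof -
    have "lev v \<le> Max (insert 0 (lev ` V))" using finV that by (intro Max_ge) auto
    thus ?thesis by (simp add: T_def)
  qed
  hence TV: "T \<notin> lev ` V" "{v\<in>V. lev v < T} = V" by force+
  have not_Some: "\<not> T < lev q" if "e \<in> L" "hi e = Some q" for e q
    using below[OF hi_V[OF that]] by simp
  have crossT: "cross T = R"
  proof (intro set_eqI iffI)
    fix e assume "e \<in> cross T"
    thus "e \<in> R" using not_Some[of e] by (cases "hi e") (auto simp: cross_def R_def)
  next
    fix e assume "e \<in> R"
    thus "e \<in> cross T" using below[OF lo_V[of e]] by (simp add: cross_def R_def)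
  qed
  have mR: "\<exists>k. \<forall>i. m e i = (if i = k then 1 else 0)" if "e \<in> R" for e
    using ray[of e] that by (auto simp: R_def)
  have mR_nonneg: "m e i \<ge> 0" if "e \<in> R" for e i using mR[OF that] by (metis zero_le_one order_refl)
  have "4 * deg T = (\<Sum>i\<in>(UNIV :: 4 set). deg T)" by simp
  also have "\<dots> = (\<Sum>i\<in>UNIV. \<Sum>e\<in>R. m e i)"
    using deg_eq[OF TV(1)] by (simp add: crossT)
  also have "\<dots> = (\<Sum>e\<in>R. \<Sum>i\<in>UNIV. m e i)" by (rule sum.swap)
  also have "\<dots> = (\<Sum>e\<in>R. 1)"
  proof (intro sum.cong refl)
    fix e assume "e \<in> R"
    then obtain k where "\<forall>i. m e i = (if i = k then 1 else 0)" using mR by blast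
    thus "(\<Sum>i\<in>UNIV. m e i) = 1" by simp
  qed
  finally have degT: "deg T = d" using rays by (simp add: R_def)
  have wR: "w e = 1" if e: "e \<in> R" for e
  proof -
    have eL: "e \<in> L" using e by (simp add: R_def)
    obtain k where k: "\<forall>i. m e i = (if i = k then 1 else 0)" using mR[OF e] by blast
    obtain i j where ij: "F e \<subseteq> {i, j}" using face[OF eL] by blast
    have "k \<in> F e" using k by (simp add: F_def)
    hence "k = i \<or> k = j" using ij by blast
    thus ?thesis using weight[OF eL ij] k by auto
  qed
  have ft: "face_term a b T \<le> 0" if "a \<noteq> b" for a b
  proof -
    \<comment> \<open>For nonnegative components a determinant is bounded by the permanent, and the
      permanents sum to twice the product of the fluxes.\<close>
    have "area a b T \<le> (\<Sum>e\<in>on a b R. \<Sum>f\<in>on a b R. of_int (m e a * m f b + m e b * m f a))"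
      unfolding area_def crossT
    proof (intro sum_mono)
      fix e f assume ef: "e \<in> on a b R" "f \<in> on a b R"
      have "sdet a b T e f \<le> \<bar>of_int (det2 a b e f)\<bar>"
        unfolding sdet_def by (auto simp: sgn_if)
      also have "\<dots> = of_int \<bar>det2 a b e f\<bar>" by simp
      also have "\<bar>det2 a b e f\<bar> \<le> m e a * m f b + m e b * m f a"
        using mR_nonneg on_sub[OF ef(1)] on_sub[OF ef(2)] unfolding det2_def
        by (intro order_trans[OF abs_triangle_ineq4]) (simp add: abs_mult)
      finally show "sdet a b T e f \<le> of_int (m e a * m f b + m e b * m f a)" by simp
    qed
    also have "\<dots> = of_int (\<Sum>e\<in>on a b R. \<Sum>f\<in>on a b R. m e a * m f b + m e b * m f a)" by simp
    also have "(\<Sum>e\<in>on a b R. \<Sum>f\<in>on a b R. m e a * m f b + m e b * m f a) = 2 * (flux a b T * flux b a T)"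
      by (simp add: flux_def crossT on_commute[of b a] sum.distrib sum_product[symmetric])
    finally show ?thesis by (simp add: face_term_def)
  qed
  have "(\<Sum>a\<in>UNIV. \<Sum>b\<in>-{a}. face_term a b T) \<le> 0" using ft by (intro sum_nonpos) auto
  hence potT: "potential T \<le> 4 * (of_int d)^2 + 4 * of_int d"
    by (simp add: potential_def pairing_def crossT degT wR)
  define corr where "corr v = (if (\<forall>k. Y v k = 0) \<and> mom v \<ge> 1 then (mom v - 1) * (mom v - 2) else 0)" for v
  define val where "val v = int (card (out v)) + int (card (inn v))" for v
  have "(\<Sum>v\<in>{v\<in>V. lev v < T}. real_of_int (4 * (val v - 2) - 4 * corr v)) \<le> potential T"
  proof (rule telescope_le[OF finV lev_inj _ _ TV(1)])
    fix t assume "\<forall>v\<in>V. t < lev v"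
    hence "cross t = {}" using lo_V by (force simp: cross_def)
    thus "potential t = 0"
      by (simp add: potential_def pairing_def face_term_def area_def flux_def deg_def on_def)
  next
    fix v s t
    assume jump: "v \<in> V" "s < lev v" "lev v < t" "\<And>u. u \<in> V \<Longrightarrow> u \<noteq> v \<Longrightarrow> lev u < s \<or> t < lev u"
    consider "\<forall>k. Y v k = 0" | i where "Y v i \<noteq> 0" "\<forall>k. k \<noteq> i \<longrightarrow> Y v k = 0"
      | i j where "i \<noteq> j" "Y v i \<noteq> 0" "Y v j \<noteq> 0" by blast
    thus "real_of_int (4 * (val v - 2) - 4 * corr v) \<le> potential t - potential s"
    proof cases
      case 1
      thus ?thesis using potential_jump_origin[OF jump] by (auto simp: val_def corr_def split: if_splits)
    next
      case 2
      hence "corr v = 0" by (auto simp: corr_def)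
      thus ?thesis using potential_jump_edge[OF jump 2(1)] 2(2) by (simp add: val_def)
    next
      case 3
      hence "corr v = 0" by (auto simp: corr_def)
      thus ?thesis using potential_jump_face[OF jump 3] by (simp add: val_def)
    qed
  qed
  also note potT
  also have "4 * (of_int d)^2 + 4 * of_int d = real_of_int (4 * d^2 + 4 * d)" by simp
  finally have "real_of_int (\<Sum>v\<in>V. 4 * (val v - 2) - 4 * corr v) \<le> real_of_int (4 * d^2 + 4 * d)"
    unfolding TV(2) of_int_sum .
  hence main: "(\<Sum>v\<in>V. 4 * (val v - 2) - 4 * corr v) \<le> 4 * d^2 + 4 * d" unfolding of_int_le_iff .
  have corr: "(\<Sum>v\<in>V. corr v) \<le> (d - 1) * (d - 2)"
  proof (cases "\<exists>v\<in>V. corr v \<noteq> 0")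
    case False
    hence "(\<Sum>v\<in>V. corr v) = 0" by (intro sum.neutral) auto
    moreover have "0 \<le> (d - 1) * (d - 2)" using d by (cases "d = 1") auto
    ultimately show ?thesis by simp
  next
    case True
    then obtain v where v: "v \<in> V" "corr v \<noteq> 0" by blast
    hence v0: "\<forall>k. Y v k = 0" "mom v \<ge> 1" by (auto simp: corr_def split: if_splits)
    have "corr u = 0" if u: "u \<in> V - {v}" for u
    proof (rule ccontr)
      assume "corr u \<noteq> 0"
      hence "\<forall>k. Y u k = 0" by (auto simp: corr_def split: if_splits)
      hence "lev u = lev v" using v0 by (simp add: lev_def)
      thus False using lev_inj u v by (auto simp: inj_on_def)
    qed
    hence "(\<Sum>v\<in>V. corr v) = corr v" using v(1) finV by (simp add: sum.remove)
    also have "\<dots> = (mom v - 1) * (mom v - 2)" using v0 by (simp add: corr_def)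
    also have "\<dots> \<le> (d - 1) * (d - 2)"
    proof -
      have "mom v \<le> (\<Sum>v\<in>V. mom v)" using v(1) finV mom_nonneg by (intro member_le_sum) auto
      also have "\<dots> = d" using deg_eq_sum[OF TV(1)] TV(2) degT by simp
      finally have le: "mom v \<le> d" .
      \<comment> \<open>This product is the difference of the two sides; its second factor is
        negative only for \<open>d = mom v = 1\<close>, where the first one vanishes.\<close>
      have "0 \<le> (d - mom v) * (d + mom v - 3)"
      proof (cases "d + mom v \<ge> 3")
        case True
        thus ?thesis using le by simp
      next
        case False
        hence "d = mom v" using le v0 by linarith
        thus ?thesis by simp
      qed
      thus ?thesis by (simp add: algebra_simps)
    qed
    finally show ?thesis .
  qed
  have vals: "(\<Sum>v\<in>V. val v) = int (card L) + int (card {e\<in>L. hi e \<noteq> None})"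
  proof -
    have "(\<Sum>v\<in>V. card (out v)) = card (\<Union>v\<in>V. out v)"
      using finV by (intro card_UN_disjoint[symmetric]) (auto simp: out_def finL)
    also have "(\<Union>v\<in>V. out v) = L" using lo_V by (auto simp: out_def)
    finally have o: "(\<Sum>v\<in>V. card (out v)) = card L" .
    have "(\<Sum>v\<in>V. card (inn v)) = card (\<Union>v\<in>V. inn v)"
      using finV by (intro card_UN_disjoint[symmetric]) (auto simp: inn_def finL)
    also have "(\<Union>v\<in>V. inn v) = {e\<in>L. hi e \<noteq> None}" using hi_V by (auto simp: inn_def)
    finally have i: "(\<Sum>v\<in>V. card (inn v)) = card {e\<in>L. hi e \<noteq> None}" .
    show ?thesis unfolding val_def using o i by (simp add: sum.distrib of_nat_sum[symmetric] del: of_nat_sum)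
  qed
  have "card L = card R + card {e\<in>L. hi e \<noteq> None}"
    unfolding R_def using finL by (subst card_Un_disjoint[symmetric]) (auto intro!: arg_cong[where f = card])
  hence cardL: "int (card L) = 4 * d + int (card {e\<in>L. hi e \<noteq> None})" using rays by (simp add: R_def)
  have "(\<Sum>v\<in>V. 4 * (val v - 2) - 4 * corr v) = 4 * (\<Sum>v\<in>V. val v) - 8 * int (card V) - 4 * (\<Sum>v\<in>V. corr v)"
    by (simp add: sum_subtractf sum_distrib_left[symmetric])
  hence "4 * (\<Sum>v\<in>V. val v) - 8 * int (card V) \<le> 4 * d^2 + 4 * d + 4 * ((d - 1) * (d - 2))"
    using main corr by presburger
  hence "(\<Sum>v\<in>V. val v) - 2 * int (card V) \<le> d^2 + d + (d - 1) * (d - 2)" by presburger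
  thus ?thesis unfolding vals cardL by (simp add: power2_eq_square algebra_simps)
qed

end

section \<open>Coordinates on a generic tropical plane\<close>

text \<open>In type \<open>4\<close> the index \<open>4 = 0\<close> plays the role of the homogenizing coordinate \<open>0\<close>.\<close>

definition coord_index :: "4 \<Rightarrow> nat" where
  "coord_index i = (if i = 1 then 1 else if i = 2 then 2 else if i = 3 then 3 else 0)"

definition icoord :: "int^3 \<Rightarrow> 4 \<Rightarrow> int" where
  "icoord u i = (if i = 1 then u $ 1 else if i = 2 then u $ 2 else if i = 3 then u $ 3 else 0)"

definition lform :: "(4 \<Rightarrow> real) \<Rightarrow> real^3 \<Rightarrow> 4 \<Rightarrow> real" where
  "lform a x i = a i + coord x (coord_index i)"

definition gap :: "(4 \<Rightarrow> real) \<Rightarrow> real^3 \<Rightarrow> 4 \<Rightarrow> real" where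
  "gap a x i = Max (range (lform a x)) - lform a x i"

definition gplane :: "(4 \<Rightarrow> real) \<Rightarrow> (real^3) set" where
  "gplane a = {x. \<exists>i j. i \<noteq> j \<and> gap a x i = 0 \<and> gap a x j = 0}"

text \<open>In \<open>int^3\<close> the constant \<open>1\<close> is the all-ones vector. By
  \<open>gap_ray\<close>, on the plane a step along the \<open>k\<close>-th direction raises the
  \<open>k\<close>-th gap and no other.\<close>

definition ray_dir :: "4 \<Rightarrow> int^3" where
  "ray_dir k = (if k = 1 then axis 1 (-1) else if k = 2 then axis 2 (-1) else if k = 3 then axis 3 (-1) else 1)"

lemma coord_index_simps [simp]: "coord_index 1 = 1" "coord_index 2 = 2" "coord_index 3 = 3" "coord_index 4 = 0"
  by (simp_all add: coord_index_def)

lemma coord_simps [simp]: "coord x 0 = 0" "coord x (Suc 0) = x $ 1" "coord x 2 = x $ 2" "coord x 3 = x $ 3"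
  by (simp_all add: coord_def)

lemma coord_linear: "coord (x + c *\<^sub>R y) i = coord x i + c * coord y i" "coord (x - y) i = coord x i - coord y i"
  by (simp_all add: coord_def)

lemma coord_int_vec: "coord (int_vec u) (coord_index i) = of_int (icoord u i)"
  using exhaust_4[of i] by (elim disjE) (simp_all add: icoord_def coord_def int_vec_def)

lemma icoord_simps [simp]: "icoord u 1 = u $ 1" "icoord u 2 = u $ 2" "icoord u 3 = u $ 3" "icoord u 4 = 0"
  by (simp_all add: icoord_def)

lemma icoord_sum: "icoord (\<Sum>x\<in>A. f x) i = (\<Sum>x\<in>A. icoord (f x) i)"
  by (simp add: icoord_def)

lemma icoord_add: "icoord (u + v) i = icoord u i + icoord v i" by (simp add: icoord_def)
lemma icoord_smult: "icoord (c *s u) i = c * icoord u i" by (simp add: icoord_def)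
lemma icoord_minus: "icoord (- u) i = - icoord u i" by (simp add: icoord_def)
lemma icoord_0 [simp]: "icoord 0 i = 0" by (simp add: icoord_def)

lemma icoord_eqI: "(\<And>i. icoord u i = icoord v i) \<Longrightarrow> u = v"
proof -
  assume a: "\<And>i. icoord u i = icoord v i"
  show "u = v" using a[of 1] a[of 2] a[of 3] by (simp add: vec_eq_iff forall_3)
qed

lemma icoord_bv: "icoord (ray_dir k) j = (if k = 4 then 1 else 0) - (if j = k then 1 else 0)"
  using exhaust_4[of k] exhaust_4[of j] by (elim disjE) (simp_all add: ray_dir_def axis_def)

lemma ray_dir_inj: "ray_dir k = ray_dir l \<Longrightarrow> k = l"
proof -
  assume "ray_dir k = ray_dir l"
  hence "icoord (ray_dir k) 1 - icoord (ray_dir k) k = icoord (ray_dir l) 1 - icoord (ray_dir l) k"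
    "icoord (ray_dir k) 2 - icoord (ray_dir k) k = icoord (ray_dir l) 2 - icoord (ray_dir l) k" by simp_all
  thus "k = l" unfolding icoord_bv by (auto split: if_splits)
qed

lemma gap_nonneg: "gap a x i \<ge> 0"
  by (simp add: gap_def)

lemma gap_zero_iff: "gap a x k = 0 \<longleftrightarrow> (\<forall>i. lform a x i \<le> lform a x k)"
proof
  assume "gap a x k = 0"
  hence "lform a x k = Max (range (lform a x))" by (simp add: gap_def)
  thus "\<forall>i. lform a x i \<le> lform a x k" by simp
next
  assume "\<forall>i. lform a x i \<le> lform a x k"
  hence "Max (range (lform a x)) = lform a x k" by (intro Max_eqI) auto
  thus "gap a x k = 0" by (simp add: gap_def)
qed

lemma gap_eq: "gap a x k = 0 \<Longrightarrow> gap a x i = lform a x k - lform a x i"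
  by (simp add: gap_def)

lemma lform_diff: "lform a x k - lform a x i - (lform a y k - lform a y i) =
    coord (x - y) (coord_index k) - coord (x - y) (coord_index i)"
  by (simp add: lform_def coord_linear)

lemma lform_affine: "lform a (x + c *\<^sub>R y) i = lform a x i + c * coord y (coord_index i)"
  by (simp add: lform_def coord_linear)

lemma gap_inj: "gap a x = gap a y \<Longrightarrow> x = y"
proof -
  assume e: "gap a x = gap a y"
  have "gap a x 4 - gap a x i = gap a y 4 - gap a y i" for i using e by simp
  hence "coord x (coord_index i) = coord y (coord_index i)" for i
    unfolding gap_def lform_def by (simp add: algebra_simps)
  from this[of 1] this[of 2] this[of 3] show "x = y" by (simp add: vec_eq_iff forall_3)
qed

text \<open>On the plane some maximal form has an index \<open>l\<close> other than
  \<open>k\<close>. It stays maximal after the step, so gaps may be measured from it at both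
  points.\<close>

lemma gap_ray:
  assumes "p \<in> gplane a"
  shows "gap a (p + int_vec (ray_dir k)) i = gap a p i + (if i = k then 1 else 0)"
proof -
  let ?x = "p + int_vec (ray_dir k)"
  obtain l where l: "l \<noteq> k" "gap a p l = 0" using assms by (auto simp: gplane_def) metis
  have lform: "lform a ?x j = lform a p j + ((if k = 4 then 1 else 0) - (if j = k then 1 else 0))" for j
    using lform_affine[of a p 1 "int_vec (ray_dir k)" j] by (simp add: coord_int_vec icoord_bv)
  have le: "lform a p i \<le> lform a p l" for i using l(2) by (simp add: gap_zero_iff)
  have "gap a ?x l = 0" unfolding gap_zero_iff lform
  proof
    fix i show "lform a p i + ((if k = 4 then 1 else 0) - (if i = k then 1 else 0))
        \<le> lform a p l + ((if k = 4 then 1 else 0) - (if l = k then 1 else 0))"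
      using le[of i] l(1) by (cases "i = k") simp_all
  qed
  thus ?thesis using gap_eq[of a ?x l i] gap_eq[OF l(2), of i] l(1) by (simp add: lform)
qed

text \<open>There are only finitely many pairs of indices, so two parameters share a maximal pair,
  and affine forms that agree twice agree everywhere. The pair could lose maximality further along
  the segment only by an exchange with the complementary pair, which takes place at the
  apex.\<close>

lemma common_max_on_segment:
  assumes sub: "closed_segment p q \<subseteq> gplane a"
    and apex: "\<And>x. x \<in> open_segment p q \<Longrightarrow> \<exists>i. gap a x i \<noteq> 0" and "p \<noteq> q"
  shows "\<exists>k l. k \<noteq> l \<and> gap a p k = 0 \<and> gap a q k = 0 \<and> gap a p l = 0 \<and> gap a q l = 0"
proof -
  define f where "f i t = lform a p i + t * coord (q - p) (coord_index i)" for i and t :: real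
  have f: "lform a (p + t *\<^sub>R (q - p)) i = f i t" for i t by (simp add: f_def lform_affine)
  have seg: "p + t *\<^sub>R (q - p) \<in> closed_segment p q" if "0 \<le> t" "t \<le> 1" for t
    using that unfolding closed_segment_def by (auto simp: algebra_simps intro!: exI[of _ t])
  have oseg: "p + t *\<^sub>R (q - p) \<in> open_segment p q" if "0 < t" "t < 1" for t
    using that \<open>p \<noteq> q\<close> unfolding in_segment by (auto simp: algebra_simps intro!: exI[of _ t])
  define M where "M t k \<longleftrightarrow> (\<forall>i. f i t \<le> f k t)" for t k
  have Mg: "gap a (p + t *\<^sub>R (q - p)) k = 0 \<longleftrightarrow> M t k" for t k
    unfolding gap_zero_iff f M_def ..
  have two: "\<exists>k l. k \<noteq> l \<and> M t k \<and> M t l" if "0 \<le> t" "t \<le> 1" for t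
    using sub seg[OF that] unfolding Mg[symmetric] gplane_def by blast
  have notall: "\<exists>i. \<not> M t i" if "0 < t" "t < 1" for t
    using apex[OF oseg[OF that]] unfolding Mg[symmetric] by blast
  have affine_eq: "f i r = f j r" if "f i s = f j s" "f i t = f j t" "s \<noteq> t" for i j r s t
  proof -
    have "(s - t) * (coord (q - p) (coord_index i) - coord (q - p) (coord_index j)) = 0"
      using that unfolding f_def by (simp add: algebra_simps)
    hence E: "coord (q - p) (coord_index i) = coord (q - p) (coord_index j)" using that(3) by simp
    have "lform a p i = lform a p j" using that(1) unfolding f_def E by linarith
    thus ?thesis unfolding f_def E by simp
  qed
  have Meq: "f k r = f l r" if "M r k" "M r l" for k l r
    using that by (simp add: M_def antisym)
  have pick: "\<exists>k l s t. k \<noteq> l \<and> lo < s \<and> s < t \<and> t < hi \<and> M s k \<and> M s l \<and> M t k \<and> M t l"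
    if "0 \<le> lo" "lo < hi" "hi \<le> 1" for lo hi
  proof -
    define c where "c t = (SOME kl. fst kl \<noteq> snd kl \<and> M t (fst kl) \<and> M t (snd kl))" for t
    have c: "fst (c t) \<noteq> snd (c t) \<and> M t (fst (c t)) \<and> M t (snd (c t))" if "lo < t" "t < hi" for t
    proof -
      have "0 \<le> t" "t \<le> 1" using that \<open>0 \<le> lo\<close> \<open>hi \<le> 1\<close> by linarith+
      then obtain k l where "k \<noteq> l" "M t k" "M t l" using two by blast
      hence "fst (k, l) \<noteq> snd (k, l) \<and> M t (fst (k, l)) \<and> M t (snd (k, l))" by simp
      thus ?thesis unfolding c_def by (rule someI)
    qed
    have "\<not> inj_on c {lo<..<hi}"
      using finite_imageD[of c "{lo<..<hi}"] infinite_Ioo[OF \<open>lo < hi\<close>] finite[of "c ` {lo<..<hi}"] by blast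
    then obtain s t where st: "s \<in> {lo<..<hi}" "t \<in> {lo<..<hi}" "c s = c t" "s < t"
      unfolding inj_on_def by (metis linorder_neqE_linordered_idom)
    show ?thesis using c[of s] c[of t] st
      by (intro exI[of _ "fst (c s)"] exI[of _ "snd (c s)"] exI[of _ s] exI[of _ t]) auto
  qed
  obtain k l s t where kl: "k \<noteq> l" "0 < s" "s < t" "t < 1" "M s k" "M s l" "M t k" "M t l"
    using pick[of 0 1] by auto
  have klf: "f k r = f l r" for r
    using affine_eq[OF Meq[OF kl(5,6)] Meq[OF kl(7,8)]] kl(3) by simp
  have bad: False if j: "f j r > f k r" and r: "0 \<le> r" "r \<le> 1" for j r
  proof -
    text \<open>At the point where \<open>j\<close> overtakes \<open>k\<close>, beyond which only \<open>j\<close> and the fourth index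
      can be maximal, all four forms agree.\<close>
    have sj: "f j s \<le> f k s" "f j t \<le> f k t" using kl by (auto simp: M_def)
    define g where "g x = f j x - f k x" for x
    define \<alpha> \<beta> where "\<alpha> = lform a p j - lform a p k" and "\<beta> = coord (q - p) (coord_index j) - coord (q - p) (coord_index k)"
    have g: "g x = \<alpha> + x * \<beta>" for x by (simp add: g_def f_def \<alpha>_def \<beta>_def algebra_simps)
    have gr: "g r > 0" and gs: "g s \<le> 0" and gt: "g t \<le> 0" using j sj by (auto simp: g_def)
    have \<beta>0: "\<beta> \<noteq> 0" using gr gs by (auto simp: g)
    define z where "z = - \<alpha> / \<beta>"
    have gz: "g x = (x - z) * \<beta>" for x using \<beta>0 by (simp add: g z_def field_simps)
    have z01: "0 < z" "z < 1"
    proof -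
      have "(r > z \<and> s \<le> z \<and> t \<le> z) \<or> (r < z \<and> s \<ge> z \<and> t \<ge> z)"
        using gr gs gt \<beta>0 unfolding gz by (auto simp: zero_less_mult_iff mult_le_0_iff)
      thus "0 < z" "z < 1" using kl r by auto
    qed
    obtain lo hi where lh: "0 \<le> lo" "lo < hi" "hi \<le> 1" "\<And>x. lo < x \<Longrightarrow> x < hi \<Longrightarrow> g x > 0"
    proof (cases "\<beta> > 0")
      case True
      hence "z < r" using gr unfolding gz by (auto simp: zero_less_mult_iff)
      thus ?thesis using that[of z r] z01 r True by (auto simp: gz)
    next
      case False
      hence "r < z" using gr \<beta>0 unfolding gz by (auto simp: zero_less_mult_iff)
      thus ?thesis using that[of r z] z01 r False \<beta>0 by (auto simp: gz zero_less_mult_iff)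
    qed
    obtain k' l' s' t' where kl': "k' \<noteq> l'" "lo < s'" "s' < t'" "t' < hi" "M s' k'" "M s' l'" "M t' k'" "M t' l'"
      using pick[OF lh(1-3)] by blast
    have "g s' > 0" using lh(4) kl' by auto
    hence "f k s' < f j s'" "f l s' < f j s'" using klf by (auto simp: g_def)
    hence d: "k' \<noteq> k" "k' \<noteq> l" "l' \<noteq> k" "l' \<noteq> l" using kl' by (auto simp: M_def not_le[symmetric])
    have jk: "j \<noteq> k" "j \<noteq> l" using j klf by auto
    have "card {k, l, k', l'} = 4" using kl kl' d by auto
    hence U: "{k, l, k', l'} = UNIV" by (intro card_subset_eq) auto
    have klf': "f k' x = f l' x" for x
      using affine_eq[OF Meq[OF kl'(5,6)] Meq[OF kl'(7,8)]] kl'(3) by simp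
    have "j = k' \<or> j = l'" using U jk by blast
    hence "f k' z = f j z" using klf' by auto
    moreover have "f j z = f k z" using gz[of z] by (simp add: g_def)
    ultimately have E: "f i z = f k z" for i
    proof -
      have "i \<in> {k, l, k', l'}" using U by blast
      thus ?thesis using klf klf' \<open>f k' z = f j z\<close> \<open>f j z = f k z\<close> by auto
    qed
    have "f x z \<le> f i z" for i x using E[of i] E[of x] by simp
    hence "\<forall>i. M z i" by (simp add: M_def)
    thus False using notall[OF z01] by blast
  qed
  have "M r k \<and> M r l" if "0 \<le> r" "r \<le> 1" for r
    using bad[OF _ that] klf by (auto simp: M_def not_le[symmetric])
  from this[of 0] this[of 1] show ?thesis
    using kl(1) Mg[of 0] Mg[of 1] by auto
qed

section \<open>Primitive directions and generic weights\<close>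

lemma primitive_unique:
  assumes "primitive u" "primitive v" and t: "t > 0" "\<And>i. real_of_int (u $ i) = t * of_int (v $ i)"
  shows "u = v"
proof -
  have v0: "\<exists>i. v $ i \<noteq> 0" using assms(2) by (auto simp: primitive_def vec_eq_iff)
  define g where "g = Gcd (range (\<lambda>i. v $ i))"
  have prim_Gcd: "Gcd (range (\<lambda>i. x $ i)) = 1" if "primitive x" for x :: "int^3"
  proof -
    define h where "h = Gcd (range (\<lambda>i. x $ i))"
    have "h \<ge> 0" by (simp add: h_def)
    moreover have "h \<noteq> 0" using that by (auto simp: h_def primitive_def vec_eq_iff Gcd_0_iff)
    moreover have "\<not> h > 1"
      using that unfolding primitive_def by (auto simp: h_def)
    ultimately show ?thesis unfolding h_def by linarith
  qed
  obtain i0 where i0: "v $ i0 \<noteq> 0" using v0 by blast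
  have cross: "u $ i * v $ i0 = v $ i * u $ i0" for i
  proof -
    have "real_of_int (u $ i * v $ i0) = real_of_int (v $ i * u $ i0)" using t by simp
    thus ?thesis by (simp only: of_int_eq_iff)
  qed
  have "Gcd (range (\<lambda>i. u $ i * v $ i0)) = Gcd ((\<lambda>x. v $ i0 * x) ` range (\<lambda>i. u $ i))"
    by (simp add: image_image mult.commute)
  also have "\<dots> = \<bar>v $ i0\<bar>" unfolding Gcd_mult prim_Gcd[OF assms(1)] by simp
  finally have 1: "Gcd (range (\<lambda>i. u $ i * v $ i0)) = \<bar>v $ i0\<bar>" .
  have "Gcd (range (\<lambda>i. v $ i * u $ i0)) = Gcd ((\<lambda>x. u $ i0 * x) ` range (\<lambda>i. v $ i))"
    by (simp add: image_image mult.commute)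
  also have "\<dots> = \<bar>u $ i0\<bar>" unfolding Gcd_mult prim_Gcd[OF assms(2)] by simp
  finally have "\<bar>u $ i0\<bar> = \<bar>v $ i0\<bar>" using 1 cross by simp
  hence "\<bar>real_of_int (u $ i0)\<bar> = \<bar>real_of_int (v $ i0)\<bar>" by (metis of_int_abs)
  hence "t = 1" using t i0 by (simp add: abs_mult)
  hence "u $ i = v $ i" for i using t(2)[of i] by simp
  thus ?thesis by (simp add: vec_eq_iff)
qed

lemma prim_dir_unique:
  assumes "prim_dir p q u" "prim_dir p q v" shows "u = v"
proof -
  obtain c d where c: "c > 0" "q - p = c *\<^sub>R int_vec u" and d: "d > 0" "q - p = d *\<^sub>R int_vec v"
    using assms by (auto simp: prim_dir_def)
  have "real_of_int (u $ i) = (d / c) * of_int (v $ i)" for i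
  proof -
    have "c * of_int (u $ i) = d * of_int (v $ i)"
      using arg_cong[where f = "\<lambda>x. x $ i", OF trans[OF c(2)[symmetric] d(2)]] by (simp add: int_vec_def)
    thus ?thesis using c(1) by (simp add: field_simps)
  qed
  thus ?thesis using primitive_unique[of u v "d / c"] assms c d by (auto simp: prim_dir_def)
qed

lemma primitive_minus: "primitive u \<Longrightarrow> primitive (- u)"
  by (simp add: primitive_def)

lemma int_vec_minus: "int_vec (- u) = - int_vec u"
  by (simp add: int_vec_def vec_eq_iff)

lemma prim_dir_commute: "prim_dir p q u \<Longrightarrow> prim_dir q p (- u)"
  unfolding prim_dir_def
proof (elim conjE exE, intro conjI)
  fix c :: real assume c: "0 < c" "q - p = c *\<^sub>R int_vec u"
  have "p - q = - (q - p)" by simp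
  hence "p - q = c *\<^sub>R int_vec (- u)" unfolding c(2) by (simp add: int_vec_minus)
  thus "\<exists>c>0. p - q = c *\<^sub>R int_vec (- u)" using c by blast
qed (rule primitive_minus)

text \<open>Powers of a single parameter suffice: each pair of vertices excludes only the finitely
  many roots of a nonzero polynomial of degree at most 3.\<close>

lemma exists_generic_weights:
  fixes Y :: "'v \<Rightarrow> 4 \<Rightarrow> real"
  assumes "finite V" "inj_on Y V"
  shows "\<exists>lam. (\<forall>i. lam i > 0) \<and> inj_on (\<lambda>v. \<Sum>i\<in>UNIV. lam i * Y v i) V"
proof -
  define P where "P x = [:x 4, x 1, x 2, x 3:]" for x :: "4 \<Rightarrow> real"
  have P: "poly (P x) s = (\<Sum>i\<in>UNIV. s ^ coord_index i * x i)" for x s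
    by (simp add: P_def sum_4 algebra_simps power2_eq_square power3_eq_cube)
  have P0: "P x \<noteq> 0" if "x \<noteq> (\<lambda>_. 0)" for x
  proof
    assume "P x = 0"
    hence "x 1 = 0" "x 2 = 0" "x 3 = 0" "x 4 = 0" by (simp_all add: P_def)
    hence "x i = 0" for i using exhaust_4[of i] by auto
    thus False using that by auto
  qed
  define B where "B = (\<Union>(u, v)\<in>{(u, v)\<in>V \<times> V. u \<noteq> v}. {s. poly (P (\<lambda>i. Y u i - Y v i)) s = 0})"
  have "finite B" unfolding B_def
  proof (intro finite_UN_I)
    show "finite {(u, v)\<in>V \<times> V. u \<noteq> v}" using assms(1) by (rule_tac finite_subset[of _ "V \<times> V"]) auto
    fix uv assume "uv \<in> {(u, v)\<in>V \<times> V. u \<noteq> v}"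
    then obtain u v where uv: "uv = (u, v)" "u \<in> V" "v \<in> V" "u \<noteq> v" by auto
    hence "Y u \<noteq> Y v" using assms(2) by (auto simp: inj_on_def)
    hence "(\<lambda>i. Y u i - Y v i) \<noteq> (\<lambda>_. 0)" by (auto simp: fun_eq_iff)
    from poly_roots_finite[OF P0[OF this]] show "finite (case uv of (u, v) \<Rightarrow> {s. poly (P (\<lambda>i. Y u i - Y v i)) s = 0})"
      by (simp add: uv)
  qed
  then obtain s where s: "s > 0" "s \<notin> B"
    using infinite_Ioi[of "0::real"] by (metis finite_subset greaterThan_iff subsetI)
  have "inj_on (\<lambda>v. \<Sum>i\<in>UNIV. s ^ coord_index i * Y v i) V"
  proof (rule inj_onI)
    fix u v assume uv: "u \<in> V" "v \<in> V" "(\<Sum>i\<in>UNIV. s ^ coord_index i * Y u i) = (\<Sum>i\<in>UNIV. s ^ coord_index i * Y v i)"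
    hence "poly (P (\<lambda>i. Y u i - Y v i)) s = 0" unfolding P by (simp add: right_diff_distrib sum_subtractf)
    thus "u = v" using s(2) uv by (auto simp: B_def)
  qed
  thus ?thesis using s(1) by (intro exI[of _ "\<lambda>i. s ^ coord_index i"]) auto
qed

text \<open>\<open>G\<close> contains every bounded edge in both orientations.\<close>

locale plane_graph =
  fixes a :: "4 \<Rightarrow> real" and V :: "(real^3) set" and G :: "((real^3) \<times> (real^3)) set"
    and R :: "((real^3) \<times> (int^3)) set" and dir :: "real^3 \<Rightarrow> real^3 \<Rightarrow> int^3"
    and om :: "real^3 \<Rightarrow> real^3 \<Rightarrow> nat"
  assumes finV: "finite V" and finR: "finite R"
    and G_V: "G \<subseteq> V \<times> V" and G_sym: "\<And>p q. (p, q) \<in> G \<Longrightarrow> (q, p) \<in> G" and G_irrefl: "\<And>p. (p, p) \<notin> G"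
    and R_V: "\<And>p u. (p, u) \<in> R \<Longrightarrow> p \<in> V"
    and dir: "\<And>p q. (p, q) \<in> G \<Longrightarrow> prim_dir p q (dir p q)"
    and om_pos: "\<And>p q. (p, q) \<in> G \<Longrightarrow> om p q > 0" and om_sym: "\<And>p q. (p, q) \<in> G \<Longrightarrow> om q p = om p q"
    and R_bv: "\<And>p u. (p, u) \<in> R \<Longrightarrow> \<exists>k. u = ray_dir k"
    and bal: "\<And>v. v \<in> V \<Longrightarrow>
      (\<Sum>q\<in>{q. (v, q) \<in> G}. int (om v q) *s dir v q) + (\<Sum>r\<in>{r\<in>R. fst r = v}. snd r) = 0"
    and inj_dir: "\<And>v q q'. (v, q) \<in> G \<Longrightarrow> (v, q') \<in> G \<Longrightarrow> dir v q = dir v q' \<Longrightarrow> q = q'"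
    and dir_ray: "\<And>v q. (v, q) \<in> G \<Longrightarrow> (v, dir v q) \<notin> R"
    and V_plane: "V \<subseteq> gplane a"
    and seg_plane: "\<And>p q. (p, q) \<in> G \<Longrightarrow> closed_segment p q \<subseteq> gplane a"
    and ray_plane: "\<And>p u. (p, u) \<in> R \<Longrightarrow> p + int_vec u \<in> gplane a"
begin

lemma finG: "finite G"
  using finite_subset[OF G_V] finV by blast

lemma dir_commute: assumes "(p, q) \<in> G" shows "dir q p = - dir p q"
  using prim_dir_unique[OF dir[OF G_sym[OF assms]] prim_dir_commute[OF dir[OF assms]]] .

end

text \<open>Vertices may still lie at the apex; only the relative interiors of bounded edges avoid
  it, so that each such edge stays in one closed face.\<close>

locale apex_free_plane_graph = plane_graph +
  assumes apex: "\<And>p q x. (p, q) \<in> G \<Longrightarrow> x \<in> open_segment p q \<Longrightarrow> \<exists>i. gap a x i \<noteq> 0"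
begin

lemma two_common:
  assumes "(p, q) \<in> G"
  shows "\<exists>k l. k \<noteq> l \<and> gap a p k = 0 \<and> gap a q k = 0 \<and> gap a p l = 0 \<and> gap a q l = 0"
  using common_max_on_segment[OF seg_plane[OF assms] apex[OF assms]] G_irrefl assms by metis

text \<open>The darts that climb, together with the rays, form a \<open>leveled_curve\<close> in the
  gap coordinates. Generic weights exclude horizontal edges, so exactly one of the two darts of each
  edge climbs and \<open>card G\<close> is twice the number of bounded edges.\<close>

lemma dart_count_bound:
  fixes d :: int
  assumes rays: "int (card R) = 4 * d" and d: "d \<ge> 1"
  shows "int (card G) + 4 * d - 2 * int (card V) \<le> 2 * d^2 - 2 * d + 2"
proof -
  have "inj_on (gap a) V" by (rule inj_onI) (rule gap_inj)
  then obtain lam where lam: "\<And>i. lam i > 0" "inj_on (\<lambda>v. \<Sum>i\<in>UNIV. lam i * gap a v i) V"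
    using exists_generic_weights[OF finV] by blast
  define lev where "lev v = (\<Sum>i\<in>UNIV. lam i * gap a v i)" for v
  define L where "L = (\<lambda>(p, q). (p, Inl q)) ` {(p, q) \<in> G. lev p < lev q} \<union> (\<lambda>(p, u). (p, Inr u)) ` R"
  define hi :: "(real^3) \<times> ((real^3) + (int^3)) \<Rightarrow> (real^3) option"
    where "hi e = (case snd e of Inl q \<Rightarrow> Some q | Inr u \<Rightarrow> None)" for e
  define kk where "kk p q = (SOME k. gap a p k = 0 \<and> gap a q k = 0)" for p q
  define du where "du e = (case snd e of Inl q \<Rightarrow> dir (fst e) q | Inr u \<Rightarrow> u)" for e
  define we where "we e = (case snd e of Inl q \<Rightarrow> int (om (fst e) q) | Inr u \<Rightarrow> 1)"
    for e :: "(real^3) \<times> ((real^3) + (int^3))"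
  \<comment> \<open>The speed of the maximal form along \<open>e\<close>; subtracting the speed of
    the \<open>i\<close>-th form leaves the speed of the \<open>i\<close>-th gap.\<close>
  define mu where "mu e = (case snd e of Inl q \<Rightarrow> icoord (dir (fst e) q) (kk (fst e) q)
     | Inr u \<Rightarrow> (if u = ray_dir 4 then 1 else 0))" for e
  define m where "m e i = we e * (mu e - icoord (du e) i)" for e i
  define F where "F e = {i. gap a (fst e) i \<noteq> 0 \<or> m e i \<noteq> 0}" for e
  define sl where "sl e = (\<Sum>i\<in>UNIV. lam i * of_int (m e i))" for e
  have L_cases: thesis
    if "e \<in> L" "\<And>p q. e = (p, Inl q) \<Longrightarrow> (p, q) \<in> G \<Longrightarrow> lev p < lev q \<Longrightarrow> thesis"
      "\<And>p u. e = (p, Inr u) \<Longrightarrow> (p, u) \<in> R \<Longrightarrow> thesis" for e thesis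
    using that by (auto simp: L_def)
  have kk: "gap a p (kk p q) = 0" "gap a q (kk p q) = 0" if pq: "(p, q) \<in> G" for p q
  proof -
    obtain k where "gap a p k = 0 \<and> gap a q k = 0" using two_common[OF pq] by blast
    hence "gap a p (kk p q) = 0 \<and> gap a q (kk p q) = 0" unfolding kk_def by (rule someI)
    thus "gap a p (kk p q) = 0" "gap a q (kk p q) = 0" by auto
  qed
  have bounded: "\<exists>c>0. \<forall>i. gap a q i = gap a p i + c * of_int (m (p, Inl q) i)" if pq: "(p, q) \<in> G" for p q
  proof -
    obtain c where c: "c > 0" "q - p = c *\<^sub>R int_vec (dir p q)" using dir[OF pq] by (auto simp: prim_dir_def)
    have o: "om p q > 0" by (rule om_pos[OF pq])
    have "gap a q i = gap a p i + (c / of_nat (om p q)) * of_int (m (p, Inl q) i)" for i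
    proof -
      have "gap a q i - gap a p i = coord (q - p) (coord_index (kk p q)) - coord (q - p) (coord_index i)"
        unfolding gap_eq[OF kk(1)[OF pq]] gap_eq[OF kk(2)[OF pq]] by (simp add: lform_diff)
      also have "\<dots> = c * of_int (icoord (dir p q) (kk p q) - icoord (dir p q) i)"
        unfolding c(2) using coord_linear(1)[of 0 c "int_vec (dir p q)"]
        by (simp add: coord_int_vec coord_def[of 0] right_diff_distrib)
      also have "\<dots> = (c / of_nat (om p q)) * of_int (m (p, Inl q) i)"
        using o by (simp add: m_def we_def mu_def du_def)
      finally show ?thesis by simp
    qed
    thus ?thesis using c(1) o by (intro exI[of _ "c / of_nat (om p q)"]) simp
  qed
  have ray_m: "m (p, Inr (ray_dir k)) i = (if i = k then 1 else 0)" for p k i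
    using ray_dir_inj[of k 4] by (auto simp: m_def we_def mu_def du_def icoord_bv)
  have lev_eq: "lev q = lev p + c * sl e" if "\<forall>i. gap a q i = gap a p i + c * of_int (m e i)" for p q c e
    unfolding lev_def sl_def using that by (simp add: sum.distrib sum_distrib_left algebra_simps)
  have we_pos: "we e > 0" if "e \<in> L" for e
    using that by (rule L_cases) (auto simp: we_def om_pos)
  have m4: "m e 4 - m e i = we e * icoord (du e) i" for e i
    by (simp add: m_def algebra_simps)
  have du_prim: "primitive (du e)" if "e \<in> L" for e
    using that
  proof (rule L_cases)
    fix p q assume "e = (p, Inl q)" "(p, q) \<in> G"
    thus ?thesis using dir by (simp add: du_def prim_dir_def)
  next
    fix p u assume e: "e = (p, Inr u)" "(p, u) \<in> R"
    then obtain k where k: "u = ray_dir k" using R_bv by blast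
    have c1: "\<exists>i. \<bar>u $ i\<bar> = 1"
      unfolding k using exhaust_4[of k] by (elim disjE) (auto simp: ray_dir_def axis_def intro: exI[of _ 1] exI[of _ 2] exI[of _ 3])
    then obtain i where i: "\<bar>u $ i\<bar> = 1" by blast
    have "primitive u" unfolding primitive_def
    proof (intro conjI allI impI notI)
      assume "u = 0" thus False using i by simp
    next
      fix x :: int assume x: "x > 1" "\<forall>i. x dvd u $ i"
      hence "x dvd \<bar>u $ i\<bar>" by simp
      thus False using x(1) unfolding i by (auto simp: zdvd1_eq)
    qed
    thus ?thesis by (simp add: du_def e)
  qed
  have du_eq: "du e = du f" if e: "e \<in> L" and f: "f \<in> L" and c: "c > 0" "\<forall>i. of_int (m e i) = c * real_of_int (m f i)" for e f c
  proof -
    have eq: "real_of_int (icoord (du e) i) = (c * of_int (we f) / of_int (we e)) * of_int (icoord (du f) i)" for i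
    proof -
      have "real_of_int (m e 4 - m e i) = c * of_int (m f 4 - m f i)" using c(2) by (simp add: algebra_simps)
      thus ?thesis unfolding m4 using we_pos[OF e] by (simp add: field_simps)
    qed
    have "real_of_int (du e $ j) = (c * of_int (we f) / of_int (we e)) * of_int (du f $ j)" for j
      using exhaust_3[of j] eq[of 1] eq[of 2] eq[of 3] by (elim disjE) simp_all
    moreover have "c * of_int (we f) / of_int (we e) > 0" using we_pos[OF e] we_pos[OF f] c(1) by simp
    ultimately show ?thesis using primitive_unique[OF du_prim[OF e] du_prim[OF f]] by blast
  qed
  have ne_lev: "lev p \<noteq> lev q" if "(p, q) \<in> G" for p q
  proof
    assume "lev p = lev q"
    moreover have "p \<in> V" "q \<in> V" using that G_V by auto
    ultimately have "p = q" using lam(2) unfolding lev_def inj_on_def by blast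
    thus False using that G_irrefl by blast
  qed
  have face2: "\<exists>k l. k \<noteq> l \<and> gap a (fst e) k = 0 \<and> m e k = 0 \<and> gap a (fst e) l = 0 \<and> m e l = 0" if "e \<in> L" for e
    using that
  proof (rule L_cases)
    fix p q assume e: "e = (p, Inl q)" "(p, q) \<in> G"
    obtain k l where kl: "k \<noteq> l" "gap a p k = 0" "gap a q k = 0" "gap a p l = 0" "gap a q l = 0"
      using two_common[OF e(2)] by blast
    obtain c where "c > 0" "\<forall>i. gap a q i = gap a p i + c * of_int (m e i)" using bounded[OF e(2)] e by blast
    hence "m e k = 0" "m e l = 0" using kl by (metis add_0 mult_eq_0_iff of_int_eq_0_iff less_irrefl)+
    thus ?thesis using kl e by auto
  next
    fix p u assume e: "e = (p, Inr u)" "(p, u) \<in> R"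
    then obtain k where k: "u = ray_dir k" using R_bv by blast
    have pp: "p \<in> gplane a" using R_V[OF e(2)] V_plane by blast
    obtain i j where ij: "i \<noteq> j" "gap a (p + int_vec u) i = 0" "gap a (p + int_vec u) j = 0"
      using ray_plane[OF e(2)] by (auto simp: gplane_def)
    have g: "gap a (p + int_vec u) x = gap a p x + (if x = k then 1 else 0)" for x
      unfolding k by (rule gap_ray[OF pp])
    have "gap a p x = 0 \<and> m e x = 0" if "gap a (p + int_vec u) x = 0" for x
      using that g[of x] gap_nonneg[of a p x] ray_m[of p k x] unfolding e(1) k by (auto split: if_splits)
    thus ?thesis using ij e(1) by auto
  qed
  have sl_pos: "sl e > 0" if "e \<in> L" for e
    using that
  proof (rule L_cases)
    fix p q assume e: "e = (p, Inl q)" "(p, q) \<in> G" "lev p < lev q"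
    obtain c where c: "c > 0" "\<forall>i. gap a q i = gap a p i + c * of_int (m e i)" using bounded[OF e(2)] e by blast
    thus ?thesis using lev_eq[OF c(2)] e(3) by (simp add: zero_less_mult_iff)
  next
    fix p u assume e: "e = (p, Inr u)" "(p, u) \<in> R"
    then obtain k where k: "u = ray_dir k" using R_bv by blast
    have "sl e = (\<Sum>i\<in>UNIV. if i = k then lam k else 0)" unfolding sl_def e(1) k ray_m by (intro sum.cong) auto
    thus ?thesis using lam(1) by simp
  qed
  have out_darts: "(\<Sum>e\<in>{e\<in>L. fst e = v}. g e) =
      (\<Sum>q\<in>{q. (v, q) \<in> G \<and> lev v < lev q}. g (v, Inl q)) + (\<Sum>r\<in>{r\<in>R. fst r = v}. g (fst r, Inr (snd r)))"
    for v and g :: "_ \<Rightarrow> int"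
  proof -
    have split: "{e\<in>L. fst e = v} = (\<lambda>q. (v, Inl q)) ` {q. (v, q) \<in> G \<and> lev v < lev q}
        \<union> (\<lambda>r. (fst r, Inr (snd r))) ` {r\<in>R. fst r = v}" by (force simp: L_def)
    have f1: "finite {q. (v, q) \<in> G \<and> lev v < lev q}"
      by (rule finite_subset[of _ "snd ` G"]) (force simp: finG)+
    show ?thesis unfolding split
      by (subst sum.union_disjoint) (auto simp: f1 finR sum.reindex inj_on_def prod_eq_iff)
  qed
  have in_darts: "(\<Sum>e\<in>{e\<in>L. hi e = Some v}. g e) = (\<Sum>q\<in>{q. (v, q) \<in> G \<and> lev q < lev v}. g (q, Inl v))"
    for v and g :: "_ \<Rightarrow> int"
  proof -
    have split: "{e\<in>L. hi e = Some v} = (\<lambda>q. (q, Inl v)) ` {q. (v, q) \<in> G \<and> lev q < lev v}"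
      using G_sym by (auto simp: L_def hi_def)
    show ?thesis unfolding split by (subst sum.reindex) (auto simp: inj_on_def)
  qed
  have LC: "leveled_curve V L fst hi (gap a) m we lam"
  proof (intro leveled_curve.intro, unfold lev_def[symmetric] sl_def[symmetric] F_def[symmetric])
    show "finite V" by (rule finV)
    show "finite L" unfolding L_def using finG finR by (auto intro: finite_subset)
    show "0 < lam i" for i by (rule lam(1))
    show "0 \<le> gap a v i" for v i by (rule gap_nonneg)
    show "fst e \<in> V" if "e \<in> L" for e using that G_V R_V by (auto simp: L_def)
    show "q \<in> V" if "e \<in> L" "hi e = Some q" for e q using that G_V by (auto simp: L_def hi_def)
    show "\<exists>c>0. \<forall>i. gap a q i = gap a (fst e) i + c * of_int (m e i)" if "e \<in> L" "hi e = Some q" for e q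
      using that bounded by (auto simp: L_def hi_def)
    show "0 < sl e" if "e \<in> L" for e by (rule sl_pos[OF that])
    show "\<exists>i j. i \<noteq> j \<and> F e \<subseteq> {i, j}" if e: "e \<in> L" for e
    proof -
      obtain k l where kl: "k \<noteq> l" "k \<notin> F e" "l \<notin> F e" using face2[OF e] by (auto simp: F_def)
      have "card (- {k, l}) = 2" using kl(1) by (simp add: Compl_eq_Diff_UNIV card_Diff_subset)
      then obtain i j where "- {k, l} = {i, j}" "i \<noteq> j" by (auto simp: card_2_iff)
      thus ?thesis using kl by blast
    qed
    show "\<exists>k. \<forall>i. m e i = (if i = k then 1 else 0)" if "e \<in> L" "hi e = None" for e
      using that(1)
    proof (rule L_cases)
      fix p u assume e: "e = (p, Inr u)" "(p, u) \<in> R"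
      then obtain k where k: "u = ray_dir k" using R_bv by blast
      show ?thesis unfolding e(1) k ray_m by blast
    qed (use that in \<open>simp add: hi_def\<close>)
    show "we e = gcd (m e i) (m e j)" if e: "e \<in> L" and F: "F e \<subseteq> {i, j}" for e i j
    proof -
      obtain k where k: "m e k = 0" using face2[OF e] by blast
      have muk: "mu e = icoord (du e) k" using k we_pos[OF e] by (simp add: m_def)
      \<comment> \<open>The \<open>k\<close>-th gap is constant along \<open>e\<close>, so
        coordinates are measured from the \<open>k\<close>-th one. The index 4, whose coordinate is
        0, makes \<open>g\<close> divide the \<open>k\<close>-th coordinate and therefore the whole
        primitive vector.\<close>
      define g where "g = gcd (icoord (du e) k - icoord (du e) i) (icoord (du e) k - icoord (du e) j)"
      have scale: "gcd (m e i) (m e j) = \<bar>we e\<bar> * g"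
        unfolding m_def muk g_def by (simp add: gcd_mult_distrib_int)
      have dvd: "g dvd icoord (du e) k - icoord (du e) x" for x
      proof (cases "x = i \<or> x = j")
        case False
        hence "m e x = 0" using F by (auto simp: F_def)
        thus ?thesis using we_pos[OF e] muk by (simp add: m_def)
      qed (auto simp: g_def)
      have "g dvd icoord (du e) x" for x
      proof -
        have "g dvd icoord (du e) k" using dvd[of 4] by simp
        hence "g dvd icoord (du e) k - (icoord (du e) k - icoord (du e) x)" using dvd[of x] by (rule dvd_diff)
        thus ?thesis by simp
      qed
      hence gd: "\<forall>j. g dvd du e $ j" using icoord_simps(1-3)[of "du e"] unfolding forall_3 by metis
      have "g \<ge> 0" by (simp add: g_def)
      moreover have "\<not> g > 1" using du_prim[OF e] gd unfolding primitive_def by blast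
      moreover have "g \<noteq> 0" using du_prim[OF e] gd unfolding primitive_def by (auto simp: vec_eq_iff)
      ultimately have "g = 1" by linarith
      thus ?thesis using scale we_pos[OF e] by simp
    qed
    show "(\<Sum>e\<in>{e\<in>L. fst e = v}. m e i) - (\<Sum>e\<in>{e\<in>L. hi e = Some v}. m e i) =
        (\<Sum>e\<in>{e\<in>L. fst e = v}. m e j) - (\<Sum>e\<in>{e\<in>L. hi e = Some v}. m e j)" if v: "v \<in> V" for v i j
    proof -
      have zero: "(\<Sum>e\<in>{e\<in>L. fst e = v}. we e * icoord (du e) x) - (\<Sum>e\<in>{e\<in>L. hi e = Some v}. we e * icoord (du e) x) = 0" for x
      proof -
        let ?U = "{q. (v, q) \<in> G \<and> lev v < lev q}" and ?D = "{q. (v, q) \<in> G \<and> lev q < lev v}"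
        have fin: "finite ?U" "finite ?D" by (rule finite_subset[of _ "snd ` G"]; force simp: finG)+
        have all: "{q. (v, q) \<in> G} = ?U \<union> ?D" "?U \<inter> ?D = {}" using ne_lev by (auto simp: neq_iff)
        have "0 = icoord ((\<Sum>q\<in>{q. (v, q) \<in> G}. int (om v q) *s dir v q) + (\<Sum>r\<in>{r\<in>R. fst r = v}. snd r)) x"
          unfolding bal[OF v] by simp
        also have "\<dots> = (\<Sum>q\<in>{q. (v, q) \<in> G}. int (om v q) * icoord (dir v q) x) + (\<Sum>r\<in>{r\<in>R. fst r = v}. icoord (snd r) x)"
          by (simp add: icoord_add icoord_sum icoord_smult)
        also have "(\<Sum>q\<in>{q. (v, q) \<in> G}. int (om v q) * icoord (dir v q) x)
           = (\<Sum>q\<in>?U. int (om v q) * icoord (dir v q) x) + (\<Sum>q\<in>?D. int (om v q) * icoord (dir v q) x)"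
          unfolding all(1) using fin all(2) by (rule sum.union_disjoint)
        also have "(\<Sum>q\<in>?D. int (om v q) * icoord (dir v q) x) = - (\<Sum>q\<in>?D. int (om q v) * icoord (dir q v) x)"
          unfolding sum_negf[symmetric]
        proof (intro sum.cong refl)
          fix q assume "q \<in> ?D"
          hence q: "(v, q) \<in> G" by simp
          show "int (om v q) * icoord (dir v q) x = - (int (om q v) * icoord (dir q v) x)"
            unfolding om_sym[OF q] dir_commute[OF q] icoord_minus by simp
        qed
        finally show ?thesis unfolding out_darts in_darts by (simp add: we_def du_def)
      qed
      \<comment> \<open>The part with \<open>mu\<close> is the same for all coordinates. Hence gap
        coordinates balance only up to a common momentum, and the balancing condition of the sweep
        compares two coordinates.\<close>
      have ms: "(\<Sum>e\<in>S. m e x) = (\<Sum>e\<in>S. we e * mu e) - (\<Sum>e\<in>S. we e * icoord (du e) x)" for S x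
        by (simp add: m_def right_diff_distrib sum_subtractf)
      show ?thesis unfolding ms using zero[of i] zero[of j] by linarith
    qed
    show "\<exists>i. of_int (m e i) \<noteq> c * (of_int (m f i) :: real)"
      if e: "e \<in> L" and f: "f \<in> L" and ne: "e \<noteq> f" and at: "fst e = fst f \<or> hi e = hi f \<and> hi e \<noteq> None" and c: "c > 0" for e f c
    proof (rule ccontr)
      assume "\<not> ?thesis"
      hence du: "du e = du f" using du_eq[OF e f c] by blast
      show False using e
      proof (rule L_cases)
        fix p q assume e': "e = (p, Inl q)" "(p, q) \<in> G"
        show False using f
        proof (rule L_cases)
          fix p' q' assume f': "f = (p', Inl q')" "(p', q') \<in> G"
          have dd: "dir p q = dir p' q'" using du by (simp add: du_def e' f')
          consider "p = p'" | "q = q'" using at by (auto simp: e' f' hi_def)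
          thus False
          proof cases
            case 1
            thus False using inj_dir[of p q q'] dd e' f' ne by auto
          next
            case 2
            hence "dir q p = dir q p'" using dd dir_commute e'(2) f'(2) by simp
            thus False using inj_dir[of q p p'] G_sym e' f' ne 2 by auto
          qed
        next
          fix p' u assume f': "f = (p', Inr u)" "(p', u) \<in> R"
          hence "p = p'" using at by (auto simp: e' f' hi_def)
          thus False using du dir_ray[OF e'(2)] f' by (simp add: du_def e')
        qed
      next
        fix p u assume e': "e = (p, Inr u)" "(p, u) \<in> R"
        show False using f
        proof (rule L_cases)
          fix p' q' assume f': "f = (p', Inl q')" "(p', q') \<in> G"
          hence "p = p'" using at by (auto simp: e' f' hi_def)
          thus False using du dir_ray[OF f'(2)] e' by (simp add: du_def f')
        next
          fix p' u' assume f': "f = (p', Inr u')" "(p', u') \<in> R"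
          hence "p = p'" using at by (auto simp: e' f' hi_def)
          thus False using du ne by (simp add: du_def e' f')
        qed
      qed
    qed
    show "inj_on lev V" using lam(2) unfolding lev_def .
  qed
  interpret C: leveled_curve V L fst hi "gap a" m we lam lev sl F
    using LC by (simp_all add: lev_def sl_def F_def)
  have Rays: "{e\<in>L. hi e = None} = (\<lambda>(p, u). (p, Inr u)) ` R" by (auto simp: L_def hi_def)
  have cR: "card {e\<in>L. hi e = None} = card R" unfolding Rays by (rule card_image) (auto simp: inj_on_def)
  define up dn where "up = {(p, q) \<in> G. lev p < lev q}" and "dn = {(p, q) \<in> G. lev q < lev p}"
  have "{e\<in>L. hi e \<noteq> None} = (\<lambda>(p, q). (p, Inl q)) ` up" by (auto simp: L_def hi_def up_def)
  hence cB: "card {e\<in>L. hi e \<noteq> None} = card up" by (simp add: card_image inj_on_def split_beta prod_eq_iff)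
  have "dn = prod.swap ` up" using G_sym by (force simp: up_def dn_def)
  hence "card dn = card up" by (simp add: card_image)
  moreover have "G = up \<union> dn" "up \<inter> dn = {}" using ne_lev by (auto simp: up_def dn_def neq_iff)
  moreover have "finite up" "finite dn" using finG by (auto simp: up_def dn_def intro: finite_subset)
  ultimately have "card G = 2 * card up" by (simp add: card_Un_disjoint)
  thus ?thesis using C.edge_count_bound[of d, unfolded cR cB] rays d by simp
qed

end

locale embedded_plane_graph = plane_graph +
  assumes open_V: "\<And>p q. (p, q) \<in> G \<Longrightarrow> open_segment p q \<inter> V = {}"
    and meet: "\<And>p q p' q' x. (p, q) \<in> G \<Longrightarrow> (p', q') \<in> G \<Longrightarrow>
      x \<in> open_segment p q \<Longrightarrow> x \<in> open_segment p' q' \<Longrightarrow> {p, q} = {p', q'}"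
begin

text \<open>An edge through the apex of the plane is subdivided there.\<close>

lemma dart_count_bound_embedded:
  fixes d :: int
  assumes rays: "int (card R) = 4 * d" and d: "d \<ge> 1"
  shows "int (card G) + 4 * d - 2 * int (card V) \<le> 2 * d^2 - 2 * d + 2"
proof (cases "\<exists>p q x. (p, q) \<in> G \<and> x \<in> open_segment p q \<and> (\<forall>i. gap a x i = 0)")
  case False
  then interpret apex_free_plane_graph a V G R dir om by unfold_locales blast
  show ?thesis by (rule dart_count_bound[OF rays d])
next
  case True
  then obtain p0 q0 z where pq: "(p0, q0) \<in> G" "z \<in> open_segment p0 q0" "\<And>i. gap a z i = 0" by blast
  note qp = G_sym[OF pq(1)]
  have zV: "z \<notin> V" using open_V[OF pq(1)] pq(2) by blast
  have pqV: "p0 \<in> V" "q0 \<in> V" using pq(1) G_V by auto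
  have ne: "p0 \<noteq> q0" "z \<noteq> p0" "z \<noteq> q0" using pq(1) G_irrefl zV pqV by auto
  define other where "other v = (if v = p0 then q0 else p0)" for v
  define dir' where "dir' p q = (if p = z then - dir q (other q) else if q = z then dir p (other p) else dir p q)" for p q
  define om' where "om' p q = (if p = z \<or> q = z then om p0 q0 else om p q)" for p q
  define V' where "V' = insert z V"
  define G0 where "G0 = G - {(p0, q0), (q0, p0)}"
  define G' where "G' = G0 \<union> {(p0, z), (q0, z), (z, p0), (z, q0)}"
  have G0: "(p, q) \<in> G" "p \<noteq> z" "q \<noteq> z" "{p, q} \<noteq> {p0, q0}" if "(p, q) \<in> G0" for p q
    using that G_V zV by (auto simp: G0_def doubleton_eq_iff)
  have G'_cases: thesis if "(p, q) \<in> G'"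
    "(p, q) \<in> G0 \<Longrightarrow> thesis" "p \<in> {p0, q0} \<Longrightarrow> q = z \<Longrightarrow> thesis" "p = z \<Longrightarrow> q \<in> {p0, q0} \<Longrightarrow> thesis" for p q thesis
    using that by (auto simp: G'_def)
  have other: "(v, other v) \<in> G" "other v \<noteq> v" "{v, other v} = {p0, q0}" if "v \<in> {p0, q0}" for v
    using that pq(1) qp ne by (auto simp: other_def)
  have zseg: "z \<in> open_segment v (other v)" if "v \<in> {p0, q0}" for v
    using that pq(2) ne(1) by (auto simp: other_def open_segment_commute)
  have dir_z: "prim_dir v z (dir v (other v))" if v: "v \<in> {p0, q0}" for v
  proof -
    obtain u where u: "0 < u" "u < 1" "z = (1 - u) *\<^sub>R v + u *\<^sub>R other v"
      using zseg[OF v] by (auto simp: in_segment)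
    obtain c where c: "c > 0" "other v - v = c *\<^sub>R int_vec (dir v (other v))"
      using dir[OF other(1)[OF v]] by (auto simp: prim_dir_def)
    have "z - v = u *\<^sub>R (other v - v)" unfolding u(3) by (simp add: algebra_simps)
    hence "z - v = (u * c) *\<^sub>R int_vec (dir v (other v))" unfolding c(2) by simp
    thus ?thesis using dir[OF other(1)[OF v]] u(1) c(1) by (auto simp: prim_dir_def intro!: exI[of _ "u * c"])
  qed
  have nbr0: "{q. (v, q) \<in> G'} = {q. (v, q) \<in> G}" if "v \<notin> {p0, q0, z}" for v
    using that by (auto simp: G'_def G0_def)
  have nbr1: "{q. (v, q) \<in> G'} = insert z ({q. (v, q) \<in> G} - {other v})" if "v \<in> {p0, q0}" for v
    using that ne by (auto simp: G'_def G0_def other_def)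
  have nbrz: "{q. (z, q) \<in> G'} = {p0, q0}"
    using ne zV G_V by (auto simp: G'_def G0_def)
  have finN: "finite {q. (v, q) \<in> G}" for v
    by (rule finite_subset[of _ "snd ` G"]) (force simp: finG)+
  have neV: "q \<noteq> z" if "(v, q) \<in> G" for v q using that G_V zV by auto
  have neV': "v \<noteq> z" if "(v, q) \<in> G" for v q using that G_V zV by auto
  interpret P: apex_free_plane_graph a V' G' R dir' om'
  proof
    show "finite V'" by (simp add: V'_def finV)
    show "finite R" by (rule finR)
    show "G' \<subseteq> V' \<times> V'" using G_V pqV by (auto simp: G'_def G0_def V'_def)
    show "(q, p) \<in> G'" if "(p, q) \<in> G'" for p q using that G_sym by (auto simp: G'_def G0_def)
    show "(p, p) \<notin> G'" for p using G_irrefl ne by (auto simp: G'_def G0_def)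
    show "p \<in> V'" if "(p, u) \<in> R" for p u using R_V[OF that] by (simp add: V'_def)
    show "prim_dir p q (dir' p q)" if "(p, q) \<in> G'" for p q
      using that
    proof (rule G'_cases)
      assume "(p, q) \<in> G0"
      thus ?thesis using G0[of p q] dir by (simp add: dir'_def)
    next
      assume "p \<in> {p0, q0}" "q = z"
      thus ?thesis using dir_z ne by (auto simp: dir'_def)
    next
      assume "p = z" "q \<in> {p0, q0}"
      thus ?thesis using prim_dir_commute[OF dir_z] by (auto simp: dir'_def)
    qed
    show "om' p q > 0" if "(p, q) \<in> G'" for p q
      using that om_pos pq(1) by (auto simp: om'_def G'_def G0_def)
    show "om' q p = om' p q" if "(p, q) \<in> G'" for p q
      using that om_sym by (auto simp: om'_def G'_def G0_def)
    show "\<exists>k. u = ray_dir k" if "(p, u) \<in> R" for p u using R_bv[OF that] .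
    show "(\<Sum>q\<in>{q. (v, q) \<in> G'}. int (om' v q) *s dir' v q) + (\<Sum>r\<in>{r\<in>R. fst r = v}. snd r) = 0" if v: "v \<in> V'" for v
    proof -
      consider "v = z" | "v \<in> {p0, q0}" | "v \<in> V" "v \<notin> {p0, q0, z}" using v by (auto simp: V'_def)
      thus ?thesis
      proof cases
        case 1
        have R0: "{r\<in>R. fst r = z} = {}" using R_V zV by auto
        have "(\<Sum>q\<in>{p0, q0}. int (om' z q) *s dir' z q)
          = int (om p0 q0) *s (- dir p0 q0) + int (om p0 q0) *s (- dir q0 p0)"
          using ne by (simp add: dir'_def om'_def other_def)
        also have "\<dots> = 0" unfolding dir_commute[OF pq(1)] by (simp add: vec_eq_iff)
        finally show ?thesis unfolding 1 nbrz R0 by simp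
      next
        case 2
        have "om v (other v) = om p0 q0" using 2 om_sym[OF pq(1)] by (auto simp: other_def)
        moreover have "v \<noteq> z" using 2 ne by auto
        ultimately have z: "int (om' v z) *s dir' v z = int (om v (other v)) *s dir v (other v)"
          by (simp add: om'_def dir'_def)
        have "(\<Sum>q\<in>{q. (v, q) \<in> G'}. int (om' v q) *s dir' v q)
          = int (om' v z) *s dir' v z + (\<Sum>q\<in>{q. (v, q) \<in> G} - {other v}. int (om' v q) *s dir' v q)"
          unfolding nbr1[OF 2] using finN neV by (subst sum.insert) auto
        also have "(\<Sum>q\<in>{q. (v, q) \<in> G} - {other v}. int (om' v q) *s dir' v q)
          = (\<Sum>q\<in>{q. (v, q) \<in> G} - {other v}. int (om v q) *s dir v q)"
          using neV neV' by (intro sum.cong refl) (auto simp: om'_def dir'_def)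
        also have "int (om' v z) *s dir' v z + \<dots> = (\<Sum>q\<in>{q. (v, q) \<in> G}. int (om v q) *s dir v q)"
          unfolding z using finN other(1)[OF 2] by (subst sum.remove[of _ "other v"]) auto
        finally show ?thesis using bal[of v] 2 pqV by auto
      next
        case 3
        have "(\<Sum>q\<in>{q. (v, q) \<in> G}. int (om' v q) *s dir' v q) = (\<Sum>q\<in>{q. (v, q) \<in> G}. int (om v q) *s dir v q)"
          using neV neV' by (intro sum.cong refl) (auto simp: om'_def dir'_def)
        thus ?thesis unfolding nbr0[OF 3(2)] using bal[OF 3(1)] by simp
      qed
    qed
    \<comment> \<open>At an old vertex each new dart has the direction of an old one, the half edge
      towards \<open>z\<close> inheriting that of the whole edge, so statements about directions
      carry over.\<close>
    have old_dart: "\<exists>q'. (v, q') \<in> G \<and> dir' v q = dir v q' \<and> (q = z \<and> v \<in> {p0, q0} \<and> q' = other v \<or> q \<noteq> z \<and> q' = q \<and> (v, q) \<in> G0)"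
      if "(v, q) \<in> G'" "v \<noteq> z" for v q
      using that(1)
    proof (rule G'_cases)
      assume "(v, q) \<in> G0"
      thus ?thesis using G0[of v q] that(2) by (intro exI[of _ q]) (simp add: dir'_def)
    next
      assume "v \<in> {p0, q0}" "q = z"
      thus ?thesis using other[of v] that(2) by (intro exI[of _ "other v"]) (simp add: dir'_def)
    qed (use that(2) in simp)
    show "q = q'" if h: "(v, q) \<in> G'" "(v, q') \<in> G'" "dir' v q = dir' v q'" for v q q'
    proof (cases "v = z")
      case True
      have q: "q \<in> {p0, q0}" "q' \<in> {p0, q0}" using h nbrz unfolding True by auto
      show ?thesis
      proof (rule ccontr)
        assume "q \<noteq> q'"
        hence "dir p0 q0 = dir q0 p0" using h(3) q ne unfolding True by (auto simp: dir'_def other_def)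
        hence "dir p0 q0 = - dir p0 q0" using dir_commute[OF pq(1)] by simp
        hence "dir p0 q0 = 0" by (simp add: vec_eq_iff)
        thus False using dir[OF pq(1)] by (simp add: prim_dir_def primitive_def)
      qed
    next
      case False
      obtain x where x: "(v, x) \<in> G" "dir' v q = dir v x"
        "q = z \<and> v \<in> {p0, q0} \<and> x = other v \<or> q \<noteq> z \<and> x = q \<and> (v, q) \<in> G0" using old_dart[OF h(1) False] by blast
      obtain x' where x': "(v, x') \<in> G" "dir' v q' = dir v x'"
        "q' = z \<and> v \<in> {p0, q0} \<and> x' = other v \<or> q' \<noteq> z \<and> x' = q' \<and> (v, q') \<in> G0" using old_dart[OF h(2) False] by blast
      have "x = x'" using inj_dir[OF x(1) x'(1)] x(2) x'(2) h(3) by simp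
      thus ?thesis using x(3) x'(3) other(3)[of v] G0(4)[of v q] G0(4)[of v q'] by metis
    qed
    show "(v, dir' v q) \<notin> R" if h: "(v, q) \<in> G'" for v q
    proof (cases "v = z")
      case True
      thus ?thesis using R_V zV by blast
    next
      case False
      thus ?thesis using old_dart[OF h False] dir_ray by metis
    qed
    have "(1 :: 4) \<noteq> 2" by simp
    hence "z \<in> gplane a" using pq(3) unfolding gplane_def by blast
    thus "V' \<subseteq> gplane a" using V_plane by (simp add: V'_def)
    have sub: "closed_segment v z \<subseteq> closed_segment v (other v)" if "v \<in> {p0, q0}" for v
      using zseg[OF that] by (simp add: open_closed_segment subset_closed_segment)
    show "closed_segment p q \<subseteq> gplane a" if "(p, q) \<in> G'" for p q
      using that
    proof (rule G'_cases)
      assume "(p, q) \<in> G0"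
      thus ?thesis using G0 seg_plane by blast
    next
      assume "p \<in> {p0, q0}" "q = z"
      thus ?thesis using sub[of p] seg_plane[OF other(1)[of p]] by blast
    next
      assume "p = z" "q \<in> {p0, q0}"
      thus ?thesis using sub[of q] seg_plane[OF other(1)[of q]] by (metis closed_segment_commute order_trans)
    qed
    show "p + int_vec u \<in> gplane a" if "(p, u) \<in> R" for p u using ray_plane[OF that] .
    show "\<exists>i. gap a x i \<noteq> 0" if h: "(p, q) \<in> G'" "x \<in> open_segment p q" for p q x
    proof (rule ccontr)
      assume "\<not> ?thesis"
      \<comment> \<open>Gaps determine points, so \<open>z\<close> is the only apex. An uncut edge
        through it would share an interior point with the edge that was cut.\<close>
      hence "gap a x = gap a z" using pq(3) by auto
      hence xz: "x = z" by (rule gap_inj)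
      show False using h(1)
      proof (rule G'_cases)
        assume "(p, q) \<in> G0"
        thus False using meet[OF _ pq(1) _ pq(2), of p q] G0[of p q] h(2) xz by blast
      qed (use h(2) xz in \<open>auto simp: open_segment_def\<close>)
    qed
  qed
  \<comment> \<open>Subdivision adds one vertex and two darts, so \<open>card G - 2 * card V\<close>
    does not change.\<close>
  have "card V' = card V + 1" using zV finV by (simp add: V'_def)
  moreover have "int (card G') = int (card G) + 2"
  proof -
    have "G0 \<inter> {(p0, z), (q0, z), (z, p0), (z, q0)} = {}" using G0(2)[of z] G0(3)[of _ z] by blast
    moreover have "card {(p0, z), (q0, z), (z, p0), (z, q0)} = 4" using ne by auto
    ultimately have "card G' = card G0 + 4"
      unfolding G'_def using finG by (subst card_Un_disjoint) (auto simp: G0_def)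
    moreover have "card G0 + card {(p0, q0), (q0, p0)} = card G"
      unfolding G0_def using pq(1) qp finG
      by (subst card_Diff_subset) (auto intro!: le_add_diff_inverse2 card_mono)
    moreover have "card {(p0, q0), (q0, p0)} = 2" using ne by auto
    ultimately show ?thesis by simp
  qed
  ultimately show ?thesis using P.dart_count_bound[OF rays d] by simp
qed

end

section \<open>Components and unbounded edges\<close>

lemma sum_antisym_zero:
  fixes g :: "'a \<Rightarrow> 'a \<Rightarrow> int"
  assumes "finite V" "G \<subseteq> V \<times> V" and sym: "\<And>p q. (p, q) \<in> G \<Longrightarrow> (q, p) \<in> G"
    and anti: "\<And>p q. (p, q) \<in> G \<Longrightarrow> g q p = - g p q"
  shows "(\<Sum>v\<in>V. \<Sum>q\<in>{q. (v, q) \<in> G}. g v q) = 0"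
proof -
  have S: "Sigma V (\<lambda>v. {q. (v, q) \<in> G}) = G" using assms(2) by auto
  have "finite {q. (v, q) \<in> G}" for v
    by (rule finite_subset[OF _ assms(1)]) (use assms(2) in auto)
  hence "(\<Sum>v\<in>V. \<Sum>q\<in>{q. (v, q) \<in> G}. g v q) = (\<Sum>x\<in>G. g (fst x) (snd x))"
    using assms(1) by (subst sum.Sigma) (auto simp: S split_beta)
  moreover have "(\<Sum>x\<in>G. g (fst x) (snd x)) = (\<Sum>x\<in>G. g (snd x) (fst x))"
    by (rule sum.reindex_bij_witness[of _ prod.swap prod.swap]) (auto intro: sym)
  moreover have "(\<Sum>x\<in>G. g (snd x) (fst x)) = - (\<Sum>x\<in>G. g (fst x) (snd x))"
    unfolding sum_negf[symmetric] using anti by (intro sum.cong) auto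
  ultimately show ?thesis by linarith
qed

text \<open>Summed over all vertices, the two ends of a bounded edge cancel.\<close>

lemma balanced_rays:
  fixes g :: "'a \<Rightarrow> 'a \<Rightarrow> int" and h :: "'a \<times> 'b \<Rightarrow> int"
  assumes "finite V" "G \<subseteq> V \<times> V" "\<And>p q. (p, q) \<in> G \<Longrightarrow> (q, p) \<in> G"
    "\<And>p q. (p, q) \<in> G \<Longrightarrow> g q p = - g p q"
    and "finite R" "fst ` R \<subseteq> V"
    and "\<And>v. v \<in> V \<Longrightarrow> (\<Sum>q\<in>{q. (v, q) \<in> G}. g v q) + (\<Sum>r\<in>{r\<in>R. fst r = v}. h r) = 0"
  shows "(\<Sum>r\<in>R. h r) = 0"
proof -
  have "(\<Sum>r\<in>R. h r) = (\<Sum>v\<in>V. \<Sum>r\<in>{r\<in>R. fst r = v}. h r)"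
    using sum.group[OF assms(5,1,6), of h] by simp
  also have "\<dots> = (\<Sum>v\<in>V. \<Sum>q\<in>{q. (v, q) \<in> G}. g v q) + (\<Sum>v\<in>V. \<Sum>r\<in>{r\<in>R. fst r = v}. h r)"
    using sum_antisym_zero[OF assms(1-4)] by simp
  also have "\<dots> = 0" unfolding sum.distrib[symmetric] using assms(7) by (intro sum.neutral) auto
  finally show ?thesis .
qed

lemma int_vec_sum: "int_vec (\<Sum>x\<in>A. f x) = (\<Sum>x\<in>A. int_vec (f x))"
  by (simp add: int_vec_def vec_eq_iff)

lemma int_vec_smult: "int_vec (c *s u) = of_int c *\<^sub>R int_vec u"
  by (simp add: int_vec_def vec_eq_iff)

context plane_graph
begin

text \<open>Needed for the components, whose degrees are not given in advance: global balancing in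
  coordinate \<open>i\<close> makes the directions \<open>i\<close> and \<open>4\<close> occur
  equally often.\<close>

lemma rays_divisible: "\<exists>n. card R = 4 * n"
proof -
  define c where "c k = card {r\<in>R. snd r = ray_dir k}" for k
  have zero: "(\<Sum>r\<in>R. icoord (snd r) i) = 0" for i
  proof (rule balanced_rays[OF finV G_V G_sym _ finR, where g = "\<lambda>p q. int (om p q) * icoord (dir p q) i"])
    show "int (om q p) * icoord (dir q p) i = - (int (om p q) * icoord (dir p q) i)" if "(p, q) \<in> G" for p q
      unfolding om_sym[OF that] dir_commute[OF that] icoord_minus by simp
    show "fst ` R \<subseteq> V" using R_V by auto
    show "(\<Sum>q\<in>{q. (v, q) \<in> G}. int (om v q) * icoord (dir v q) i) + (\<Sum>r\<in>{r\<in>R. fst r = v}. icoord (snd r) i) = 0"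
      if "v \<in> V" for v
      using arg_cong[OF bal[OF that], of "\<lambda>u. icoord u i"] by (simp add: icoord_add icoord_sum icoord_smult)
  qed
  have R: "R = (\<Union>k\<in>UNIV. {r\<in>R. snd r = ray_dir k})" using R_bv by fastforce
  have dis: "{r\<in>R. snd r = ray_dir k} \<inter> {r\<in>R. snd r = ray_dir l} = {}" if "k \<noteq> l" for k l
    using that ray_dir_inj by auto
  have sumR: "(\<Sum>r\<in>R. h r) = (\<Sum>k\<in>UNIV. \<Sum>r\<in>{r\<in>R. snd r = ray_dir k}. h r)" for h :: "_ \<Rightarrow> int"
    using finR dis by (subst R, subst sum.UNION_disjoint) auto
  have eq: "int (c 4) = int (c i)" for i
  proof (cases "i = 4")
    case False
    have "0 = (\<Sum>k\<in>UNIV. int (c k) * icoord (ray_dir k) i)"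
      unfolding zero[of i, symmetric] sumR c_def by (intro sum.cong refl) simp
    also have "\<dots> = (\<Sum>k\<in>UNIV. (if k = 4 then int (c k) else 0) - (if k = i then int (c k) else 0))"
      by (intro sum.cong refl) (auto simp: icoord_bv)
    also have "\<dots> = int (c 4) - int (c i)" by (simp add: sum_subtractf)
    finally show ?thesis by simp
  qed simp
  have "int (card R) = (\<Sum>k\<in>UNIV. int (c k))" using sumR[of "\<lambda>_. 1"] by (simp add: c_def)
  also have "\<dots> = (\<Sum>k\<in>(UNIV :: 4 set). int (c 4))" by (intro sum.cong refl eq[symmetric])
  also have "\<dots> = int (4 * c 4)" by simp
  finally show ?thesis by (metis of_nat_eq_iff)
qed

text \<open>A vertex of maximal norm sees all its neighbours in an open half-space.\<close>

lemma no_darts_if_no_rays: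
  assumes "R = {}" shows "G = {}"
proof (rule ccontr)
  assume "G \<noteq> {}"
  hence fin: "finite (norm ` fst ` G)" "norm ` fst ` G \<noteq> {}" using finG by auto
  then obtain v where v: "v \<in> fst ` G" "norm v = Max (norm ` fst ` G)"
    using Max_in[OF fin] by (metis imageE)
  have neg: "int_vec (dir v q) \<bullet> v < 0" if q: "(v, q) \<in> G" for q
  proof -
    obtain c where c: "c > 0" "q - v = c *\<^sub>R int_vec (dir v q)" using dir[OF q] by (auto simp: prim_dir_def)
    have "q \<in> fst ` G" using G_sym[OF q] by force
    hence "norm q \<le> norm v" unfolding v(2) using fin by (intro Max_ge) auto
    hence "q \<bullet> q \<le> v \<bullet> v" by (simp add: norm_le)
    moreover have "(q - v) \<bullet> (q - v) > 0" using q G_irrefl by auto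
    ultimately have "(q - v) \<bullet> v < 0" by (simp add: inner_diff_left inner_diff_right inner_commute)
    thus ?thesis unfolding c(2) using c(1) by (simp add: mult_less_0_iff)
  qed
  have vV: "v \<in> V" using v(1) G_V by auto
  have N: "finite {q. (v, q) \<in> G}" by (rule finite_subset[of _ "snd ` G"]) (force simp: finG)+
  have "(\<Sum>q\<in>{q. (v, q) \<in> G}. int (om v q) *s dir v q) = 0" using bal[OF vV] assms by simp
  hence "int_vec (\<Sum>q\<in>{q. (v, q) \<in> G}. int (om v q) *s dir v q) \<bullet> v = 0"
    by (simp add: int_vec_def zero_vec_def[symmetric])
  hence "(\<Sum>q\<in>{q. (v, q) \<in> G}. - (real (om v q) * (int_vec (dir v q) \<bullet> v))) = 0"
    by (simp add: int_vec_sum int_vec_smult inner_sum_left sum_negf)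
  moreover have "(\<Sum>q\<in>{q. (v, q) \<in> G}. - (real (om v q) * (int_vec (dir v q) \<bullet> v))) > 0"
    using N v(1) neg om_pos by (intro sum_pos) (auto simp: mult_pos_neg)
  ultimately show False by simp
qed

end

text \<open>At 0 the product would be 2, but a component without unbounded edges is a single
  vertex.\<close>

definition max_genus :: "int \<Rightarrow> int" where
  "max_genus n = (if n = 0 then 0 else (n - 1) * (n - 2))"

text \<open>For positive arguments the two sides differ by \<open>2 * m * n - 2\<close>.\<close>

lemma max_genus_add: "m \<ge> 0 \<Longrightarrow> n \<ge> 0 \<Longrightarrow> max_genus m + max_genus n \<le> max_genus (m + n)"
proof -
  assume mn: "m \<ge> 0" "n \<ge> 0"
  show ?thesis
  proof (cases "m = 0 \<or> n = 0")
    case False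
    hence "1 * 1 \<le> m * n" using mn by (intro mult_mono) auto
    thus ?thesis using False mn by (simp add: max_genus_def algebra_simps)
  qed (auto simp: max_genus_def)
qed

lemma sum_max_genus_le: "finite A \<Longrightarrow> (\<And>x. x \<in> A \<Longrightarrow> f x \<ge> 0) \<Longrightarrow> (\<Sum>x\<in>A. max_genus (f x)) \<le> max_genus (\<Sum>x\<in>A. f x)"
proof (induction A rule: finite_induct)
  case (insert x A)
  have "(\<Sum>x\<in>insert x A. max_genus (f x)) \<le> max_genus (f x) + max_genus (\<Sum>x\<in>A. f x)"
    using insert by simp
  also have "\<dots> \<le> max_genus (f x + (\<Sum>x\<in>A. f x))"
    using insert.prems by (intro max_genus_add sum_nonneg) auto
  finally show ?case using insert.hyps by simp
qed (simp add: max_genus_def)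

text \<open>The unbounded edges of a curve of degree \<open>d\<close> have total multiplicity \<open>4 d\<close> in the four
  directions of the plane, so \<open>4 d\<close> of them can only be basic rays of weight 1.\<close>

lemma basic_rays:
  fixes wr :: "'a \<times> (int^3) \<Rightarrow> nat"
  assumes fin: "finite R" and wr: "\<And>r. r \<in> R \<Longrightarrow> wr r > 0" and prim: "\<And>r. r \<in> R \<Longrightarrow> snd r \<noteq> 0"
    and bal: "\<And>i. (\<Sum>r\<in>R. int (wr r) * icoord (snd r) i) = 0"
    and deg: "(\<Sum>r\<in>R. wr r * nat (Max (insert 0 (range (\<lambda>j. snd r $ j))))) = d" and card: "card R = 4 * d"
    and r: "r \<in> R"
  shows "wr r = 1 \<and> (\<exists>k. snd r = ray_dir k)"
proof -
  define \<mu> where "\<mu> u = Max (insert 0 (range (\<lambda>j. u $ j)))" for u :: "int^3"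
  have \<mu>0: "\<mu> u \<ge> 0" for u unfolding \<mu>_def by simp
  have \<mu>_ge: "\<mu> u \<ge> icoord u i" for u i
  proof -
    have "icoord u i \<in> insert 0 (range (\<lambda>j. u $ j))" using exhaust_4[of i] by (elim disjE) simp_all
    thus ?thesis unfolding \<mu>_def by (intro Max_ge) auto
  qed
  have \<mu>_in: "\<exists>i. \<mu> u = icoord u i" for u
  proof -
    have "\<mu> u \<in> insert 0 (range (\<lambda>j. u $ j))" unfolding \<mu>_def by (rule Max_in) auto
    then consider "\<mu> u = 0" | j where "\<mu> u = u $ j" by auto
    thus ?thesis
    proof cases
      case 1
      thus ?thesis by (intro exI[of _ 4]) simp
    next
      case 2
      thus ?thesis using exhaust_3[of j] icoord_simps[of u] by metis
    qed
  qed
  \<comment> \<open>The sum of the components of \<open>u\<close> in gap coordinates. Balancing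
    cancels the linear part, so the weighted total of \<open>t\<close> over the rays is four times
    the degree.\<close>
  define t where "t u = (\<Sum>i\<in>UNIV. \<mu> u - icoord u i)" for u
  have t1: "t (snd r) \<ge> 1" if "r \<in> R" for r
  proof (rule ccontr)
    assume "\<not> ?thesis"
    moreover have "t (snd r) \<ge> 0" unfolding t_def using \<mu>_ge by (intro sum_nonneg) simp
    ultimately have "t (snd r) = 0" by simp
    hence z: "\<mu> (snd r) - icoord (snd r) i = 0" for i
      unfolding t_def using \<mu>_ge by (subst (asm) sum_nonneg_eq_0_iff) auto
    have "icoord (snd r) i = icoord 0 i" for i using z[of i] z[of 4] by simp
    thus False using icoord_eqI prim[OF that] by blast
  qed
  have ge1: "int (wr r) * t (snd r) \<ge> 1" if "r \<in> R" for r
    using mult_mono[of 1 "int (wr r)" 1 "t (snd r)"] wr[OF that] t1[OF that] by simp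
  have "(\<Sum>r\<in>R. int (wr r) * t (snd r)) = (\<Sum>r\<in>R. \<Sum>i\<in>(UNIV :: 4 set). int (wr r) * \<mu> (snd r) - int (wr r) * icoord (snd r) i)"
    by (simp add: t_def sum_distrib_left right_diff_distrib)
  also have "\<dots> = (\<Sum>i\<in>(UNIV :: 4 set). (\<Sum>r\<in>R. int (wr r) * \<mu> (snd r)) - (\<Sum>r\<in>R. int (wr r) * icoord (snd r) i))"
    by (subst sum.swap) (simp add: sum_subtractf)
  also have "\<dots> = 4 * (\<Sum>r\<in>R. int (wr r) * \<mu> (snd r))" by (simp add: bal)
  also have "(\<Sum>r\<in>R. int (wr r) * \<mu> (snd r)) = int d"
    unfolding deg[symmetric] using \<mu>0 by (simp add: \<mu>_def)
  \<comment> \<open>There are \<open>4 d\<close> terms, each at least 1, with total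
    \<open>4 d\<close>, so every one of them is 1.\<close>
  finally have sum0: "(\<Sum>r\<in>R. int (wr r) * t (snd r) - 1) = 0" using card by (simp add: sum_subtractf)
  have nonneg: "0 \<le> int (wr r) * t (snd r) - 1" if "r \<in> R" for r using ge1[OF that] by simp
  have "\<forall>r\<in>R. int (wr r) * t (snd r) - 1 = 0"
    by (rule sum_nonneg_eq_0_iff[OF fin nonneg, THEN iffD1, OF _ sum0])
  hence eq: "int (wr r) * t (snd r) = 1" using r by simp
  hence wt: "wr r = 1" "t (snd r) = 1" using wr[OF r] t1[OF r] by (auto simp: zmult_eq_1_iff)
  define u where "u = snd r"
  have "\<exists>k. \<mu> u - icoord u k \<noteq> 0"
  proof (rule ccontr)
    assume "\<not> ?thesis"
    hence "t u = 0" by (simp add: t_def)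
    thus False using wt by (simp add: u_def)
  qed
  then obtain k where k: "\<mu> u - icoord u k \<ge> 1" using \<mu>_ge[of u] by (metis diff_ge_0_iff_ge int_one_le_iff_zero_less order_less_le)
  have tk: "1 = (\<mu> u - icoord u k) + (\<Sum>i\<in>-{k}. \<mu> u - icoord u i)"
    using wt(2) by (simp add: t_def u_def[symmetric] sum_UNIV_split[of _ k])
  have nn: "0 \<le> (\<Sum>i\<in>-{k}. \<mu> u - icoord u i)" using \<mu>_ge by (intro sum_nonneg) simp
  have k1: "\<mu> u - icoord u k = 1" using tk nn k by linarith
  hence "(\<Sum>i\<in>-{k}. \<mu> u - icoord u i) = 0" using tk by linarith
  hence oth: "\<mu> u = icoord u i" if "i \<noteq> k" for i
    using that \<mu>_ge by (subst (asm) sum_nonneg_eq_0_iff) auto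
  have \<mu>4: "\<mu> u = (if k = 4 then 1 else 0)" using k1 oth[of 4] by auto
  have "icoord u i = icoord (ray_dir k) i" for i
    using k1 oth[of i] \<mu>4 by (cases "i = k") (simp_all add: icoord_bv)
  hence "u = ray_dir k" by (rule icoord_eqI)
  thus ?thesis using wt(1) by (auto simp: u_def)
qed

text \<open>A missing linear form gets a constant so low that at the finitely many vertices every
  form of the given plane dominates it. Domination extends to segments because the forms are affine,
  and to a step along \<open>ray_dir l\<close> because some index other than \<open>l\<close> is
  present.\<close>

lemma gplane_of_tropical_plane:
  assumes P: "tropical_plane P" and finV: "finite V"
  shows "\<exists>a. (\<forall>v\<in>V. v \<in> P \<longrightarrow> v \<in> gplane a)
    \<and> (\<forall>p\<in>V. \<forall>q\<in>V. closed_segment p q \<subseteq> P \<longrightarrow> closed_segment p q \<subseteq> gplane a)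
    \<and> (\<forall>p\<in>V. \<forall>k. p + int_vec (ray_dir k) \<in> P \<longrightarrow> p + int_vec (ray_dir k) \<in> gplane a)"
proof -
  obtain S a0 where S: "S \<subseteq> {0..3}" "card S \<ge> 2" and
    Pdef: "P = {x. \<exists>i\<in>S. \<exists>j\<in>S. i \<noteq> j \<and> a0 j + coord x j = a0 i + coord x i \<and>
                 (\<forall>k\<in>S. a0 k + coord x k \<le> a0 i + coord x i)}"
    using P unfolding tropical_plane_def by blast
  have n4_onto: "\<exists>i'. coord_index i' = i" if "i \<in> S" for i
  proof -
    have "i = 0 \<or> i = 1 \<or> i = 2 \<or> i = 3" using S(1) that by (auto simp: le_Suc_eq numeral_eq_Suc)
    thus ?thesis using coord_index_simps by metis
  qed
  define T where "T = {i. coord_index i \<in> S}"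
  have T2: "\<exists>i\<in>T. i \<noteq> l" for l
  proof (rule ccontr)
    assume h: "\<not> ?thesis"
    have "S \<subseteq> coord_index ` T" using n4_onto by (force simp: T_def)
    moreover have "T \<subseteq> {l}" using h by auto
    hence "coord_index ` T \<subseteq> {coord_index l}" by auto
    ultimately have "S \<subseteq> {coord_index l}" by (rule order_trans)
    hence "card S \<le> 1" by (metis card_mono finite.emptyI finite.insertI card.empty card_insert_disjoint empty_iff One_nat_def)
    thus False using S(2) by simp
  qed
  define B where "B = (\<lambda>(v, k, i). coord v (coord_index k) - a0 (coord_index i) - coord v (coord_index i)) ` (V \<times> UNIV \<times> (UNIV :: 4 set))"
  \<comment> \<open>The entry 0 keeps \<open>Max\<close> meaningful when \<open>V\<close> is
    empty.\<close>
  define M where "M = Max (insert 0 B)"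
  have M: "coord v (coord_index k) - a0 (coord_index i) - coord v (coord_index i) \<le> M" if "v \<in> V" for v k i
    unfolding M_def
  proof (rule Max_ge)
    show "finite (insert 0 B)" using finV by (simp add: B_def)
    show "coord v (coord_index k) - a0 (coord_index i) - coord v (coord_index i) \<in> insert 0 B"
      unfolding B_def using that by (intro insertI2 image_eqI[of _ _ "(v, k, i)"]) auto
  qed
  define a where "a i = (if i \<in> T then a0 (coord_index i) else - M)" for i
  have low: "lform a v k \<le> lform a v i" if "v \<in> V" "k \<notin> T" "i \<in> T" for v k i
    using M[OF that(1), of k i] that(2,3) by (simp add: lform_def a_def)
  have key: "x \<in> gplane a" if x: "x \<in> P" and dom: "\<And>k. k \<notin> T \<Longrightarrow> \<exists>i\<in>T. lform a x k \<le> lform a x i" for x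
  proof -
    obtain i j where ij: "i \<in> S" "j \<in> S" "i \<noteq> j" "a0 j + coord x j = a0 i + coord x i"
      "\<forall>k\<in>S. a0 k + coord x k \<le> a0 i + coord x i" using x unfolding Pdef by blast
    obtain i' j' where i': "coord_index i' = i" "coord_index j' = j" using n4_onto ij by metis
    have inT: "i' \<in> T" "j' \<in> T" using i' ij by (auto simp: T_def)
    have le: "lform a x k \<le> lform a x i'" if "k \<in> T" for k
      using that inT ij(5) i' by (auto simp: lform_def a_def T_def)
    hence all: "lform a x k \<le> lform a x i'" for k
      using dom[of k] by (cases "k \<in> T") (auto intro: order_trans)
    have "lform a x j' = lform a x i'" using inT ij(4) i' by (simp add: lform_def a_def)
    hence "gap a x i' = 0" "gap a x j' = 0" using all by (auto simp: gap_zero_iff)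
    moreover have "i' \<noteq> j'" using i' ij(3) by auto
    ultimately show ?thesis by (auto simp: gplane_def)
  qed
  have "v \<in> gplane a" if "v \<in> V" "v \<in> P" for v
    using key[OF that(2)] low[OF that(1)] T2 by blast
  moreover have "closed_segment p q \<subseteq> gplane a" if pq: "p \<in> V" "q \<in> V" "closed_segment p q \<subseteq> P" for p q
  proof
    fix x assume x: "x \<in> closed_segment p q"
    then obtain u where u: "0 \<le> u" "u \<le> 1" "x = (1 - u) *\<^sub>R p + u *\<^sub>R q" by (auto simp: in_segment)
    have lx: "lform a x i = (1 - u) * lform a p i + u * lform a q i" for i
      unfolding u(3) lform_def by (simp add: coord_def algebra_simps)
    show "x \<in> gplane a"
    proof (rule key)
      show "x \<in> P" using x pq by blast
      fix k assume k: "k \<notin> T"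
      obtain i where i: "i \<in> T" using T2 by blast
      have "lform a x k \<le> lform a x i" unfolding lx
        using low[OF pq(1) k i] low[OF pq(2) k i] u by (intro add_mono mult_left_mono) auto
      thus "\<exists>i\<in>T. lform a x k \<le> lform a x i" using i by blast
    qed
  qed
  moreover have "p + int_vec (ray_dir l) \<in> gplane a" if p: "p \<in> V" "p + int_vec (ray_dir l) \<in> P" for p l
  proof (rule key[OF p(2)])
    fix k assume k: "k \<notin> T"
    obtain i where i: "i \<in> T" "i \<noteq> l" using T2 by blast
    have lx: "lform a (p + int_vec (ray_dir l)) j = lform a p j + of_int (icoord (ray_dir l) j)" for j
      using lform_affine[of a p 1 "int_vec (ray_dir l)" j] by (simp add: coord_int_vec)
    have "lform a (p + int_vec (ray_dir l)) k \<le> lform a (p + int_vec (ray_dir l)) i"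
      unfolding lx icoord_bv using low[OF p(1) k i(1)] i(2) by (cases "k = l") simp_all
    thus "\<exists>i\<in>T. lform a (p + int_vec (ray_dir l)) k \<le> lform a (p + int_vec (ray_dir l)) i" using i by blast
  qed
  ultimately show ?thesis by blast
qed

section \<open>From edges to darts, and assembly over the components\<close>

lemma card_darts:
  assumes fin: "finite E" and E: "\<And>e. e \<in> E \<Longrightarrow> \<exists>p q. e = {p, q} \<and> p \<noteq> q"
  shows "card {(p, q). {p, q} \<in> E} = 2 * card E" "finite {(p, q). {p, q} \<in> E}"
proof -
  let ?G = "{(p, q). {p, q} \<in> E}"
  have "?G \<subseteq> \<Union> E \<times> \<Union> E" by auto
  moreover have "finite e" if "e \<in> E" for e using E[OF that] by auto
  ultimately show finG: "finite ?G" using fin by (meson finite_SigmaI finite_Union finite_subset)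
  have fib: "card {x\<in>?G. {fst x, snd x} = e} = 2" if e: "e \<in> E" for e
  proof -
    obtain p q where pq: "e = {p, q}" "p \<noteq> q" using E[OF e] by blast
    hence "{x\<in>?G. {fst x, snd x} = e} = {(p, q), (q, p)}" using e by (auto simp: doubleton_eq_iff insert_commute)
    thus ?thesis using pq by simp
  qed
  have "card ?G = (\<Sum>x\<in>?G. 1)" by simp
  also have "\<dots> = (\<Sum>e\<in>E. \<Sum>x\<in>{x\<in>?G. {fst x, snd x} = e}. 1)"
    by (rule sum.group[symmetric, OF finG fin]) auto
  also have "\<dots> = (\<Sum>e\<in>E. 2)" using fib by (intro sum.cong refl) simp
  finally show "card ?G = 2 * card E" by simp
qed

theorem theorem1p3:
  fixes d :: nat
    and V :: "(real^3) set" and E :: "(real^3) set set" and R :: "((real^3) \<times> (int^3)) set"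
    and w :: "(real^3) set \<Rightarrow> nat" and wr :: "(real^3) \<times> (int^3) \<Rightarrow> nat"
  assumes "d \<ge> 1"
    and "tropical_curve V E R w wr"
    and "planar V E R"
    and "degree R wr = d"
    and "card R = 4 * d"
  shows "genus V E \<le> (int d - 1) * (int d - 2)"
proof -
  note T = assms(2)[unfolded tropical_curve_def]
  have fin: "finite V \<and> finite E \<and> finite R" using T by (elim conjE) (intro conjI)
  note fin = fin[THEN conjunct1] fin[THEN conjunct2, THEN conjunct1] fin[THEN conjunct2, THEN conjunct2]
  have E_sub: "E \<subseteq> {{p, q} | p q. p \<in> V \<and> q \<in> V \<and> p \<noteq> q}" using T by (elim conjE)
  have R_sub: "R \<subseteq> {(p, u). p \<in> V \<and> primitive u}" using T by (elim conjE)
  have w_pos: "\<forall>e\<in>E. w e > 0" using T by (elim conjE)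
  have wr_pos: "\<forall>r\<in>R. wr r > 0" using T by (elim conjE)
  have rational: "\<forall>p q. {p, q} \<in> E \<longrightarrow> (\<exists>u. prim_dir p q u)" using T by (elim conjE)
  have balance: "\<forall>v\<in>V. (\<Sum>q\<in>{q. {v, q} \<in> E}. int (w {v, q}) *s (THE u. prim_dir v q u))
      + (\<Sum>r\<in>{r\<in>R. fst r = v}. int (wr r) *s snd r) = 0" using T by (elim conjE)
  have seg_all: "\<forall>p q. {p, q} \<in> E \<longrightarrow> closed_segment p q \<inter> V = {p, q}" using T by (elim conjE)
  hence seg_V: "closed_segment p q \<inter> V = {p, q}" if "{p, q} \<in> E" for p q using that by simp
  have ray_all: "\<forall>p u. (p, u) \<in> R \<longrightarrow> ray p u \<inter> V = {p}" using T by (elim conjE)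
  hence ray_V: "ray p u \<inter> V = {p}" if "(p, u) \<in> R" for p u using that by simp
  have cells_meet: "\<forall>c1\<in>cells E R. \<forall>c2\<in>cells E R. c1 \<noteq> c2 \<longrightarrow> c1 \<inter> c2 \<subseteq> V" using T by (elim conjE)
  define dr where "dr p q = (THE u. prim_dir p q u)" for p q
  have dr: "prim_dir p q (dr p q)" if pq: "{p, q} \<in> E" for p q
  proof -
    obtain u where u: "prim_dir p q u" using rational pq by blast
    hence "dr p q = u" unfolding dr_def using prim_dir_unique by blast
    thus ?thesis using u by simp
  qed
  have ends: "p \<in> V" "q \<in> V" "p \<noteq> q" if "{p, q} \<in> E" for p q
    using that E_sub by (auto simp: doubleton_eq_iff)
  have dr_commute: "dr q p = - dr p q" if "{p, q} \<in> E" for p q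
    using prim_dir_unique[OF dr prim_dir_commute[OF dr[OF that]]] that by (simp add: insert_commute)
  define G where "G = {(p, q). {p, q} \<in> E}"
  have cardG: "card G = 2 * card E" and finG: "finite G"
    using card_darts[OF fin(2)] E_sub unfolding G_def by blast+
  have "(\<Sum>r\<in>R. int (wr r) * icoord (snd r) i) = 0" for i
  proof (rule balanced_rays[OF fin(1) _ _ _ fin(3), where G = G and g = "\<lambda>p q. int (w {p, q}) * icoord (dr p q) i"])
    show "G \<subseteq> V \<times> V" using ends by (auto simp: G_def)
    show "(q, p) \<in> G" if "(p, q) \<in> G" for p q using that by (simp add: G_def insert_commute)
    show "int (w {q, p}) * icoord (dr q p) i = - (int (w {p, q}) * icoord (dr p q) i)" if "(p, q) \<in> G" for p q
      using that dr_commute[of p q] by (simp add: G_def icoord_minus insert_commute)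
    show "fst ` R \<subseteq> V" using R_sub by auto
    show "(\<Sum>q\<in>{q. (v, q) \<in> G}. int (w {v, q}) * icoord (dr v q) i)
        + (\<Sum>r\<in>{r\<in>R. fst r = v}. int (wr r) * icoord (snd r) i) = 0" if "v \<in> V" for v
      using arg_cong[OF bspec[OF balance that], of "\<lambda>u. icoord u i"]
      by (simp add: icoord_add icoord_sum icoord_smult G_def dr_def)
  qed
  moreover have "snd r \<noteq> 0" if "r \<in> R" for r using R_sub that by (auto simp: primitive_def)
  ultimately have basic: "wr r = 1 \<and> (\<exists>k. snd r = ray_dir k)" if "r \<in> R" for r
    using basic_rays[OF fin(3), of wr d r] wr_pos assms(4,5) that by (auto simp: degree_def)

  obtain P where P: "tropical_plane P" "support V E R \<subseteq> P" using assms(3) by (auto simp: planar_def)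
  obtain a where a: "\<forall>v\<in>V. v \<in> P \<longrightarrow> v \<in> gplane a"
    "\<forall>p\<in>V. \<forall>q\<in>V. closed_segment p q \<subseteq> P \<longrightarrow> closed_segment p q \<subseteq> gplane a"
    "\<forall>p\<in>V. \<forall>k. p + int_vec (ray_dir k) \<in> P \<longrightarrow> p + int_vec (ray_dir k) \<in> gplane a"
    using gplane_of_tropical_plane[OF P(1) fin(1)] by blast
  have V_plane: "V \<subseteq> gplane a" using a(1) P(2) by (auto simp: support_def)
  have seg_plane: "closed_segment p q \<subseteq> gplane a" if "{p, q} \<in> E" for p q
  proof -
    have "closed_segment p q \<subseteq> support V E R" using that by (auto simp: support_def cells_def)
    thus ?thesis using a(2) P(2) ends[OF that] by blast
  qed
  have ray_plane: "p + int_vec u \<in> gplane a" if pu: "(p, u) \<in> R" for p u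
  proof -
    obtain k where k: "u = ray_dir k" using basic[OF pu] by auto
    have "p + int_vec u \<in> ray p u" by (auto simp: ray_def intro!: exI[of _ 1])
    moreover have "ray p u \<in> cells E R" using pu by (auto simp: cells_def)
    ultimately have "p + int_vec u \<in> support V E R" unfolding support_def by blast
    moreover have "p \<in> V" using R_sub pu by auto
    ultimately show ?thesis using a(3) P(2) k by blast
  qed

  define rel where "rel = (adj E)\<^sup>*"
  define comps where "comps = V // rel"
  have adj_sym: "sym (adj E)" by (auto simp: adj_def sym_def insert_commute)
  have rel_V: "y \<in> V" if "(x, y) \<in> rel" "x \<in> V" for x y
    using that unfolding rel_def by (induction rule: rtrancl_induct) (auto simp: adj_def dest: ends)
  \<comment> \<open>The closure \<open>rel\<close> is reflexive on the whole space; restricted to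
    \<open>V\<close> it is an equivalence with the same classes.\<close>
  define rel' where "rel' = rel \<inter> V \<times> V"
  have equiv: "equiv V rel'"
  proof (rule equivI)
    show "rel' \<subseteq> V \<times> V" by (auto simp: rel'_def)
    show "refl_on V rel'" by (auto simp: rel'_def rel_def refl_on_def)
    show "sym rel'" using sym_rtrancl[OF adj_sym] by (auto simp: rel'_def rel_def sym_def)
    show "trans rel'" using trans_rtrancl[of "adj E"] unfolding rel'_def rel_def trans_def by blast
  qed
  have comps': "comps = V // rel'"
  proof -
    have "rel `` {x} = rel' `` {x}" if "x \<in> V" for x using rel_V that by (auto simp: rel'_def)
    thus ?thesis by (auto simp: comps_def quotient_def)
  qed
  have comps_V: "\<Union> comps = V" unfolding comps' by (rule Union_quotient[OF equiv])
  have comps_fin: "finite comps" unfolding comps' by (rule finite_quotient[OF fin(1)]) (auto simp: rel'_def)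
  have comps_disj: "K \<inter> K' = {}" if "K \<in> comps" "K' \<in> comps" "K \<noteq> K'" for K K'
    using quotient_disj[OF equiv] that unfolding comps' by blast
  have closed: "q \<in> K" if K: "K \<in> comps" and "p \<in> K" "{p, q} \<in> E" for K p q
  proof -
    obtain x where "x \<in> V" "K = rel `` {x}" using K by (auto simp: comps_def quotient_def)
    moreover have "(p, q) \<in> adj E" using \<open>{p, q} \<in> E\<close> by (simp add: adj_def)
    ultimately show ?thesis using \<open>p \<in> K\<close> by (auto simp: rel_def intro: rtrancl_into_rtrancl)
  qed
  define GK where "GK K = {x\<in>G. fst x \<in> K}" for K
  define RK where "RK K = {r\<in>R. fst r \<in> K}" for K
  have part: "embedded_plane_graph a K (GK K) (RK K) dr (\<lambda>p q. w {p, q})" if K: "K \<in> comps" for K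
  proof
    have KV: "K \<subseteq> V" using K comps_V by blast
    have mem: "{p, q} \<in> E \<and> p \<in> K \<and> q \<in> K" if "(p, q) \<in> GK K" for p q
      using that closed[OF K] by (auto simp: GK_def G_def)
    show "finite K" using KV fin(1) by (rule finite_subset)
    show "finite (RK K)" using fin(3) by (simp add: RK_def)
    show "GK K \<subseteq> K \<times> K" using mem by auto
    show "(q, p) \<in> GK K" if "(p, q) \<in> GK K" for p q
      using mem[OF that] by (simp add: GK_def G_def insert_commute)
    show "(p, p) \<notin> GK K" for p using mem[of p p] ends(3)[of p p] by blast
    show "p \<in> K" if "(p, u) \<in> RK K" for p u using that by (simp add: RK_def)
    show "prim_dir p q (dr p q)" if "(p, q) \<in> GK K" for p q using dr mem[OF that] by blast
    show "w {p, q} > 0" if "(p, q) \<in> GK K" for p q using w_pos mem[OF that] by blast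
    show "w {q, p} = w {p, q}" for p q by (simp add: insert_commute)
    show "\<exists>k. u = ray_dir k" if "(p, u) \<in> RK K" for p u using basic[of "(p, u)"] that by (simp add: RK_def)
    show "(\<Sum>q\<in>{q. (v, q) \<in> GK K}. int (w {v, q}) *s dr v q) + (\<Sum>r\<in>{r\<in>RK K. fst r = v}. snd r) = 0"
      if v: "v \<in> K" for v
    proof -
      have "v \<in> V" using v KV by blast
      note ray_dir = bspec[OF balance this]
      have "{q. (v, q) \<in> GK K} = {q. {v, q} \<in> E}" using v by (auto simp: GK_def G_def)
      moreover have "{r\<in>RK K. fst r = v} = {r\<in>R. fst r = v}" using v by (auto simp: RK_def)
      moreover have "(\<Sum>r\<in>{r\<in>R. fst r = v}. int (wr r) *s snd r) = (\<Sum>r\<in>{r\<in>R. fst r = v}. snd r)"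
        using basic by (intro sum.cong refl) simp
      ultimately show ?thesis using ray_dir by (simp add: dr_def)
    qed
    show "q = q'" if h: "(v, q) \<in> GK K" "(v, q') \<in> GK K" "dr v q = dr v q'" for v q q'
    proof (rule ccontr)
      assume ne: "q \<noteq> q'"
      have E: "{v, q} \<in> E" "{v, q'} \<in> E" using mem h by blast+
      \<comment> \<open>Of two edges leaving \<open>v\<close> in the same direction, the end of the
        shorter one would be a vertex inside the longer one.\<close>
      have no: False if F: "{v, x} \<in> E" "{v, y} \<in> E" "x \<noteq> y" and c: "c > 0" "x - v = c *\<^sub>R int_vec u"
        and c': "y - v = c' *\<^sub>R int_vec u" "c \<le> c'" for x y c c' u
      proof -
        have "x = v + (c / c') *\<^sub>R (y - v)" using c c' by (simp add: algebra_simps)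
        hence "x = (1 - c / c') *\<^sub>R v + (c / c') *\<^sub>R y" by (simp add: algebra_simps)
        moreover have "0 \<le> c / c'" "c / c' \<le> 1" using c c' by auto
        ultimately have "x \<in> closed_segment v y" unfolding in_segment by blast
        hence "x \<in> {v, y}" using seg_V[OF F(2)] ends[OF F(1)] by blast
        thus False using F ends(3)[OF F(1)] by blast
      qed
      obtain c where c: "c > 0" "q - v = c *\<^sub>R int_vec (dr v q)" using dr[OF E(1)] by (auto simp: prim_dir_def)
      obtain c' where c': "c' > 0" "q' - v = c' *\<^sub>R int_vec (dr v q)" using dr[OF E(2)] h(3) by (auto simp: prim_dir_def)
      show False using no[OF E ne c c'(2)] no[OF E(2,1) ne[symmetric] c' c(2)] by linarith
    qed
    show "(v, dr v q) \<notin> RK K" if h: "(v, q) \<in> GK K" for v q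
    proof
      assume "(v, dr v q) \<in> RK K"
      hence r: "(v, dr v q) \<in> R" by (simp add: RK_def)
      have E: "{v, q} \<in> E" using mem[OF h] by blast
      obtain c where c: "c > 0" "q - v = c *\<^sub>R int_vec (dr v q)" using dr[OF E] by (auto simp: prim_dir_def)
      have "q = v + c *\<^sub>R int_vec (dr v q)" unfolding c(2)[symmetric] by simp
      hence "q \<in> ray v (dr v q)" unfolding ray_def using c(1) by (auto intro!: exI[of _ c])
      hence "q \<in> {v}" unfolding ray_V[OF r, symmetric] using ends[OF E] by simp
      thus False using ends[OF E] by simp
    qed
    show "K \<subseteq> gplane a" using KV V_plane by blast
    show "closed_segment p q \<subseteq> gplane a" if "(p, q) \<in> GK K" for p q using seg_plane mem[OF that] by blast
    show "p + int_vec u \<in> gplane a" if "(p, u) \<in> RK K" for p u using ray_plane that by (simp add: RK_def)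
    show "open_segment p q \<inter> K = {}" if "(p, q) \<in> GK K" for p q
      using seg_V[of p q] mem[OF that] KV by (auto simp: open_segment_def)
    show "{p, q} = {p', q'}" if h: "(p, q) \<in> GK K" "(p', q') \<in> GK K" "x \<in> open_segment p q" "x \<in> open_segment p' q'"
      for p q p' q' x
    proof -
      have "closed_segment p q = closed_segment p' q'"
      proof (rule ccontr)
        assume ne: "closed_segment p q \<noteq> closed_segment p' q'"
        have "closed_segment p q \<in> cells E R" "closed_segment p' q' \<in> cells E R"
          using mem[OF h(1)] mem[OF h(2)] by (auto simp: cells_def)
        hence "x \<in> V" using cells_meet ne h(3,4) by (meson IntI open_closed_segment subsetD)
        thus False using seg_V[of p q] mem[OF h(1)] h(3) by (auto simp: open_segment_def)
      qed
      thus ?thesis by (simp add: closed_segment_eq)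
    qed
  qed

  define n where "n K = card (RK K) div 4" for K
  have RK4: "card (RK K) = 4 * n K" if "K \<in> comps" for K
  proof -
    interpret embedded_plane_graph a K "GK K" "RK K" dr "\<lambda>p q. w {p, q}" by (rule part[OF that])
    show ?thesis using rays_divisible by (auto simp: n_def)
  qed
  have bound: "int (card (GK K)) - 2 * int (card K) + 2 \<le> 2 * max_genus (int (n K))" if K: "K \<in> comps" for K
  proof -
    interpret embedded_plane_graph a K "GK K" "RK K" dr "\<lambda>p q. w {p, q}" by (rule part[OF K])
    show ?thesis
    proof (cases "n K = 0")
      case True
      hence "RK K = {}" using RK4[OF K] finR by simp
      hence G0: "GK K = {}" by (rule no_darts_if_no_rays)
      obtain x where x: "x \<in> V" "K = rel `` {x}" using K by (auto simp: comps_def quotient_def)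
      have "y = x" if xy: "(x, y) \<in> rel" for y
      proof (rule ccontr)
        assume "y \<noteq> x"
        then obtain z where "(x, z) \<in> adj E" using xy unfolding rel_def by (metis converse_rtranclE)
        hence "(x, z) \<in> GK K" using x by (simp add: GK_def G_def adj_def rel_def)
        thus False using G0 by simp
      qed
      hence "K = {x}" using x by (auto simp: rel_def)
      thus ?thesis using G0 True by (simp add: max_genus_def)
    next
      case False
      \<comment> \<open>Moving \<open>4 n\<close> to the right and adding 2 leaves
        \<open>2 n^2 - 6 n + 4\<close>, which is \<open>2 (n - 1) (n - 2)\<close>.\<close>
      have "int (card (GK K)) + 4 * int (n K) - 2 * int (card K) \<le> 2 * (int (n K))^2 - 2 * int (n K) + 2"
        using dart_count_bound_embedded[of "int (n K)"] RK4[OF K] False by simp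
      thus ?thesis using False by (simp add: max_genus_def power2_eq_square algebra_simps)
    qed
  qed
  have cV: "card V = (\<Sum>K\<in>comps. card K)"
    using card_Union_disjoint[of comps] comps_disj comps_V fin(1)
    by (metis (no_types, lifting) Union_upper disjnt_def finite_subset pairwiseI)
  have group: "(\<Sum>K\<in>comps. card {x\<in>A. fst x \<in> K}) = card A" if "finite A" "fst ` A \<subseteq> V"
    for A :: "((real^3) \<times> 'b) set"
  proof -
    have "A = (\<Union>K\<in>comps. {x\<in>A. fst x \<in> K})" using that(2) comps_V by auto
    hence "card A = card (\<Union>K\<in>comps. {x\<in>A. fst x \<in> K})" by simp
    also have "\<dots> = (\<Sum>K\<in>comps. card {x\<in>A. fst x \<in> K})"
    proof (intro card_UN_disjoint ballI impI)
      show "{x\<in>A. fst x \<in> K} \<inter> {x\<in>A. fst x \<in> K'} = {}" if "K \<in> comps" "K' \<in> comps" "K \<noteq> K'" for K K'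
        using comps_disj[OF that] by blast
    qed (use comps_fin that(1) in simp_all)
    finally show ?thesis by simp
  qed
  have cG: "card G = (\<Sum>K\<in>comps. card (GK K))"
    unfolding GK_def using ends by (intro group[symmetric] finG) (auto simp: G_def)
  have "card R = (\<Sum>K\<in>comps. card (RK K))"
    unfolding RK_def using R_sub by (intro group[symmetric] fin(3)) auto
  also have "\<dots> = 4 * (\<Sum>K\<in>comps. n K)" unfolding sum_distrib_left using RK4 by (intro sum.cong) auto
  finally have nd: "(\<Sum>K\<in>comps. int (n K)) = int d" using assms(5) by (simp flip: of_nat_sum)
  have "2 * genus V E = int (card G) - 2 * int (card V) + 2 * int (card comps)"
    unfolding genus_def cardG comps_def rel_def by simp
  also have "\<dots> = (\<Sum>K\<in>comps. int (card (GK K)) - 2 * int (card K) + 2)"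
    unfolding cG cV by (simp add: sum.distrib sum_subtractf sum_distrib_left)
  also have "\<dots> \<le> (\<Sum>K\<in>comps. 2 * max_genus (int (n K)))" using bound by (intro sum_mono)
  also have "\<dots> = 2 * (\<Sum>K\<in>comps. max_genus (int (n K)))" by (simp add: sum_distrib_left)
  also have "\<dots> \<le> 2 * max_genus (int d)"
    using sum_max_genus_le[OF comps_fin, of "\<lambda>K. int (n K)"] nd by simp
  finally show ?thesis using assms(1) by (simp add: max_genus_def)
qed

end
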